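(* Let $\phi$ be a fermionic (odd) superfield, let $L=(\mathcal{D}^3+\phi)(\mathcal{D}^3+\phi)$, and consider the supersymmetric Sawada-Kotera hierarchy $$\frac{\partial L}{\partial t_n}=[(L^{\frac n3})_+,L],$$ whose flows are nontrivial only if $n$ is an integer with $n\not\equiv 0\ (\mathrm{mod}\ 3)$ and $n\equiv 1\ (\mathrm{mod}\ 2)$. The operator $$\begin{aligned} \mathscr{R}=\;&\partial_x^6+6(\mathcal{D}\phi)\partial_x^4+9(\mathcal{D}\phi_x)\partial_x^3+6\phi_{xx}\partial_x^2\mathcal{D}+\{5(\mathcal{D}\phi_{xx})+9(\mathcal{D}\phi)^2\}\partial_x^2\\ &+\{9\phi_{xxx}+12\phi_x(\mathcal{D}\phi)\}\partial_x\mathcal{D}+\{(\mathcal{D}\phi_{xxx})+9(\mathcal{D}\phi_x)(\mathcal{D}\phi)\}\partial_x\\ &+\{5\phi_{xxxx}+12\phi_{xx}(\mathcal{D}\phi)+6\phi_x(\mathcal{D}\phi_x)\}\mathcal{D}+\{4(\mathcal{D}\phi_{xx})(\mathcal{D}\phi)+4(\mathcal{D}\phi)^3-3\phi_{xx}\phi_x\}\\ &+\{\phi_{xxxxx}+5\phi_{xxx}(\mathcal{D}\phi)+5\phi_{xx}(\mathcal{D}\phi_x)+2\phi_x(\mathcal{D}\phi_{xx})+6\phi_x(\mathcal{D}\phi)^2\}\mathcal{D}^{-1}\\ &-\{2(\mathcal{D}\phi_{xx})+2(\mathcal{D}\phi)^2\}\mathcal{D}^{-1}\phi_x-4\phi_x(\mathcal{D}\phi)\partial_x^{-1}\phi_x-2(\mathcal{D}\phi)\mathcal{D}^{-1}[\phi_{xxx}+2\phi_x(\mathcal{D}\phi)]\\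 &-2\phi_x\mathcal{D}^{-1}\{(\phi_{xxx}+\phi_x(\mathcal{D}\phi))\mathcal{D}^{-1}-3(\mathcal{D}\phi)\mathcal{D}^{-1}\phi_x-2\phi_x\partial_x^{-1}\phi_x+2\mathcal{D}^{-1}[\phi_{xxx}+2\phi_x(\mathcal{D}\phi)]\} \end{aligned}$$ is a recursion operator for the supersymmetric Sawada-Kotera equation $$\phi_{t}+\phi_{xxxxx}+5\phi_{xxx}(\mathcal{D}\phi)+5\phi_{xx}(\mathcal{D}\phi_x)+5\phi_x(\mathcal{D}\phi)^2=0$$ and its hierarchy: the flow achieved by applying the recursion operator to the $t_n$-flow is the $t_{n+6}$-flow $\partial L/\partial t_{n+6}=[(L^{\frac{n+6}{3}})_+,L]$.
   Context: Superspace has one even coordinate $x$ and one odd coordinate $\theta$; $\mathcal{D}=\partial_\theta+\theta\partial_x$ is the super derivative, so $\mathcal{D}^2=\partial_x$. $(\mathcal{D}f)$ with parentheses denotes $\mathcal{D}$ applied to $f$, and a subscript $x$ denotes the $x$-derivative. Super pseudodifferential operators are formal series in decreasing powers of $\mathcal{D}$; $(\cdot)_+$ is the projection to the differential part, $(\cdot)_-$ is the complementary part, and $[A,B]=AB-(-1)^{|A||B|}BA$ is the supercommutator. $L^{1/3}=\partial_x+\cdots$ is the cube root of $L$. The supersymmetric Sawada-Kotera equation is the flow $\partial L/\partial t=[9(L^{5/3})_+,L]$. In $\mathscr{R}$, functions act by left multiplication, and $\mathcal{D},\partial_x$ and their formal inverses $\mathcal{D}^{-1},\partial_x^{-1}$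 act as operators on everything to their right. The operator is derived from the relation $\partial L/\partial t_{n+6}=L^2\,\partial L/\partial t_n+[R_n,L]$, where $R_n=\left(L^2(L^{n/3})_-\right)_+$ is a differential operator whose coefficients are expressed through $\phi$ and $\phi_n=\partial\phi/\partial t_n$ by solving a system of differential equations coming from this relation. Because of nonlocality this solution involves a certain ambiguity, and to avoid it the $t_7$-flow was used, in the form $$\begin{aligned}\phi_{t_7}=\;&\phi_{xxxxxxx}+7\phi_{xxxxx}(\mathcal{D}\phi)+14\phi_{xxxx}(\mathcal{D}\phi_x)+14\phi_{xxx}(\mathcal{D}\phi_{xx})+14\phi_{xxx}(\mathcal{D}\phi)^2\\&+7\phi_{xx}(\mathcal{D}\phi_{xxx})+28\phi_{xx}(\mathcal{D}\phi_x)(\mathcal{D}\phi)+14\phi_x(\mathcal{D}\phi_{xx})(\mathcal{D}\phi)+7\phi_x(\mathcal{D}\phi_x)^2+\tfrac{28}{3}\phi_x(\mathcal{D}\phi)^3.\end{aligned}$$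
   Formalization: With every time normalised by ∂L/∂t_n=[(L^{n/3})_+,L], R applied to the t_n-flow is −27 times the t_{n+6}-flow (already visible at n=1: φ_{7x}+… against −φ_{7x}/27+…), so the recursion is stated with this constant; the equation is the t_5-flow with time rescaled by 9. *)

theory Defs
  imports Complex_Main "HOL-Library.Multiset"
begin

section \<open>Superdifferential polynomials in one odd superfield\<close>

text \<open>
  The superfield is generic: superfields are elements of the free supercommutative algebra over a
  field of characteristic 0 on generators \<open>\<phi>, D \<phi>, D\<^sup>2 \<phi>, ...\<close>. Generator number
  \<open>k\<close> is \<open>D\<^sup>k \<phi>\<close>; since \<open>\<phi>\<close> and \<open>D\<close> are odd, it is fermionic iff
  \<open>k\<close> is even. A monomial is a multiset of generators, read as their product in ascending
  order, and it vanishes if a fermionic generator is repeated.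
\<close>

definition admissible :: "nat multiset \<Rightarrow> bool" where
  "admissible M \<longleftrightarrow> (\<forall>k. even k \<longrightarrow> count M k \<le> 1)"

definition fdeg :: "nat multiset \<Rightarrow> nat" where
  "fdeg M = size {#k \<in># M. even k#}"

text \<open>Number of transpositions of fermionic generators needed to sort the product of two
  sorted monomials.\<close>

definition crossings :: "nat multiset \<Rightarrow> nat multiset \<Rightarrow> nat" where
  "crossings M N = (\<Sum>a\<in>#M. \<Sum>b\<in>#N. of_bool (even a \<and> even b \<and> b < a))"

typedef (overloaded) 'k sdp =
  "{f :: nat multiset \<Rightarrow> 'k::field_char_0. finite {M. f M \<noteq> 0} \<and> (\<forall>M. f M \<noteq> 0 \<longrightarrow> admissible M)}"
  morphisms mcoeff Abs_sdp
  by (rule exI[of _ "\<lambda>_. 0"]) simp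

setup_lifting type_definition_sdp

lemma sdp_eqI: "(\<And>M. mcoeff f M = mcoeff g M) \<Longrightarrow> f = g"
  by (metis ext mcoeff_inject)

lemma finite_mcoeff [simp]: "finite {M. mcoeff f M \<noteq> 0}"
  using mcoeff[of f] by simp

lemma mcoeff_admissible: "mcoeff f M \<noteq> 0 \<Longrightarrow> admissible M"
  using mcoeff[of f] by simp

lemma admissible_subset: "admissible P \<Longrightarrow> M \<subseteq># P \<Longrightarrow> admissible M"
  unfolding admissible_def by (meson mset_subset_eq_count order_trans)

lemma finite_submultisets [simp]: "finite {M. M \<subseteq># (P :: 'a multiset)}"
proof (induction P)
  case (add x P)
  have "{M. M \<subseteq># add_mset x P} \<subseteq> {M. M \<subseteq># P} \<union> add_mset x ` {M. M \<subseteq># P}"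
  proof
    fix M assume "M \<in> {M. M \<subseteq># add_mset x P}"
    then have M: "M \<subseteq># add_mset x P" by simp
    show "M \<in> {M. M \<subseteq># P} \<union> add_mset x ` {M. M \<subseteq># P}"
    proof (cases "x \<in># M")
      case True
      then obtain N where "M = add_mset x N" by (metis insert_DiffM)
      with M show ?thesis by simp
    next
      case False
      with M have "M \<subseteq># P"
        by (metis Diff_eq_empty_iff_mset diff_single_trivial mset_subset_eq_add_mset_cancel
            add_mset_add_single diff_add_mset_swap subset_eq_diff_conv)
      then show ?thesis by simp
    qed
  qed
  then show ?case using add by (meson finite_Un finite_imageI finite_subset)
qed simp

instantiation sdp :: (field_char_0) ring_1
begin

lift_definition zero_sdp :: "'a sdp" is "\<lambda>_. 0" by simp

lift_definition one_sdp :: "'a sdp" is "\<lambda>M. of_bool (M = {#})"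
  by (auto simp: admissible_def)

lift_definition plus_sdp :: "'a sdp \<Rightarrow> 'a sdp \<Rightarrow> 'a sdp" is "\<lambda>f g M. f M + g M"
proof -
  fix f g :: "nat multiset \<Rightarrow> 'a"
  assume a: "finite {M. f M \<noteq> 0} \<and> (\<forall>M. f M \<noteq> 0 \<longrightarrow> admissible M)"
    "finite {M. g M \<noteq> 0} \<and> (\<forall>M. g M \<noteq> 0 \<longrightarrow> admissible M)"
  have "{M. f M + g M \<noteq> 0} \<subseteq> {M. f M \<noteq> 0} \<union> {M. g M \<noteq> 0}" by auto
  with a have "finite {M. f M + g M \<noteq> 0}" by (meson finite_Un finite_subset)
  with a show "finite {M. f M + g M \<noteq> 0} \<and> (\<forall>M. f M + g M \<noteq> 0 \<longrightarrow> admissible M)"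
    by (metis add_0)
qed

lift_definition uminus_sdp :: "'a sdp \<Rightarrow> 'a sdp" is "\<lambda>f M. - f M" by simp

definition minus_sdp :: "'a sdp \<Rightarrow> 'a sdp \<Rightarrow> 'a sdp" where "f - g = f + - (g :: 'a sdp)"

lift_definition times_sdp :: "'a sdp \<Rightarrow> 'a sdp \<Rightarrow> 'a sdp" is
  "\<lambda>f g P. if admissible P
      then \<Sum>M\<in>{M. M \<subseteq># P}. (-1) ^ crossings M (P - M) * f M * g (P - M) else 0"
proof -
  fix f g :: "nat multiset \<Rightarrow> 'a"
  assume a: "finite {M. f M \<noteq> 0} \<and> (\<forall>M. f M \<noteq> 0 \<longrightarrow> admissible M)"
    "finite {M. g M \<noteq> 0} \<and> (\<forall>M. g M \<noteq> 0 \<longrightarrow> admissible M)"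
  let ?h = "\<lambda>P. if admissible P
      then \<Sum>M\<in>{M. M \<subseteq># P}. (-1) ^ crossings M (P - M) * f M * g (P - M) else 0"
  have "{P. ?h P \<noteq> 0} \<subseteq> (\<lambda>(M, N). M + N) ` ({M. f M \<noteq> 0} \<times> {N. g N \<noteq> 0})"
  proof
    fix P assume "P \<in> {P. ?h P \<noteq> 0}"
    then have "(\<Sum>M\<in>{M. M \<subseteq># P}. (-1) ^ crossings M (P - M) * f M * g (P - M)) \<noteq> 0"
      by (auto split: if_splits)
    then obtain M where "M \<subseteq># P" "f M \<noteq> 0" "g (P - M) \<noteq> 0"
      by (smt (verit) mem_Collect_eq mult_zero_left mult_zero_right sum.neutral)
    then show "P \<in> (\<lambda>(M, N). M + N) ` ({M. f M \<noteq> 0} \<times> {N. g N \<noteq> 0})"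
      by (intro image_eqI[of _ _ "(M, P - M)"]) auto
  qed
  then have "finite {P. ?h P \<noteq> 0}"
    using a by (meson finite_SigmaI finite_imageI finite_subset)
  then show "finite {P. ?h P \<noteq> 0} \<and> (\<forall>P. ?h P \<noteq> 0 \<longrightarrow> admissible P)" by simp
qed

lemma crossings_add_left: "crossings (M + N) P = crossings M P + crossings N P"
  by (simp add: crossings_def)

lemma crossings_add_right: "crossings M (N + P) = crossings M N + crossings M P"
  by (induction M) (simp_all add: crossings_def)

lemma crossings_empty [simp]: "crossings {#} M = 0" "crossings M {#} = 0"
  by (simp_all add: crossings_def)

instance
proof
  fix f g h :: "'a sdp"
  show "f + g + h = f + (g + h)" by transfer (simp add: add.assoc)
  show "f + g = g + f" by transfer (simp add: add.commute)
  show "0 + f = f" by transfer simp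
  show "- f + f = 0" by transfer simp
  show "f - g = f + - g" by (rule minus_sdp_def)
  show "(f + g) * h = f * h + g * h"
    by transfer (auto simp: fun_eq_iff algebra_simps sum.distrib)
  show "f * (g + h) = f * g + f * h"
    by transfer (auto simp: fun_eq_iff algebra_simps sum.distrib)
  show "(0 :: 'a sdp) \<noteq> 1" by transfer (auto simp: fun_eq_iff)
  show "1 * f = f"
  proof (rule sdp_eqI)
    fix P
    show "mcoeff (1 * f) P = mcoeff f P"
    proof (cases "admissible P")
      case True
      have "mcoeff (1 * f) P =
          (\<Sum>M\<in>{M. M \<subseteq># P}. if M = {#} then mcoeff f P else 0)"
        using True unfolding times_sdp.rep_eq one_sdp.rep_eq
        by (subst if_P, assumption, intro sum.cong) auto
      then show ?thesis by (simp add: sum.delta)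
    next
      case False
      then show ?thesis using mcoeff_admissible[of f P] by (auto simp: times_sdp.rep_eq)
    qed
  qed
  show "f * 1 = f"
  proof (rule sdp_eqI)
    fix P
    show "mcoeff (f * 1) P = mcoeff f P"
    proof (cases "admissible P")
      case True
      have "mcoeff (f * 1) P =
          (\<Sum>M\<in>{M. M \<subseteq># P}. if M = P then mcoeff f P else 0)"
        using True unfolding times_sdp.rep_eq one_sdp.rep_eq
        by (subst if_P, assumption, intro sum.cong) (auto simp: Diff_eq_empty_iff_mset dest: subset_mset.antisym)
      then show ?thesis by simp
    next
      case False
      then show ?thesis using mcoeff_admissible[of f P] by (auto simp: times_sdp.rep_eq)
    qed
  qed
  show "f * g * h = f * (g * h)"
  proof (rule sdp_eqI)
    fix P
    show "mcoeff (f * g * h) P = mcoeff (f * (g * h)) P"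
    proof (cases "admissible P")
      case True
      let ?t = "\<lambda>M N K. (-1) ^ (crossings M N + crossings M K + crossings N K) *
        mcoeff f M * mcoeff g N * mcoeff h K"
      have "mcoeff (f * g * h) P = (\<Sum>Q\<in>{Q. Q \<subseteq># P}. \<Sum>M\<in>{M. M \<subseteq># Q}. ?t M (Q - M) (P - Q))"
      proof -
        have "(-1) ^ crossings Q (P - Q) * mcoeff (f * g) Q * mcoeff h (P - Q) =
            (\<Sum>M\<in>{M. M \<subseteq># Q}. ?t M (Q - M) (P - Q))" if Q: "Q \<subseteq># P" for Q
        proof -
          have "crossings Q (P - Q) = crossings M (P - Q) + crossings (Q - M) (P - Q)"
            if "M \<subseteq># Q" for M
            using that by (metis crossings_add_left subset_mset.add_diff_inverse)
          then show ?thesis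
            using True Q by (simp add: times_sdp.rep_eq admissible_subset sum_distrib_left
                sum_distrib_right power_add mult_ac)
        qed
        then show ?thesis using True by (simp add: times_sdp.rep_eq[of "f * g"])
      qed
      also have "\<dots> = (\<Sum>(Q, M)\<in>(SIGMA Q:{Q. Q \<subseteq># P}. {M. M \<subseteq># Q}). ?t M (Q - M) (P - Q))"
        by (rule sum.Sigma) auto
      also have "\<dots> = (\<Sum>(M, N)\<in>(SIGMA M:{M. M \<subseteq># P}. {N. N \<subseteq># P - M}). ?t M N (P - M - N))"
      proof (rule sum.reindex_bij_witness[of _ "\<lambda>(M, N). (M + N, M)" "\<lambda>(Q, M). (M, Q - M)"])
        fix a assume "a \<in> (SIGMA M:{M. M \<subseteq># P}. {N. N \<subseteq># P - M})"
        then show "(case a of (M, N) \<Rightarrow> (M + N, M)) \<in> (SIGMA Q:{Q. Q \<subseteq># P}. {M. M \<subseteq># Q})"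
          by (auto simp: subset_mset.le_diff_conv2 union_commute)
      next
        fix a assume a: "a \<in> (SIGMA Q:{Q. Q \<subseteq># P}. {M. M \<subseteq># Q})"
        obtain Q M where QM: "a = (Q, M)" "Q \<subseteq># P" "M \<subseteq># Q"
          using a by auto
        have "M \<subseteq># P" using QM subset_mset.order_trans by blast
        then show "(case a of (Q, M) \<Rightarrow> (M, Q - M)) \<in> (SIGMA M:{M. M \<subseteq># P}. {N. N \<subseteq># P - M})"
          using QM by (simp add: subset_mset.le_diff_conv2)
        have "P - M - (Q - M) = P - Q"
          using QM by (simp add: diff_diff_add_mset)
        then show "(case case a of (Q, M) \<Rightarrow> (M, Q - M) of (M, N) \<Rightarrow> ?t M N (P - M - N)) =
            (case a of (Q, M) \<Rightarrow> ?t M (Q - M) (P - Q))"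
          using QM by simp
      qed auto
      also have "\<dots> = (\<Sum>M\<in>{M. M \<subseteq># P}. \<Sum>N\<in>{N. N \<subseteq># P - M}. ?t M N (P - M - N))"
        by (rule sum.Sigma[symmetric]) auto
      also have "\<dots> = mcoeff (f * (g * h)) P"
      proof -
        have "(\<Sum>N\<in>{N. N \<subseteq># P - M}. ?t M N (P - M - N)) =
            (-1) ^ crossings M (P - M) * mcoeff f M * mcoeff (g * h) (P - M)"
          if M: "M \<subseteq># P" for M
        proof -
          have "crossings M (P - M) = crossings M N + crossings M (P - M - N)"
            if "N \<subseteq># P - M" for N
            using that by (metis crossings_add_right subset_mset.add_diff_inverse)
          moreover have "admissible (P - M)"
            using True admissible_subset diff_subset_eq_self by blast
          ultimately show ?thesis
            by (simp add: times_sdp.rep_eq[of g] sum_distrib_left power_add mult_ac)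
        qed
        then show ?thesis using True by (simp add: times_sdp.rep_eq[of f])
      qed
      finally show ?thesis .
    qed (simp add: times_sdp.rep_eq)
  qed
qed

end

lift_definition const :: "'k::field_char_0 \<Rightarrow> 'k sdp" is "\<lambda>c M. if M = {#} then c else 0"
  by (auto simp: admissible_def)

lift_definition gen :: "nat \<Rightarrow> 'k::field_char_0 sdp" is "\<lambda>k M. of_bool (M = {#k#})"
  by (auto simp: admissible_def)

abbreviation phi :: "'k::field_char_0 sdp" where "phi \<equiv> gen 0"

definition even_elem :: "'k::field_char_0 sdp \<Rightarrow> bool" where
  "even_elem f \<longleftrightarrow> (\<forall>M. mcoeff f M \<noteq> 0 \<longrightarrow> even (fdeg M))"

definition odd_elem :: "'k::field_char_0 sdp \<Rightarrow> bool" where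
  "odd_elem f \<longleftrightarrow> (\<forall>M. mcoeff f M \<noteq> 0 \<longrightarrow> odd (fdeg M))"

text \<open>The grading involution \<open>a \<mapsto> (-1)\<^bsup>|a|\<^esup> a\<close>.\<close>

lift_definition grading :: "'k::field_char_0 sdp \<Rightarrow> 'k sdp" is "\<lambda>f M. (-1) ^ fdeg M * f M"
  by simp

text \<open>The superderivation (odd if the flag is set, even otherwise) that is linear over constants
  and takes the value \<open>d k\<close> on the \<open>k\<close>-th generator. On words it is given by the signed
  Leibniz rule; a monomial is the word listing its generators in ascending order.\<close>

primrec superder_word ::
    "bool \<Rightarrow> (nat \<Rightarrow> 'k::field_char_0 sdp) \<Rightarrow> nat list \<Rightarrow> 'k sdp" where
  "superder_word p d [] = 0"
| "superder_word p d (k # ks) = d k * prod_list (map gen ks)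
     + (if p \<and> even k then -1 else 1) * gen k * superder_word p d ks"

definition superder ::
    "bool \<Rightarrow> (nat \<Rightarrow> 'k::field_char_0 sdp) \<Rightarrow> 'k sdp \<Rightarrow> 'k sdp" where
  "superder p d f = (\<Sum>M | mcoeff f M \<noteq> 0.
     const (mcoeff f M) * superder_word p d (sorted_list_of_multiset M))"

text \<open>The super derivative, and \<open>\<partial>\<^sub>x = D\<^sup>2\<close>.\<close>

definition D :: "'k::field_char_0 sdp \<Rightarrow> 'k sdp" where
  "D = superder True (\<lambda>k. gen (Suc k))"

definition dx :: "'k::field_char_0 sdp \<Rightarrow> 'k sdp" where
  "dx f = D (D f)"

text \<open>Time derivative along the flow \<open>\<phi>\<^sub>t = f\<close> (\<open>f\<close> odd, \<open>t\<close> even): the even derivation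
  commuting with \<open>D\<close> that sends \<open>\<phi>\<close> to \<open>f\<close>.\<close>

definition evol :: "'k::field_char_0 sdp \<Rightarrow> 'k sdp \<Rightarrow> 'k sdp" where
  "evol f = superder False (\<lambda>k. (D ^^ k) f)"

lemma evol_0 [simp]: "evol f 0 = 0"
  by (simp add: evol_def superder_def zero_sdp.rep_eq)


section \<open>Super pseudodifferential operators\<close>

lifting_update sdp.lifting
lifting_forget sdp.lifting

text \<open>Formal series \<open>\<Sum>i. a\<^sub>i D\<^sup>i\<close> with \<open>a\<^sub>i = 0\<close> for all large \<open>i\<close>.\<close>

typedef (overloaded) 'k spdo =
  "{A :: int \<Rightarrow> 'k::field_char_0 sdp. \<exists>N. \<forall>i>N. A i = 0}"
  morphisms opcoeff Abs_spdo
  by (rule exI[of _ "\<lambda>_. 0"]) simp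

setup_lifting type_definition_spdo

text \<open>The coefficients of the super Leibniz rule, valid for every integer \<open>i\<close> and homogeneous
  \<open>a\<close>: \<open>D\<^sup>i a = (\<Sum>k\<ge>0. superbinom i k (-1)\<^bsup>|a|(i-k)\<^esup> (D\<^sup>k a) D\<^bsup>i-k\<^esup>)\<close>.\<close>

definition superbinom :: "int \<Rightarrow> nat \<Rightarrow> 'k::field_char_0" where
  "superbinom i k = (if even i \<and> odd k then 0 else of_int (i div 2) gchoose (k div 2))"

definition leibniz_coeff :: "int \<Rightarrow> nat \<Rightarrow> 'k::field_char_0 sdp \<Rightarrow> 'k sdp" where
  "leibniz_coeff i k a =
     const (superbinom i k) * (D ^^ k) (if even (i - int k) then a else grading a)"

instantiation spdo :: (field_char_0) "{zero, one, plus, uminus, minus, times, power}"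
begin

lift_definition zero_spdo :: "'a spdo" is "\<lambda>_. 0" by simp

lift_definition one_spdo :: "'a spdo" is "\<lambda>i. of_bool (i = 0)"
  by (auto intro: exI[of _ 0])

lift_definition plus_spdo :: "'a spdo \<Rightarrow> 'a spdo \<Rightarrow> 'a spdo" is "\<lambda>A B i. A i + B i"
  by (metis (mono_tags) add_0 max_less_iff_conj)

lift_definition uminus_spdo :: "'a spdo \<Rightarrow> 'a spdo" is "\<lambda>A i. - A i" by simp

definition minus_spdo :: "'a spdo \<Rightarrow> 'a spdo \<Rightarrow> 'a spdo" where "A - B = A + - (B :: 'a spdo)"

text \<open>The index set is finite because both series are bounded above.\<close>

lift_definition times_spdo :: "'a spdo \<Rightarrow> 'a spdo \<Rightarrow> 'a spdo" is
  "\<lambda>A B m. \<Sum>(i, j) | A i \<noteq> 0 \<and> B j \<noteq> 0 \<and> m \<le> i + j. A i * leibniz_coeff i (nat (i + j - m)) (B j)"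
proof -
  fix A B :: "int \<Rightarrow> 'a sdp"
  assume "\<exists>N. \<forall>i>N. A i = 0" "\<exists>N. \<forall>i>N. B i = 0"
  then obtain N N' where "\<forall>i>N. A i = 0" "\<forall>i>N'. B i = 0" by blast
  then have "{(i, j). A i \<noteq> 0 \<and> B j \<noteq> 0 \<and> m \<le> i + j} = {}" if "m > N + N'" for m
    using that by (auto simp: not_less[symmetric]) (smt (verit))
  then show "\<exists>N. \<forall>m>N. (\<Sum>(i, j) | A i \<noteq> 0 \<and> B j \<noteq> 0 \<and> m \<le> i + j.
      A i * leibniz_coeff i (nat (i + j - m)) (B j)) = 0"
    by (intro exI[of _ "N + N'"] allI impI) (simp only: sum.empty)
qed

instance ..

end

lift_definition fun_op :: "'k::field_char_0 sdp \<Rightarrow> 'k spdo" is "\<lambda>a i. if i = 0 then a else 0"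
  by (auto intro: exI[of _ 0])

lift_definition D_op :: "int \<Rightarrow> 'k::field_char_0 spdo" is "\<lambda>n i. of_bool (i = n)"
  by auto

text \<open>The projection \<open>(\<cdot>)\<^sub>+\<close> to the differential part.\<close>

lift_definition diff_part :: "'k::field_char_0 spdo \<Rightarrow> 'k spdo" is "\<lambda>A i. if 0 \<le> i then A i else 0"
  by auto

lift_definition evol_op :: "'k::field_char_0 sdp \<Rightarrow> 'k spdo \<Rightarrow> 'k spdo" is "\<lambda>f A i. evol f (A i)"
  by (metis evol_0)

definition odd_op :: "'k::field_char_0 spdo \<Rightarrow> bool" where
  "odd_op A \<longleftrightarrow> (\<forall>i. if even i then odd_elem (opcoeff A i) else even_elem (opcoeff A i))"

text \<open>The supercommutator \<open>AB - (-1)\<^bsup>|A||B|\<^esup> BA\<close> of homogeneous operators.\<close>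

definition supercomm :: "'k::field_char_0 spdo \<Rightarrow> 'k spdo \<Rightarrow> 'k spdo" where
  "supercomm A B = (if odd_op A \<and> odd_op B then A * B + B * A else A * B - B * A)"


section \<open>The hierarchy\<close>

definition L :: "'k::field_char_0 spdo" where
  "L = (D_op 3 + fun_op phi) * (D_op 3 + fun_op phi)"

definition cbrt_L :: "'k::field_char_0 spdo" where
  "cbrt_L = (THE Q. Q ^ 3 = L \<and> opcoeff Q 2 = 1 \<and> (\<forall>i>2. opcoeff Q i = 0))"

text \<open>\<open>f\<close> is the right-hand side \<open>\<phi>\<^bsub>t\<^sub>n\<^esub>\<close> of the \<open>t\<^sub>n\<close>-flow
  \<open>\<partial>L/\<partial>t\<^sub>n = [(L\<^bsup>n/3\<^esup>)\<^sub>+, L]\<close>.\<close>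

definition flow :: "nat \<Rightarrow> 'k::field_char_0 sdp \<Rightarrow> bool" where
  "flow n f \<longleftrightarrow> odd_elem f \<and> evol_op f L = supercomm (diff_part (cbrt_L ^ n)) L"


section \<open>Nonlocal operators\<close>

text \<open>Operators acting on superfields; they are partial because formal inverses of \<open>D\<close> and
  \<open>\<partial>\<^sub>x\<close> are defined only on their ranges. Sums and compositions are defined where all their
  constituents are.\<close>

datatype 'a nonlocal_op = Nop (app: "'a \<Rightarrow> 'a option")

instantiation nonlocal_op :: (ring_1) "{one, plus, minus, times, power}"
begin

definition "1 = Nop Some"

definition "P + Q = Nop (\<lambda>f. case (app P f, app Q f) of (Some g, Some h) \<Rightarrow> Some (g + h) | _ \<Rightarrow> None)"

definition "P - Q = Nop (\<lambda>f. case (app P f, app Q f) of (Some g, Some h) \<Rightarrow> Some (g - h) | _ \<Rightarrow> None)"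

definition "P * Q = Nop (app P \<circ>\<^sub>m app Q)"

instance ..

end

definition mult_by :: "'k::field_char_0 sdp \<Rightarrow> 'k sdp nonlocal_op" (\<open>\<langle>_\<rangle>\<close>) where
  "\<langle>a\<rangle> = Nop (\<lambda>f. Some (a * f))"

text \<open>The formal inverse of a derivation, without constants of integration: the preimage is
  normalised to have no constant term.\<close>

definition antideriv :: "('k::field_char_0 sdp \<Rightarrow> 'k sdp) \<Rightarrow> 'k sdp \<Rightarrow> 'k sdp option" where
  "antideriv d g = (if \<exists>!h. d h = g \<and> mcoeff h {#} = 0
     then Some (THE h. d h = g \<and> mcoeff h {#} = 0) else None)"

definition DD :: "'k::field_char_0 sdp nonlocal_op" (\<open>\<D>\<close>) where "\<D> = Nop (\<lambda>f. Some (D f))"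
definition DX :: "'k::field_char_0 sdp nonlocal_op" (\<open>\<partial>\<close>) where "\<partial> = Nop (\<lambda>f. Some (dx f))"
definition Dinv :: "'k::field_char_0 sdp nonlocal_op" (\<open>\<D>\<inverse>\<close>) where "\<D>\<inverse> = Nop (antideriv D)"
definition DXinv :: "'k::field_char_0 sdp nonlocal_op" (\<open>\<partial>\<inverse>\<close>) where "\<partial>\<inverse> = Nop (antideriv dx)"

text \<open>\<open>phi_x k\<close> is the \<open>k\<close>-th \<open>x\<close>-derivative of \<open>\<phi>\<close>, and \<open>Dphi_x k\<close> is \<open>(D \<phi>\<^bsub>kx\<^esub>)\<close>.\<close>

abbreviation phi_x :: "nat \<Rightarrow> 'k::field_char_0 sdp" where "phi_x k \<equiv> (dx ^^ k) phi"
abbreviation Dphi_x :: "nat \<Rightarrow> 'k::field_char_0 sdp" where "Dphi_x k \<equiv> D (phi_x k)"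

definition recursion_op :: "'k::field_char_0 sdp nonlocal_op" where
  "recursion_op =
     \<partial>^6 + \<langle>6 * Dphi_x 0\<rangle> * \<partial>^4 + \<langle>9 * Dphi_x 1\<rangle> * \<partial>^3 + \<langle>6 * phi_x 2\<rangle> * \<partial>^2 * \<D>
     + \<langle>5 * Dphi_x 2 + 9 * (Dphi_x 0)^2\<rangle> * \<partial>^2
     + \<langle>9 * phi_x 3 + 12 * phi_x 1 * Dphi_x 0\<rangle> * \<partial> * \<D> + \<langle>Dphi_x 3 + 9 * Dphi_x 1 * Dphi_x 0\<rangle> * \<partial>
     + \<langle>5 * phi_x 4 + 12 * phi_x 2 * Dphi_x 0 + 6 * phi_x 1 * Dphi_x 1\<rangle> * \<D>
     + \<langle>4 * Dphi_x 2 * Dphi_x 0 + 4 * (Dphi_x 0)^3 - 3 * phi_x 2 * phi_x 1\<rangle>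
     + \<langle>phi_x 5 + 5 * phi_x 3 * Dphi_x 0 + 5 * phi_x 2 * Dphi_x 1 + 2 * phi_x 1 * Dphi_x 2
         + 6 * phi_x 1 * (Dphi_x 0)^2\<rangle> * \<D>\<inverse>
     - \<langle>2 * Dphi_x 2 + 2 * (Dphi_x 0)^2\<rangle> * \<D>\<inverse> * \<langle>phi_x 1\<rangle>
     - \<langle>4 * phi_x 1 * Dphi_x 0\<rangle> * \<partial>\<inverse> * \<langle>phi_x 1\<rangle>
     - \<langle>2 * Dphi_x 0\<rangle> * \<D>\<inverse> * \<langle>phi_x 3 + 2 * phi_x 1 * Dphi_x 0\<rangle>
     - \<langle>2 * phi_x 1\<rangle> * \<D>\<inverse> *
         (\<langle>phi_x 3 + phi_x 1 * Dphi_x 0\<rangle> * \<D>\<inverse>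
          - \<langle>3 * Dphi_x 0\<rangle> * \<D>\<inverse> * \<langle>phi_x 1\<rangle>
          - \<langle>2 * phi_x 1\<rangle> * \<partial>\<inverse> * \<langle>phi_x 1\<rangle>
          + \<langle>2\<rangle> * \<D>\<inverse> * \<langle>phi_x 3 + 2 * phi_x 1 * Dphi_x 0\<rangle>)"

end

theory Submission
  imports Defs
begin

text \<open>
  Write \<open>L = \<Lambda>\<^sup>2\<close> with \<open>\<Lambda> = D\<^sup>3 + \<phi>\<close>, and let \<open>Q = L\<^bsup>1/3\<^esup>\<close>, \<open>B = (Q\<^sup>n)\<^sub>+\<close>, \<open>M = (Q\<^sup>n)\<^sub>-\<close>. By uniqueness of the
  root, \<open>Q\<close> commutes with \<open>\<Lambda>\<close>, and \<open>Q\<^sup>* = -Q\<close> for the super adjoint, since \<open>L\<^sup>* = -L\<close>. For odd \<open>n\<close> the adjoint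
  kills the coefficient of \<open>D\<^sup>-\<^sup>1\<close> in \<open>M\<close>; then \<open>[B, \<Lambda>] = -[M, \<Lambda>]\<close> is both differential and of order 0, so it is
  a function \<open>f\<close>, and this is the flow. For even \<open>n\<close> the adjoint kills the flow.

  The equation \<open>[M, \<Lambda>] = -f\<close> determines the coefficients of \<open>M\<close> one after the other; those of even
  index arise by integration. So \<open>h = D\<^sup>-\<^sup>1 f\<close> is three times the coefficient of \<open>D\<^sup>-\<^sup>2\<close>, \<open>p = \<partial>\<^sub>x\<^sup>-\<^sup>1 \<phi>\<^sub>x f\<close> is
  read off at \<open>D\<^sup>-\<^sup>6\<close>, and the \<open>D\<^sup>-\<^sup>1\<close> of the braces in the last line of the recursion operator, \<open>q\<close>,
  at \<open>D\<^bsup>-10\<^esup>\<close>. These potentials are local because the coefficients of \<open>M\<close> are; no constants of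
  integration occur because \<open>Q\<^sup>n\<close> has the constant part \<open>D\<^bsup>2n\<^esup>\<close>. Finally \<open>(Q\<^bsup>n+6\<^esup>)\<^sub>+ = L\<^sup>2 B + R\<close> with
  \<open>R = (L\<^sup>2 M)\<^sub>+\<close>, so the \<open>t\<^bsub>n+6\<^esub>\<close>-flow is the constant coefficient of \<open>L\<^sup>2 f + [R, \<Lambda>]\<close>.
\<close>

section \<open>The algebra of superdifferential polynomials\<close>

text \<open>The recursion operator is partial, so its nonlocal terms must be shown to exist before
  any value can be compared. No integrability argument is used: each integral is exhibited inside
  the coefficients of an operator that already exists, and it is the only antiderivative without
  constant term because the kernel of D consists of the constants. The factor \<open>Lam\<close> is
  preferred to L because its commutator with M is a single function instead of a differential
  operator. Parity explains which coefficients need integration: in the coefficient of D^-m of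
  [M, Lam], the coefficient of M at D^(-m-3) is doubled if its index is odd and cancels if it is
  even. An odd one is therefore algebraic in its predecessor, an even one is known only through
  three times its x-derivative. The potentials h, p, q enter M with the factors 1/3, 4/9 and 2/27,
  whose denominators a common factor 27 clears. What remains are identities between polynomials with
  integer coefficients, which are decided by evaluating symbolic lists. The same 27 reappears in the
  theorem: -27 times the next flow is the multiple in which the sixth x-derivative of f has
  coefficient 1.\<close>

lemma sdp_minus_rep: "mcoeff (f - g) M = mcoeff f M - mcoeff g M"
  unfolding minus_sdp_def plus_sdp.rep_eq uminus_sdp.rep_eq by (rule add_uminus_conv_diff)

lemmas mcoeff_simps = zero_sdp.rep_eq one_sdp.rep_eq plus_sdp.rep_eq uminus_sdp.rep_eq
  sdp_minus_rep const.rep_eq gen.rep_eq grading.rep_eq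

lemma mcoeff_sum: "mcoeff (sum F S) M = (\<Sum>x\<in>S. mcoeff (F x) M)"
  by (induction S rule: infinite_finite_induct) (simp_all add: mcoeff_simps)

lemma mcoeff_const_mult: "mcoeff (const c * f) P = c * mcoeff f P"
proof (cases "admissible P")
  case True
  have "mcoeff (const c * f) P = (\<Sum>M\<in>{M. M \<subseteq># P}. if M = {#} then c * mcoeff f P else 0)"
    using True unfolding times_sdp.rep_eq const.rep_eq
    by (subst if_P, assumption, intro sum.cong) auto
  then show ?thesis by simp
next
  case False
  then show ?thesis using mcoeff_admissible[of f P] by (auto simp: times_sdp.rep_eq)
qed

lemma mcoeff_mult_const: "mcoeff (f * const c) P = c * mcoeff f P"
proof (cases "admissible P")
  case True
  have "mcoeff (f * const c) P = (\<Sum>M\<in>{M. M \<subseteq># P}. if M = P then c * mcoeff f P else 0)"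
    using True unfolding times_sdp.rep_eq const.rep_eq
    by (subst if_P, assumption, intro sum.cong)
      (auto simp: Diff_eq_empty_iff_mset dest: subset_mset.antisym)
  then show ?thesis by simp
next
  case False
  then show ?thesis using mcoeff_admissible[of f P] by (auto simp: times_sdp.rep_eq)
qed

lemma const_commute: "f * const c = const c * f"
  by (rule sdp_eqI) (simp add: mcoeff_mult_const mcoeff_const_mult)

lemma const_0 [simp]: "const 0 = 0"
  by (rule sdp_eqI) (simp add: mcoeff_simps)

lemma const_1 [simp]: "const 1 = 1"
  by (rule sdp_eqI) (simp add: mcoeff_simps)

lemma const_add: "const (a + b) = const a + const b"
  by (rule sdp_eqI) (simp add: mcoeff_simps)

lemma const_minus: "const (- a) = - const a"
  by (rule sdp_eqI) (simp add: mcoeff_simps)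

lemma const_mult: "const (a * b) = const a * const b"
  by (rule sdp_eqI) (simp add: mcoeff_const_mult mcoeff_simps)

lemma const_of_nat: "const (of_nat n) = of_nat n"
  by (induction n) (simp_all add: const_add)

lemma const_numeral: "const (numeral n) = numeral n"
  using const_of_nat[of "numeral n"] by simp

lemma const_of_int: "const (of_int n) = of_int n"
  by (cases n rule: int_cases2) (simp_all add: const_of_nat const_minus)

lemma const_mult_left_commute: "f * (const c * g) = const c * (f * g)"
  by (metis const_commute mult.assoc)

lemma const_mult_const: "const a * (const b * f) = const (a * b) * f"
  by (simp add: const_mult mult.assoc)

lemma const_cancel: "c \<noteq> 0 \<Longrightarrow> const c * f = const c * g \<longleftrightarrow> f = g"
  by (metis const_mult_const const_1 left_inverse mult_1)

lemma numeral_mult_cancel: "numeral n * f = numeral n * (g :: 'k::field_char_0 sdp) \<longleftrightarrow> f = g"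
  using const_cancel[of "numeral n" f g] by (simp add: const_numeral)

lemma double_eq_0: "f + f = 0 \<Longrightarrow> f = (0 :: 'k::field_char_0 sdp)"
  using numeral_mult_cancel[of "num.Bit0 num.One" f 0] by (simp add: mult_2)

subsection \<open>Words\<close>

lemma mcoeff_gen_mult: "mcoeff (gen k * f) P =
    (if admissible P \<and> k \<in># P then (-1) ^ crossings {#k#} (P - {#k#}) * mcoeff f (P - {#k#}) else 0)"
proof (cases "admissible P")
  case True
  have "mcoeff (gen k * f) P = (\<Sum>M\<in>{M. M \<subseteq># P}.
      if M = {#k#} then (-1) ^ crossings {#k#} (P - {#k#}) * mcoeff f (P - {#k#}) else 0)"
    using True unfolding times_sdp.rep_eq gen.rep_eq
    by (subst if_P, assumption, intro sum.cong) auto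
  then show ?thesis using True by (simp add: sum.delta')
qed (simp add: times_sdp.rep_eq)

abbreviation word :: "nat list \<Rightarrow> 'k::field_char_0 sdp" where
  "word ks \<equiv> prod_list (map gen ks)"

lemma mcoeff_word:
  "sorted ks \<Longrightarrow> admissible (mset ks) \<Longrightarrow> mcoeff (word ks :: 'k::field_char_0 sdp) P = of_bool (P = mset ks)"
proof (induction ks arbitrary: P)
  case (Cons k ks)
  have a: "admissible (mset ks)"
    using Cons.prems(2) admissible_subset by (metis mset.simps(2) mset_subset_eq_add_mset_cancel
        subset_mset.order_refl add_mset_add_single mset_subset_eq_add_left)
  have c: "crossings {#k#} (mset ks) = 0"
    using Cons.prems(1) by (auto simp: crossings_def)
  have "k \<in># P \<Longrightarrow> P - {#k#} = mset ks \<longleftrightarrow> P = add_mset k (mset ks)"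
    by (metis add_mset_remove_trivial insert_DiffM)
  then show ?case
    using Cons a c by (auto simp: mcoeff_gen_mult)
qed (simp add: mcoeff_simps)

lemma sdp_expand: "f = (\<Sum>M | mcoeff f M \<noteq> 0. const (mcoeff f M) * word (sorted_list_of_multiset M))"
proof (rule sdp_eqI)
  fix P
  have "mcoeff (\<Sum>M | mcoeff f M \<noteq> 0. const (mcoeff f M) * word (sorted_list_of_multiset M)) P
     = (\<Sum>M | mcoeff f M \<noteq> 0. if M = P then mcoeff f P else 0)"
    unfolding mcoeff_sum mcoeff_const_mult
    by (intro sum.cong) (auto simp: mcoeff_word mcoeff_admissible)
  then show "mcoeff f P = mcoeff (\<Sum>M | mcoeff f M \<noteq> 0. const (mcoeff f M) * word (sorted_list_of_multiset M)) P"
    by simp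
qed

text \<open>Every element is a finite sum of constants times words, and a word is built by left
  multiplication with generators. Identities that are linear in f thus reduce to one generator
  step.\<close>

lemma sdp_induct [case_names one gen add const]:
  assumes one: "P 1" and gen: "\<And>k f. P f \<Longrightarrow> P (gen k * f)"
    and add: "\<And>f g. P f \<Longrightarrow> P g \<Longrightarrow> P (f + g)"
    and const: "\<And>c f. P f \<Longrightarrow> P (const c * f)"
  shows "P (f :: 'k::field_char_0 sdp)"
proof -
  have z: "P 0" using const[OF one, of 0] by simp
  have w: "P (word ks)" for ks
    by (induction ks) (simp_all add: one gen)
  have "P (sum F S)" if "\<And>x. x \<in> S \<Longrightarrow> P (F x)" for F :: "nat multiset \<Rightarrow> 'k sdp" and S
    using that by (induction S rule: infinite_finite_induct) (simp_all add: z add)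
  then show ?thesis by (subst sdp_expand) (simp add: w const)
qed

subsection \<open>Parity\<close>

lemma fdeg_add: "fdeg (M + N) = fdeg M + fdeg N"
  by (simp add: fdeg_def)

lemma grading_add [simp]: "grading (f + g) = grading f + grading g"
  by (rule sdp_eqI) (simp add: mcoeff_simps algebra_simps)

lemma grading_minus [simp]: "grading (- f) = - grading f"
  by (rule sdp_eqI) (simp add: mcoeff_simps algebra_simps)

lemma grading_diff [simp]: "grading (f - g) = grading f - grading g"
  by (rule sdp_eqI) (simp add: mcoeff_simps algebra_simps)

lemma grading_0 [simp]: "grading 0 = 0"
  by (rule sdp_eqI) (simp add: mcoeff_simps)

lemma grading_const [simp]: "grading (const c) = const c"
  by (rule sdp_eqI) (simp add: mcoeff_simps fdeg_def)

lemma grading_1 [simp]: "grading 1 = 1"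
  using grading_const[of 1] by simp

lemma grading_numeral [simp]: "grading (numeral n) = numeral n"
  by (metis const_numeral grading_const)

lemma grading_of_int [simp]: "grading (of_int n) = of_int n"
  by (metis const_of_int grading_const)

lemma grading_mult [simp]: "grading (f * g) = grading f * grading (g :: 'k::field_char_0 sdp)"
proof (rule sdp_eqI)
  fix P
  have "(-1 :: 'k) ^ fdeg P * ((-1) ^ crossings M (P - M) * mcoeff f M * mcoeff g (P - M)) =
     (-1) ^ crossings M (P - M) * ((-1) ^ fdeg M * mcoeff f M) * ((-1) ^ fdeg (P - M) * mcoeff g (P - M))"
    if "M \<subseteq># P" for M
  proof -
    have "fdeg P = fdeg M + fdeg (P - M)"
      using that by (metis fdeg_add subset_mset.add_diff_inverse)
    then show ?thesis by (simp add: power_add mult_ac)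
  qed
  then show "mcoeff (grading (f * g)) P = mcoeff (grading f * grading g) P"
    unfolding grading.rep_eq times_sdp.rep_eq
    by (auto simp only: sum_distrib_left mult_zero_right mem_Collect_eq intro!: sum.cong split: if_splits)
qed

lemma grading_grading [simp]: "grading (grading f) = f"
  by (rule sdp_eqI) (simp add: mcoeff_simps mult.assoc[symmetric] power_add[symmetric] flip: power_mult_distrib)

lemma grading_gen: "grading (gen k) = (if even k then - gen k else gen k)"
  by (rule sdp_eqI) (auto simp: mcoeff_simps fdeg_def)

lemma odd_elem_iff: "odd_elem f \<longleftrightarrow> grading f = - f"
proof
  assume "grading f = - f"
  then have "(-1) ^ fdeg M * mcoeff f M = - mcoeff f M" for M by (metis grading.rep_eq uminus_sdp.rep_eq)
  then have "even (fdeg M) \<Longrightarrow> - mcoeff f M = mcoeff f M" for M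
    by (metis minus_one_power_iff mult_1)
  then show "odd_elem f"
    by (auto simp: odd_elem_def)
qed (auto simp: odd_elem_def intro!: sdp_eqI simp: grading.rep_eq uminus_sdp.rep_eq minus_one_power_iff)

lemma gen_gen: "gen i * gen j = (if even i \<and> even j then - (gen j * gen i) else gen j * gen i :: 'k::field_char_0 sdp)"
proof (rule sdp_eqI)
  have e: "P - {#k#} = {#l#} \<and> k \<in># P \<longleftrightarrow> P = {#k, l#}" for k l and P :: "nat multiset"
    by (metis add_mset_remove_trivial insert_DiffM union_single_eq_member add_mset_add_single)
  have m: "mcoeff (gen k * gen l :: 'k sdp) P = (if admissible P \<and> P = {#k, l#} then (-1) ^ crossings {#k#} {#l#} else 0)" for k l P
    using e[of P k l] by (auto simp: mcoeff_gen_mult gen.rep_eq)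
  \<comment> \<open>A repeated fermionic generator is inadmissible, so both products vanish and the
    sign is immaterial.\<close>
  have n: "i = j \<Longrightarrow> even i \<Longrightarrow> \<not> admissible {#i, j#}"
    by (auto simp: admissible_def intro!: exI[of _ j])
  fix P :: "nat multiset"
  show "mcoeff (gen i * gen j :: 'k sdp) P = mcoeff (if even i \<and> even j then - (gen j * gen i) else gen j * gen i) P"
    using n by (cases i j rule: linorder_cases)
      (auto simp: m uminus_sdp.rep_eq crossings_def add_mset_commute)
qed

lemma gen_mult_commute: "gen k * f = (if even k then grading f else f) * gen k"
proof (induction f rule: sdp_induct)
  case (gen j f)
  have "gen k * (gen j * f) = (if even k \<and> even j then -1 else 1) * gen j * (gen k * f)"
    by (simp add: mult.assoc[symmetric] gen_gen[of k j])
  then show ?case using gen by (simp add: mult.assoc grading_gen)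
next
  case (const c f)
  then show ?case by (simp add: const_mult_left_commute) (simp add: mult.assoc)
qed (simp_all add: algebra_simps)

lemma even_commute: "grading f = f \<Longrightarrow> a * f = f * a"
proof (induction a rule: sdp_induct)
  case (gen k a)
  then show ?case using gen_mult_commute[of k f] by (simp add: mult.assoc) (simp add: mult.assoc[symmetric])
next
  case (const c a)
  then show ?case by (simp add: const_mult_left_commute mult.assoc)
qed (simp_all add: algebra_simps)

lemma odd_commute: "grading f = - f \<Longrightarrow> a * f = f * grading a"
proof (induction a rule: sdp_induct)
  case (gen k a)
  then show ?case using gen_mult_commute[of k f]
    by (simp add: mult.assoc grading_gen) (simp add: mult.assoc[symmetric])
next
  case (const c a)
  then show ?case by (simp add: const_mult_left_commute mult.assoc)
qed (simp_all add: algebra_simps)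

lemma odd_square_0: "grading f = - f \<Longrightarrow> f * f = 0"
proof -
  assume "grading f = - f"
  then have "f * f = - (f * f)" using odd_commute[of f f] by (metis mult_minus_right)
  then show ?thesis by (metis double_eq_0 add.right_inverse)
qed

subsection \<open>Superderivations\<close>

lemma superder_superset:
  assumes "finite S" "{M. mcoeff f M \<noteq> 0} \<subseteq> S"
  shows "superder p d f = (\<Sum>M\<in>S. const (mcoeff f M) * superder_word p d (sorted_list_of_multiset M))"
  unfolding superder_def by (rule sum.mono_neutral_left) (use assms in auto)

lemma superder_add: "superder p d (f + g) = superder p d f + superder p d g"
proof -
  let ?S = "{M. mcoeff f M \<noteq> 0} \<union> {M. mcoeff g M \<noteq> 0}"
  have "{M. mcoeff (f + g) M \<noteq> 0} \<subseteq> ?S" by (auto simp: mcoeff_simps)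
  then show ?thesis
    by (simp add: superder_superset[of ?S] plus_sdp.rep_eq const_add algebra_simps sum.distrib)
qed

lemma superder_const_mult: "superder p d (const c * f) = const c * superder p d f"
proof -
  have "{M. mcoeff (const c * f) M \<noteq> 0} \<subseteq> {M. mcoeff f M \<noteq> 0}" by (auto simp: mcoeff_const_mult)
  then show ?thesis
    by (simp add: superder_superset[of "{M. mcoeff f M \<noteq> 0}"] mcoeff_const_mult const_mult
        sum_distrib_left mult.assoc)
qed

lemma superder_0: "superder p d 0 = 0"
  using superder_const_mult[of p d 0 0] by simp

lemma superder_minus: "superder p d (- f) = - superder p d f"
  using superder_add[of p d f "- f"] by (simp add: superder_0 eq_neg_iff_add_eq_0 add.commute)

lemma superder_sum: "superder p d (sum F S) = (\<Sum>x\<in>S. superder p d (F x))"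
  by (induction S rule: infinite_finite_induct) (simp_all add: superder_0 superder_add)

lemma superder_sorted_word:
  assumes "sorted ks" "admissible (mset ks)"
  shows "superder p d (word ks) = superder_word p d ks"
proof -
  have "sorted_list_of_multiset (mset ks) = ks"
    using assms(1) by (simp add: sorted_sort_id)
  moreover have "superder p d (word ks) = (\<Sum>M\<in>{mset ks}. const (mcoeff (word ks) M) * superder_word p d (sorted_list_of_multiset M))"
    by (rule superder_superset) (auto simp: mcoeff_word[OF assms])
  ultimately show ?thesis by (simp add: mcoeff_word[OF assms])
qed

lemma superder_1: "superder p d 1 = 0"
  using superder_sorted_word[of "[]" p d] by (simp add: admissible_def)

lemma superder_gen [simp]: "superder p d (gen k) = d k"
  using superder_sorted_word[of "[k]" p d] by (simp add: admissible_def)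

text \<open>\<open>superder\<close> is defined through sorted words, so the Leibniz rule for
  arbitrary products has to be proved. It is consistent with reordering because the parity of
  \<open>d k\<close> is that of the derivation plus that of the generator k, which is the assumption
  made here.\<close>

locale superderivation =
  fixes p :: bool and d :: "nat \<Rightarrow> 'k::field_char_0 sdp"
  assumes parity: "grading (d k) = (if p = even k then d k else - d k)"
begin

abbreviation "\<Delta> \<equiv> superder p d"

lemma gen_d: "gen k * d j = (if even k \<and> p \<noteq> even j then - d j * gen k else d j * gen k)"
  using gen_mult_commute[of k "d j"] by (simp add: parity)

text \<open>If k does not exceed any letter of f, putting it in front keeps every word sorted, and
  the defining rule applies directly. The exception is a fermionic k that already occurs.\<close>

lemma gen_step_sorted:
  assumes f: "\<And>M x. mcoeff f M \<noteq> 0 \<Longrightarrow> x \<in># M \<Longrightarrow> k \<le> x"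
  shows "\<Delta> (gen k * f) = d k * f + (if p \<and> even k then -1 else 1) * gen k * \<Delta> f"
proof -
  let ?s = "(if p \<and> even k then -1 else 1) :: 'k sdp"
  have w: "\<Delta> (gen k * word ks) = d k * word ks + ?s * gen k * \<Delta> (word ks)"
    if ks: "sorted ks" "admissible (mset ks)" "\<forall>x\<in>set ks. k \<le> x" for ks
  proof (cases "even k \<and> k \<in> set ks")
    case False
    then have "admissible (mset (k # ks))" using ks(2)
      by (auto simp: admissible_def count_eq_zero_iff)
    then show ?thesis
      using superder_sorted_word[of "k # ks" p d] superder_sorted_word[of ks p d] ks by simp
  next
    \<comment> \<open>The product is zero because a fermionic generator is repeated. On the right,
      the two terms with \<open>d k\<close> cancel by \<open>gen_d\<close>, and the remaining one
      contains the square of \<open>gen k\<close>.\<close>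
    case True
    then obtain l ls where l: "ks = l # ls" by (cases ks) auto
    with True ks have "l = k" by (auto simp: order_antisym)
    then have kk: "ks = k # ls" using l by simp
    have z: "gen k * gen k = (0 :: 'k sdp)"
      using True odd_square_0[of "gen k"] by (simp add: grading_gen)
    have z': "gen k * (gen k * x) = (0 :: 'k sdp)" for x using z by (simp add: mult.assoc[symmetric])
    have "gen k * (d k * x) = (if p then d k * (gen k * x) else - (d k * (gen k * x)))" for x
      using gen_d[of k k] True by (simp add: mult.assoc[symmetric])
    then show ?thesis
      using True superder_sorted_word[of ks p d] ks z'
      by (simp add: kk superder_0 algebra_simps)
  qed
  have c: "sorted (sorted_list_of_multiset M)" "admissible (mset (sorted_list_of_multiset M))"
      "\<forall>x\<in>set (sorted_list_of_multiset M). k \<le> x"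
    if "mcoeff f M \<noteq> 0" for M
    using that f mcoeff_admissible by auto
  let ?S = "{M. mcoeff f M \<noteq> 0}"
  have "\<Delta> (gen k * f) = \<Delta> (gen k * (\<Sum>M\<in>?S. const (mcoeff f M) * word (sorted_list_of_multiset M)))"
    by (subst sdp_expand[of f]) simp
  also have "\<dots> = (\<Sum>M\<in>?S. const (mcoeff f M) * \<Delta> (gen k * word (sorted_list_of_multiset M)))"
    by (simp add: sum_distrib_left superder_sum superder_const_mult const_mult_left_commute)
  also have "\<dots> = (\<Sum>M\<in>?S. const (mcoeff f M) * (d k * word (sorted_list_of_multiset M)
      + ?s * gen k * \<Delta> (word (sorted_list_of_multiset M))))"
    by (intro sum.cong refl arg_cong[where f = "\<lambda>x. const _ * x"] w) (use c in blast)+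
  also have "\<dots> = d k * (\<Sum>M\<in>?S. const (mcoeff f M) * word (sorted_list_of_multiset M))
      + ?s * gen k * \<Delta> (\<Sum>M\<in>?S. const (mcoeff f M) * word (sorted_list_of_multiset M))"
    by (simp add: sum_distrib_left superder_sum superder_const_mult const_mult_left_commute
        distrib_left sum.distrib)
  also have "\<dots> = d k * f + ?s * gen k * \<Delta> f"
    by (simp flip: sdp_expand)
  finally show ?thesis .
qed

text \<open>If the first letter j is smaller than k, the two generators are swapped. The factor
  \<open>gen k * word js\<close> need not be a sorted word, but all its letters are at least j, so
  \<open>gen_step_sorted\<close> still handles the outer generator j and induction the inner
  k.\<close>

lemma gen_step_word:
  assumes "sorted ks" "admissible (mset ks)"
  shows "\<Delta> (gen k * word ks) = d k * word ks + (if p \<and> even k then -1 else 1) * gen k * \<Delta> (word ks)"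
  using assms
proof (induction ks)
  case Nil
  show ?case by (simp add: superder_1)
next
  case (Cons j js)
  have a: "admissible (mset js)"
    using Cons.prems(2) admissible_subset by (metis mset.simps(2) mset_subset_eq_add_mset_cancel
        subset_mset.order_refl add_mset_add_single mset_subset_eq_add_left)
  show ?case
  proof (cases "k \<le> j")
    case True
    have "k \<le> x" if "mcoeff (word (j # js) :: 'k sdp) M \<noteq> 0" "x \<in># M" for M x
      using that Cons.prems(1) True unfolding mcoeff_word[OF Cons.prems] by (auto split: if_splits)
    then show ?thesis by (rule gen_step_sorted)
  next
    case False
    let ?s = "\<lambda>k. (if p \<and> even k then -1 else 1) :: 'k sdp"
    let ?t = "(if even k \<and> even j then -1 else 1) :: 'k sdp"
    have IH: "\<Delta> (gen k * word js) = d k * word js + ?s k * gen k * \<Delta> (word js)"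
      using Cons a by auto
    have j: "\<Delta> (gen j * word js) = d j * word js + ?s j * gen j * \<Delta> (word js)"
      using superder_sorted_word[OF Cons.prems, of p d] superder_sorted_word[of js p d] Cons.prems a by simp
    have sw: "gen k * (gen j * x) = ?t * (gen j * (gen k * x))" for x :: "'k sdp"
      by (simp add: mult.assoc[symmetric] gen_gen[of k j])
    have "j \<le> x" if "mcoeff (gen k * word js :: 'k sdp) M \<noteq> 0" "x \<in># M" for M x
    proof -
      have "k \<in># M" "M - {#k#} = mset js"
        using that(1) Cons.prems(1) a by (auto simp: mcoeff_gen_mult mcoeff_word split: if_splits)
      then have "M = add_mset k (mset js)" by (metis insert_DiffM)
      then show ?thesis using that(2) False Cons.prems(1) by auto
    qed
    then have "\<Delta> (gen j * (gen k * word js)) = d j * (gen k * word js) + ?s j * gen j * \<Delta> (gen k * word js)"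
      by (rule gen_step_sorted)
    moreover have "\<Delta> (gen k * (gen j * word js)) = ?t * \<Delta> (gen j * (gen k * word js))"
      by (simp add: sw superder_minus)
    ultimately have 1: "\<Delta> (gen k * (gen j * word js)) = ?t * (d j * (gen k * word js)
        + ?s j * gen j * (d k * word js + ?s k * gen k * \<Delta> (word js)))"
      using IH by simp
    have c1: "gen j * (d k * x) = (if even j \<and> p \<noteq> even k then - (d k * (gen j * x)) else d k * (gen j * x))" for x
      using gen_d[of j k] by (simp add: mult.assoc[symmetric])
    have c2: "gen k * (d j * x) = (if even k \<and> p \<noteq> even j then - (d j * (gen k * x)) else d j * (gen k * x))" for x
      using gen_d[of k j] by (simp add: mult.assoc[symmetric])
    show ?thesis
      by (simp add: 1 j) (simp add: algebra_simps c1 c2 sw)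
  qed
qed

lemma gen_step: "\<Delta> (gen k * f) = d k * f + (if p \<and> even k then -1 else 1) * gen k * \<Delta> f"
proof -
  let ?s = "(if p \<and> even k then -1 else 1) :: 'k sdp"
  let ?S = "{M. mcoeff f M \<noteq> 0}"
  have "\<Delta> (gen k * f) = \<Delta> (gen k * (\<Sum>M\<in>?S. const (mcoeff f M) * word (sorted_list_of_multiset M)))"
    by (subst sdp_expand[of f]) simp
  also have "\<dots> = (\<Sum>M\<in>?S. const (mcoeff f M) * \<Delta> (gen k * word (sorted_list_of_multiset M)))"
    by (simp add: sum_distrib_left superder_sum superder_const_mult const_mult_left_commute)
  also have "\<dots> = (\<Sum>M\<in>?S. const (mcoeff f M) * (d k * word (sorted_list_of_multiset M)
      + ?s * gen k * \<Delta> (word (sorted_list_of_multiset M))))"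
    by (intro sum.cong refl arg_cong[where f = "\<lambda>x. const _ * x"] gen_step_word)
      (simp_all add: mcoeff_admissible)
  also have "\<dots> = d k * (\<Sum>M\<in>?S. const (mcoeff f M) * word (sorted_list_of_multiset M))
      + ?s * gen k * \<Delta> (\<Sum>M\<in>?S. const (mcoeff f M) * word (sorted_list_of_multiset M))"
    by (simp add: sum_distrib_left superder_sum superder_const_mult const_mult_left_commute
        distrib_left sum.distrib)
  also have "\<dots> = d k * f + ?s * gen k * \<Delta> f"
    by (simp flip: sdp_expand)
  finally show ?thesis .
qed

lemma leibniz: "\<Delta> (f * g) = \<Delta> f * g + (if p then grading f else f) * \<Delta> g"
proof (induction f rule: sdp_induct)
  case (gen k f)
  then show ?case by (simp add: mult.assoc gen_step grading_gen) (simp add: algebra_simps)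
next
  case (const c f)
  then show ?case by (simp add: mult.assoc superder_const_mult algebra_simps)
qed (simp_all add: superder_1 superder_add algebra_simps)

lemma grading_superder: "grading (\<Delta> f) = (if p then - \<Delta> (grading f) else \<Delta> (grading f))"
proof (induction f rule: sdp_induct)
  case (gen k f)
  define X Y Z where "X = \<Delta> f" and "Y = \<Delta> (grading f)" and "Z = \<Delta> (grading (gen k * f))"
  have "Z = (if even k then -1 else 1) * (d k * grading f + (if p \<and> even k then -1 else 1) * gen k * Y)"
    by (simp add: Y_def Z_def grading_gen gen_step superder_minus)
  moreover have "grading X = (if p then - Y else Y)"
    using gen by (simp add: X_def Y_def)
  ultimately show ?case
    unfolding gen_step X_def[symmetric] Z_def[symmetric] by (simp add: grading_gen parity algebra_simps)
qed (simp_all add: superder_1 superder_add superder_const_mult algebra_simps)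

end

interpretation D: superderivation True "\<lambda>k. gen (Suc k) :: 'k::field_char_0 sdp"
  by unfold_locales (simp add: grading_gen)

lemma D_gen [simp]: "D (gen k) = gen (Suc k)"
  and D_add [simp]: "D (f + g) = D f + D g"
  and D_minus [simp]: "D (- f) = - D f"
  and D_0 [simp]: "D 0 = 0"
  and D_1 [simp]: "D 1 = 0"
  and D_const_mult: "D (const c * f) = const c * D f"
  and D_mult: "D (f * g) = D f * g + grading f * D g"
  and grading_D [simp]: "grading (D f) = - D (grading f)"
  using D.leibniz[of f g] D.grading_superder[of f]
  by (simp_all add: D_def superder_add superder_minus superder_0 superder_1 superder_const_mult)

lemma D_diff [simp]: "D (f - g) = D f - D g"
  using D_add[of f "- g"] by simp

lemma D_const [simp]: "D (const c) = 0"
  using D_const_mult[of c 1] by simp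

lemma D_numeral [simp]: "D (numeral n) = 0"
  by (metis D_const const_numeral)

lemma D_of_int [simp]: "D (of_int n) = 0"
  by (metis D_const const_of_int)

lemma D_power_0 [simp]: "(D ^^ n) 0 = 0"
  by (induction n) auto

lemma D_power_add: "(D ^^ n) (f + g) = (D ^^ n) f + (D ^^ n) g"
  by (induction n) auto

lemma D_power_minus: "(D ^^ n) (- f) = - (D ^^ n) f"
  by (induction n) auto

lemma grading_D_power: "grading ((D ^^ n) f) = (-1) ^ n * (D ^^ n) (grading f)"
  by (induction n) (auto simp: minus_one_power_iff)

subsection \<open>The kernel of the super derivative\<close>

lemma mcoeff_mult_empty: "mcoeff (f * g) {#} = mcoeff f {#} * mcoeff g {#}"
proof -
  have "{M. M \<subseteq># {#}} = {{#}}" by auto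
  then show ?thesis by (simp add: times_sdp.rep_eq admissible_def)
qed

lemma mcoeff_gen_empty [simp]: "mcoeff (gen k) {#} = 0"
  by (simp add: gen.rep_eq)

lemma mcoeff_D_empty [simp]: "mcoeff (D f) {#} = 0"
  by (induction f rule: sdp_induct)
    (simp_all add: D_mult D_const_mult mcoeff_simps mcoeff_mult_empty)

lemma mcoeff_grading_empty [simp]: "mcoeff (grading f) {#} = mcoeff f {#}"
  by (simp add: grading.rep_eq fdeg_def)

lemma mcoeff_numeral_empty [simp]: "mcoeff (numeral n :: 'k::field_char_0 sdp) {#} = numeral n"
  using const.rep_eq[of "numeral n :: 'k"] by (simp add: const_numeral)

lemma mcoeff_of_int_empty [simp]: "mcoeff (of_int n :: 'k::field_char_0 sdp) {#} = of_int n"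
  using const.rep_eq[of "of_int n :: 'k"] by (simp add: const_of_int)

text \<open>D raises one letter by one. Hence the letter \<open>Suc N\<close> can arise from words
  with letters up to N only by differentiating an N; this bound discards all other terms.\<close>

definition bounded_letters :: "nat \<Rightarrow> 'k::field_char_0 sdp \<Rightarrow> bool" where
  "bounded_letters N f \<longleftrightarrow> (\<forall>M. mcoeff f M \<noteq> 0 \<longrightarrow> (\<forall>x\<in>#M. x \<le> N))"

lemma bounded_letters_mult:
  assumes "bounded_letters N f" "bounded_letters N g" shows "bounded_letters N (f * g)"
  unfolding bounded_letters_def
proof (intro allI impI ballI)
  fix P x assume P: "mcoeff (f * g) P \<noteq> 0" and x: "x \<in># P"
  obtain M where M: "M \<subseteq># P" "mcoeff f M \<noteq> 0" "mcoeff g (P - M) \<noteq> 0"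
  proof (rule ccontr)
    assume "\<not> thesis"
    then have "\<And>M. M \<subseteq># P \<Longrightarrow> mcoeff f M = 0 \<or> mcoeff g (P - M) = 0" using that by blast
    then have "mcoeff (f * g) P = 0"
      unfolding times_sdp.rep_eq by (auto intro!: sum.neutral)
    then show False using P by simp
  qed
  have "x \<in># M + (P - M)" using x M by simp
  then have "x \<in># M \<or> x \<in># P - M" by (metis union_iff)
  then show "x \<le> N" using assms M by (auto simp: bounded_letters_def)
qed

lemma bounded_letters_add: "bounded_letters N f \<Longrightarrow> bounded_letters N g \<Longrightarrow> bounded_letters N (f + g)"
  unfolding bounded_letters_def plus_sdp.rep_eq by (metis add.right_neutral)

lemma bounded_letters_gen: "k \<le> N \<Longrightarrow> bounded_letters N (gen k)"
  by (simp add: bounded_letters_def gen.rep_eq)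

lemma bounded_letters_0 [simp]: "bounded_letters N 0"
  by (simp add: bounded_letters_def mcoeff_simps)

lemma bounded_letters_1 [simp]: "bounded_letters N 1"
  by (simp add: bounded_letters_def mcoeff_simps)

lemma bounded_letters_grading: "bounded_letters N f \<Longrightarrow> bounded_letters N (grading f)"
  by (simp add: bounded_letters_def grading.rep_eq)

lemma bounded_letters_word: "\<forall>x\<in>set ks. x \<le> N \<Longrightarrow> bounded_letters N (word ks)"
  by (induction ks) (simp_all add: bounded_letters_mult bounded_letters_gen)

lemma bounded_letters_D_word: "\<forall>x\<in>set ks. x < N \<Longrightarrow> bounded_letters N (D (word ks))"
  by (induction ks) (simp_all add: D_mult bounded_letters_mult bounded_letters_gen
      bounded_letters_add bounded_letters_word bounded_letters_grading less_imp_le)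

lemma D_gen_power:
  assumes "odd N"
  shows "D (gen N ^ c :: 'k::field_char_0 sdp) = of_nat c * (gen N ^ (c - 1) * gen (Suc N))"
proof (induction c)
  case (Suc c)
  have c: "gen N * gen (Suc N) = gen (Suc N) * (gen N :: 'k sdp)"
    using assms gen_gen[of N "Suc N"] by simp
  have "gen (Suc N) * gen N ^ c = gen N ^ c * (gen (Suc N) :: 'k sdp)"
    by (rule power_commuting_commutes[OF c, symmetric])
  moreover have "gen N * (of_nat c * x) = of_nat c * (gen N * x)" for x :: "'k sdp"
    by (metis mult.assoc mult_of_nat_commute)
  moreover have "of_nat c * (gen N * (gen N ^ (c - 1) * gen (Suc N))) = of_nat c * (gen N ^ c * (gen (Suc N) :: 'k sdp))"
    by (cases c) (simp_all add: mult.assoc)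
  ultimately show ?case
    using assms Suc by (simp add: D_mult grading_gen algebra_simps)
qed simp

lemma mcoeff_of_nat_mult: "mcoeff (of_nat c * f) P = of_nat c * mcoeff f P"
  using mcoeff_const_mult[of "of_nat c" f P] by (simp add: const_of_nat)

text \<open>Split M into its letters below N and c copies of N. Only the derivative of the block of
  N's contains \<open>Suc N\<close>; passing D across the lower letters gives the sign, and the
  power rule gives the multiplicity. The condition says that P is M with one N replaced by
  \<open>Suc N\<close>, written without subtraction.\<close>

lemma mcoeff_D_word_top:
  fixes M P :: "nat multiset"
  assumes M: "admissible M" "\<forall>x\<in>#M. x \<le> N" and P: "Suc N \<in># P"
  shows "mcoeff (D (word (sorted_list_of_multiset M) :: 'k::field_char_0 sdp)) P =
    (if add_mset (Suc N) M = add_mset N P then (-1) ^ fdeg (filter_mset (\<lambda>x. x < N) M) * of_nat (count M N) else 0)"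
proof -
  define U where "U = filter_mset (\<lambda>x. x < N) M"
  define us where "us = sorted_list_of_multiset U"
  define c where "c = count M N"
  have MU: "M = U + replicate_mset c N"
    using M(2) by (auto simp: U_def c_def multiset_eq_iff count_eq_zero_iff)
  have U: "\<forall>x\<in>#U. x < N" by (simp add: U_def)
  have sM: "sorted_list_of_multiset M = us @ replicate c N"
  proof -
    have "sorted (us @ replicate c N)" "mset (us @ replicate c N) = M"
      using U by (auto simp: us_def MU sorted_append less_imp_le)
    then show ?thesis by (metis sorted_list_of_multiset_mset sorted_sort_id)
  qed
  have gw: "grading (word us) = (-1) ^ fdeg U * (word us :: 'k sdp)"
  proof (rule sdp_eqI)
    fix Q
    have "sorted us" "admissible (mset us)" "mset us = U"
      using M(1) by (auto simp: us_def admissible_def U_def)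
    then have "mcoeff (word us :: 'k sdp) Q = of_bool (Q = U)"
      by (metis mcoeff_word)
    moreover have "mcoeff ((-1) ^ fdeg U * (word us :: 'k sdp)) Q = (-1) ^ fdeg U * mcoeff (word us) Q"
      by (cases "even (fdeg U)") (simp_all add: uminus_sdp.rep_eq)
    ultimately show "mcoeff (grading (word us)) Q = mcoeff ((-1) ^ fdeg U * (word us :: 'k sdp)) Q"
      by (simp add: grading.rep_eq)
  qed
  have Dp: "D (gen N ^ c :: 'k sdp) = of_nat c * word (replicate (c - 1) N @ [Suc N])"
  proof (cases "odd N")
    case True
    then show ?thesis by (simp add: D_gen_power prod_list_replicate)
  next
    case False
    \<comment> \<open>A fermionic top letter occurs at most once, so there is no power to
      differentiate.\<close>
    then have "c \<le> 1" using M(1) by (simp add: admissible_def c_def)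
    then show ?thesis by (cases c) auto
  qed
  have z: "mcoeff (D (word us) * gen N ^ c :: 'k sdp) P = 0"
  proof -
    have "bounded_letters N (D (word us) * gen N ^ c :: 'k sdp)"
      using U bounded_letters_word[of "replicate c N" N] bounded_letters_D_word[of us N]
      by (intro bounded_letters_mult) (auto simp: us_def prod_list_replicate)
    then show ?thesis using P by (metis bounded_letters_def Suc_n_not_le_n)
  qed
  have wc: "x * (of_nat c * y) = of_nat c * (x * y)" for x y :: "'k sdp"
    by (metis mult.assoc mult_of_nat_commute)
  define ts where "ts = us @ replicate (c - 1) N @ [Suc N]"
  have "word (sorted_list_of_multiset M) = word us * (gen N ^ c :: 'k sdp)"
    by (simp add: sM prod_list_replicate)
  then have "D (word (sorted_list_of_multiset M)) = D (word us) * gen N ^ c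
      + grading (word us) * D (gen N ^ c :: 'k sdp)"
    by (simp only: D_mult)
  also have "grading (word us) * D (gen N ^ c :: 'k sdp)
      = (-1) ^ fdeg U * (of_nat c * (word us * word (replicate (c - 1) N @ [Suc N])))"
    by (simp only: gw Dp mult.assoc wc)
  also have "word us * word (replicate (c - 1) N @ [Suc N]) = (word ts :: 'k sdp)"
    by (simp add: ts_def)
  finally have "D (word (sorted_list_of_multiset M)) = D (word us) * gen N ^ c
      + (-1) ^ fdeg U * (of_nat c * (word ts :: 'k sdp))" .
  moreover have "mcoeff ((-1) ^ fdeg U * (of_nat c * (word ts :: 'k sdp))) P
      = (-1) ^ fdeg U * of_nat c * mcoeff (word ts) P"
    by (cases "even (fdeg U)") (simp_all add: uminus_sdp.rep_eq mcoeff_of_nat_mult)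
  ultimately have *: "mcoeff (D (word (sorted_list_of_multiset M) :: 'k sdp)) P
      = (-1) ^ fdeg U * of_nat c * mcoeff (word ts) P"
    by (simp add: plus_sdp.rep_eq z)
  show ?thesis
  proof (cases "c = 0")
    case True
    then show ?thesis using * by (simp add: c_def)
  next
    case False
    have mt: "add_mset N (mset ts) = add_mset (Suc N) M"
      using False by (cases c) (auto simp: ts_def MU us_def)
    have "sorted ts"
      using U by (auto simp: ts_def us_def sorted_append less_imp_le)
    moreover have "admissible (mset ts)"
      unfolding admissible_def
    proof (intro allI impI)
      fix k :: nat assume k: "even k"
      have "count (add_mset N (mset ts)) k = count (add_mset (Suc N) M) k" using mt by simp
      moreover have "count M (Suc N) = 0" using M(2) by (auto simp: count_eq_zero_iff)
      moreover have "count M k \<le> 1" using M(1) k by (simp add: admissible_def)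
      ultimately show "count (mset ts) k \<le> 1"
        by (cases "k = N"; cases "k = Suc N") auto
    qed
    ultimately have "mcoeff (word ts :: 'k sdp) P = of_bool (P = mset ts)"
      by (rule mcoeff_word)
    moreover have "P = mset ts \<longleftrightarrow> add_mset (Suc N) M = add_mset N P"
      using mt by (metis add_mset_add_single add_right_cancel)
    ultimately show ?thesis using * by (simp add: c_def U_def)
  qed
qed

text \<open>Let N be the largest letter of f and replace one N by \<open>Suc N\<close> in a monomial
  M that contains it. M is the only monomial of f contributing to the resulting P in D f, and its
  factor, a sign times a positive multiplicity, is nonzero in characteristic 0.\<close>

lemma D_eq_0_iff: "D f = 0 \<longleftrightarrow> (f :: 'k::field_char_0 sdp) = const (mcoeff f {#})"
proof
  assume Df: "D f = 0"
  let ?S = "{M. mcoeff f M \<noteq> 0}"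
  show "f = const (mcoeff f {#})"
  proof (rule ccontr)
    assume "f \<noteq> const (mcoeff f {#})"
    then obtain M0 where M0: "mcoeff f M0 \<noteq> mcoeff (const (mcoeff f {#})) M0" by (meson sdp_eqI)
    then have "M0 \<noteq> {#}" "M0 \<in> ?S" by (auto simp: const.rep_eq split: if_splits)
    define X where "X = (\<Union>M\<in>?S. set_mset M)"
    have X: "finite X" "X \<noteq> {}" using \<open>M0 \<noteq> {#}\<close> \<open>M0 \<in> ?S\<close> by (auto simp: X_def)
    define N where "N = Max X"
    have "N \<in> X" using X by (simp add: N_def)
    then obtain M where M: "mcoeff f M \<noteq> 0" "N \<in># M" by (auto simp: X_def)
    have le: "x \<le> N" if "mcoeff f M' \<noteq> 0" "x \<in># M'" for M' x
      using that X by (auto simp: N_def X_def intro!: Max_ge)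
    define P where "P = add_mset (Suc N) (M - {#N#})"
    have NP: "add_mset N P = add_mset (Suc N) M" using M(2) by (simp add: P_def add_mset_commute)
    have "D f = D (\<Sum>M\<in>?S. const (mcoeff f M) * word (sorted_list_of_multiset M))"
      by (subst sdp_expand[of f]) simp
    also have "\<dots> = (\<Sum>M\<in>?S. const (mcoeff f M) * D (word (sorted_list_of_multiset M)))"
      by (simp add: D_def superder_sum superder_const_mult)
    finally have "mcoeff (D f) P = (\<Sum>M'\<in>?S. mcoeff f M' * mcoeff (D (word (sorted_list_of_multiset M'))) P)"
      by (simp add: mcoeff_sum mcoeff_const_mult)
    also have "\<dots> = (\<Sum>M'\<in>?S. if M' = M then mcoeff f M * ((-1) ^ fdeg (filter_mset (\<lambda>x. x < N) M) * of_nat (count M N)) else 0)"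
    proof (intro sum.cong refl)
      fix M' assume "M' \<in> ?S"
      then have "mcoeff (D (word (sorted_list_of_multiset M') :: 'k sdp)) P =
        (if add_mset (Suc N) M' = add_mset N P then (-1) ^ fdeg (filter_mset (\<lambda>x. x < N) M') * of_nat (count M' N) else 0)"
        by (intro mcoeff_D_word_top) (auto simp: P_def mcoeff_admissible le)
      then show "mcoeff f M' * mcoeff (D (word (sorted_list_of_multiset M'))) P =
         (if M' = M then mcoeff f M * ((-1) ^ fdeg (filter_mset (\<lambda>x. x < N) M) * of_nat (count M N)) else 0)"
        by (auto simp: NP)
    qed
    also have "\<dots> = mcoeff f M * ((-1) ^ fdeg (filter_mset (\<lambda>x. x < N) M) * of_nat (count M N))"
      using M(1) by simp
    also have "\<dots> \<noteq> 0" using M by (auto simp: count_eq_zero_iff)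
    finally show False using Df by (simp add: mcoeff_simps)
  qed
next
  assume "f = const (mcoeff f {#})"
  then show "D f = 0" by (metis D_const)
qed

lemma D_eq_0: "D f = 0 \<Longrightarrow> mcoeff f {#} = 0 \<Longrightarrow> f = 0"
  using D_eq_0_iff[of f] by simp

lemma D_cancel: "D f = D g \<Longrightarrow> mcoeff f {#} = mcoeff g {#} \<Longrightarrow> f = g"
  using D_eq_0[of "f - g"] by (simp add: sdp_minus_rep)

text \<open>\<open>D f\<close> never has a constant term, so the statement for D can be applied
  twice under a single condition on constants.\<close>

lemma dx_cancel: "dx f = dx g \<Longrightarrow> mcoeff f {#} = mcoeff g {#} \<Longrightarrow> f = g"
  unfolding dx_def by (intro D_cancel[of f g] D_cancel[of "D f" "D g"]) simp_all

lemma odd_mcoeff_empty: "grading f = - f \<Longrightarrow> mcoeff f {#} = 0"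
  using mcoeff_grading_empty[of f] by (simp add: uminus_sdp.rep_eq del: mcoeff_grading_empty)

lemma D_odd_eq_0: "D f = 0 \<Longrightarrow> grading f = - f \<Longrightarrow> f = 0"
  by (simp add: D_eq_0 odd_mcoeff_empty)

lemma antideriv_D: "D h = g \<Longrightarrow> mcoeff h {#} = 0 \<Longrightarrow> antideriv D g = Some h"
proof -
  assume h: "D h = g" "mcoeff h {#} = 0"
  then have "(D h' = g \<and> mcoeff h' {#} = 0) \<longleftrightarrow> h' = h" for h'
    using D_cancel[of h' h] by auto
  then show ?thesis by (simp add: antideriv_def)
qed

lemma antideriv_dx: "dx h = g \<Longrightarrow> mcoeff h {#} = 0 \<Longrightarrow> antideriv dx g = Some h"
proof -
  assume h: "dx h = g" "mcoeff h {#} = 0"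
  then have "(dx h' = g \<and> mcoeff h' {#} = 0) \<longleftrightarrow> h' = h" for h'
    using dx_cancel[of h' h] by auto
  then show ?thesis by (simp add: antideriv_def)
qed

section \<open>The ring of super pseudodifferential operators\<close>

lemma spdo_eqI: "(\<And>m. opcoeff A m = opcoeff B m) \<Longrightarrow> A = B"
  by (metis ext opcoeff_inject)

lemma opcoeff_minus: "opcoeff (A - B) m = opcoeff A m - opcoeff B m"
  unfolding minus_spdo_def plus_spdo.rep_eq uminus_spdo.rep_eq by (rule add_uminus_conv_diff)

lift_definition monom_op :: "'k::field_char_0 sdp \<Rightarrow> int \<Rightarrow> 'k spdo" is "\<lambda>a n i. if i = n then a else 0"
  by auto

lemma fun_op_monom: "fun_op a = monom_op a 0"
  by (rule spdo_eqI) (simp add: fun_op.rep_eq monom_op.rep_eq)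

lemma D_op_monom: "D_op n = monom_op 1 n"
  by (rule spdo_eqI) (simp add: D_op.rep_eq monom_op.rep_eq)

lemma D_op_0: "D_op 0 = 1"
  by (rule spdo_eqI) (simp add: D_op.rep_eq one_spdo.rep_eq)

lemmas opcoeff_simps = zero_spdo.rep_eq one_spdo.rep_eq plus_spdo.rep_eq uminus_spdo.rep_eq
  opcoeff_minus fun_op.rep_eq D_op.rep_eq diff_part.rep_eq evol_op.rep_eq monom_op.rep_eq

instance spdo :: (field_char_0) ab_group_add
  by standard (rule spdo_eqI; simp add: opcoeff_simps)+

lemma opcoeff_sum: "opcoeff (sum F S) m = (\<Sum>x\<in>S. opcoeff (F x) m)"
  by (induction S rule: infinite_finite_induct) (simp_all add: opcoeff_simps)

definition order_le :: "int \<Rightarrow> 'k::field_char_0 spdo \<Rightarrow> bool" where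
  "order_le N A \<longleftrightarrow> (\<forall>i>N. opcoeff A i = 0)"

lemma order_le_ex: obtains N where "order_le N A"
  using opcoeff[of A] by (auto simp: order_le_def)

lemma order_le_mono: "order_le N A \<Longrightarrow> N \<le> N' \<Longrightarrow> order_le N' A"
  by (auto simp: order_le_def)

lemma order_leD: "order_le N A \<Longrightarrow> N < i \<Longrightarrow> opcoeff A i = 0"
  by (auto simp: order_le_def)

lemma order_le_0 [simp]: "order_le N 0"
  by (simp add: order_le_def opcoeff_simps)

lemma order_le_add: "order_le N A \<Longrightarrow> order_le N B \<Longrightarrow> order_le N (A + B)"
  by (simp add: order_le_def opcoeff_simps)

lemma order_le_diff: "order_le N A \<Longrightarrow> order_le N B \<Longrightarrow> order_le N (A - B)"
  by (simp add: order_le_def opcoeff_simps)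

lemma order_le_minus: "order_le N A \<Longrightarrow> order_le N (- A)"
  by (simp add: order_le_def opcoeff_simps)

lemma order_le_monom: "n \<le> N \<Longrightarrow> order_le N (monom_op a n)"
  by (simp add: order_le_def opcoeff_simps)

lemma order_le_fun: "order_le 0 (fun_op a)"
  by (simp add: order_le_def opcoeff_simps)

lemma order_le_D: "order_le n (D_op n)"
  by (simp add: order_le_def opcoeff_simps)

lemma superbinom_0 [simp]: "superbinom i 0 = 1"
  by (simp add: superbinom_def)

lemma leibniz_coeff_add: "leibniz_coeff i k (a + b) = leibniz_coeff i k a + leibniz_coeff i k b"
  by (simp add: leibniz_coeff_def D_power_add distrib_left)

lemma leibniz_coeff_zero [simp]: "leibniz_coeff i k 0 = 0"
  by (simp add: leibniz_coeff_def)

lemma leibniz_coeff_0: "leibniz_coeff i 0 a = (if even i then a else grading a)"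
  by (simp add: leibniz_coeff_def)

text \<open>The product is defined by a sum over the supports of its factors; with order bounds the
  index set no longer depends on the factors, which makes bilinearity a termwise matter.\<close>

lemma opcoeff_mult:
  assumes "order_le N A" "order_le N' B"
  shows "opcoeff (A * B) m = (\<Sum>(i, j) | i \<le> N \<and> j \<le> N' \<and> m \<le> i + j.
    opcoeff A i * leibniz_coeff i (nat (i + j - m)) (opcoeff B j))"
proof -
  have "{(i, j). i \<le> N \<and> j \<le> N' \<and> m \<le> i + j} \<subseteq> {m - N'..N} \<times> {m - N..N'}" by auto
  then have "finite {(i, j). i \<le> N \<and> j \<le> N' \<and> m \<le> i + j}" by (rule finite_subset) auto
  moreover have "{(i, j). opcoeff A i \<noteq> 0 \<and> opcoeff B j \<noteq> 0 \<and> m \<le> i + j} \<subseteq> {(i, j). i \<le> N \<and> j \<le> N' \<and> m \<le> i + j}"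
    using assms by (auto simp: order_le_def) (meson not_le)+
  ultimately show ?thesis
    unfolding times_spdo.rep_eq by (intro sum.mono_neutral_left) auto
qed

lemma opcoeff_mult_monom:
  assumes "order_le N A"
  shows "opcoeff (A * monom_op b n) m = (\<Sum>i=m-n..N. opcoeff A i * leibniz_coeff i (nat (i + n - m)) b)"
proof -
  have "opcoeff (A * monom_op b n) m = (\<Sum>(i, j) | i \<le> N \<and> j \<le> n \<and> m \<le> i + j.
    opcoeff A i * leibniz_coeff i (nat (i + j - m)) (opcoeff (monom_op b n) j))"
    by (rule opcoeff_mult[OF assms order_le_monom]) simp
  also have "\<dots> = (\<Sum>(i, j)\<in>{m-n..N} \<times> {n}. opcoeff A i * leibniz_coeff i (nat (i + j - m)) b)"
  proof (rule sum.mono_neutral_cong_right)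
    have "{(i, j). i \<le> N \<and> j \<le> n \<and> m \<le> i + j} \<subseteq> {m - n..N} \<times> {m - N..n}" by auto
    then show "finite {(i, j). i \<le> N \<and> j \<le> n \<and> m \<le> i + j}" by (rule finite_subset) auto
  qed (auto simp: monom_op.rep_eq split: if_splits)
  also have "\<dots> = (\<Sum>i=m-n..N. opcoeff A i * leibniz_coeff i (nat (i + n - m)) b)"
    by (simp flip: sum.cartesian_product)
  finally show ?thesis .
qed

lemma opcoeff_monom_mult:
  assumes "order_le N B"
  shows "opcoeff (monom_op a n * B) m = a * (\<Sum>j=m-n..N. leibniz_coeff n (nat (n + j - m)) (opcoeff B j))"
proof -
  have "opcoeff (monom_op a n * B) m = (\<Sum>(i, j) | i \<le> n \<and> j \<le> N \<and> m \<le> i + j.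
    opcoeff (monom_op a n) i * leibniz_coeff i (nat (i + j - m)) (opcoeff B j))"
    by (rule opcoeff_mult[OF order_le_monom assms]) simp
  also have "\<dots> = (\<Sum>(i, j)\<in>{n} \<times> {m-n..N}. a * leibniz_coeff i (nat (i + j - m)) (opcoeff B j))"
  proof (rule sum.mono_neutral_cong_right)
    have "{(i, j). i \<le> n \<and> j \<le> N \<and> m \<le> i + j} \<subseteq> {m - N..n} \<times> {m - n..N}" by auto
    then show "finite {(i, j). i \<le> n \<and> j \<le> N \<and> m \<le> i + j}" by (rule finite_subset) auto
  qed (auto simp: monom_op.rep_eq split: if_splits)
  also have "\<dots> = a * (\<Sum>j=m-n..N. leibniz_coeff n (nat (n + j - m)) (opcoeff B j))"
    by (simp flip: sum.cartesian_product add: sum_distrib_left)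
  finally show ?thesis .
qed

lemma spdo_distrib_right: "(A + B) * C = A * C + B * (C :: 'k::field_char_0 spdo)"
proof (rule spdo_eqI)
  fix m
  obtain NA NB NC where "order_le NA A" "order_le NB B" and C: "order_le NC C" by (meson order_le_ex)
  then have A: "order_le (max NA NB) A" and B: "order_le (max NA NB) B"
    by (auto intro: order_le_mono)
  show "opcoeff ((A + B) * C) m = opcoeff (A * C + B * C) m"
    unfolding plus_spdo.rep_eq[of "A * C"] opcoeff_mult[OF A C] opcoeff_mult[OF B C]
      opcoeff_mult[OF order_le_add[OF A B] C]
    by (simp add: plus_spdo.rep_eq distrib_right case_prod_beta sum.distrib)
qed

lemma spdo_distrib_left: "C * (A + B) = C * A + C * (B :: 'k::field_char_0 spdo)"
proof (rule spdo_eqI)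
  fix m
  obtain NA NB NC where "order_le NA A" "order_le NB B" and C: "order_le NC C" by (meson order_le_ex)
  then have A: "order_le (max NA NB) A" and B: "order_le (max NA NB) B"
    by (auto intro: order_le_mono)
  show "opcoeff (C * (A + B)) m = opcoeff (C * A + C * B) m"
    unfolding plus_spdo.rep_eq[of "C * A"] opcoeff_mult[OF C A] opcoeff_mult[OF C B]
      opcoeff_mult[OF C order_le_add[OF A B]]
    by (simp add: plus_spdo.rep_eq leibniz_coeff_add distrib_left case_prod_beta sum.distrib)
qed

lemma order_le_mult: "order_le N A \<Longrightarrow> order_le N' B \<Longrightarrow> order_le (N + N') (A * B)"
  unfolding order_le_def[of "N + N'"]
proof (intro allI impI)
  fix m assume "order_le N A" "order_le N' B" "N + N' < m"
  moreover from this have "{(i, j). i \<le> N \<and> j \<le> N' \<and> m \<le> i + j} = {}" by auto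
  ultimately show "opcoeff (A * B) m = 0" by (simp only: opcoeff_mult sum.empty)
qed

lemma opcoeff_mult_top:
  assumes "order_le N A" "order_le N' B"
  shows "opcoeff (A * B) (N + N') = opcoeff A N * (if even N then opcoeff B N' else grading (opcoeff B N'))"
proof -
  have "{(i, j). i \<le> N \<and> j \<le> N' \<and> N + N' \<le> i + j} = {(N, N')}" by auto
  then show ?thesis by (simp add: opcoeff_mult[OF assms] leibniz_coeff_0)
qed

lemma opcoeff_fun_mult: "opcoeff (fun_op a * B) m = a * opcoeff B m"
proof -
  obtain N where N: "order_le N B" by (rule order_le_ex)
  then have "order_le (max N m) B" by (auto intro: order_le_mono)
  moreover have "leibniz_coeff 0 (nat (j - m)) (opcoeff B j) = (if j = m then opcoeff B j else 0)"
    if "m \<le> j" for j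
    using that by (auto simp: leibniz_coeff_def superbinom_def gbinomial_0_left)
  ultimately show ?thesis
    unfolding fun_op_monom by (subst opcoeff_monom_mult[of "max N m"]) (simp_all add: sum.delta)
qed

lemma monom_op_mult: "monom_op a n * B = fun_op a * (D_op n * B)"
proof (rule spdo_eqI)
  fix m
  obtain N where N: "order_le N B" by (rule order_le_ex)
  show "opcoeff (monom_op a n * B) m = opcoeff (fun_op a * (D_op n * B)) m"
    by (simp add: opcoeff_fun_mult D_op_monom opcoeff_monom_mult[OF N])
qed

lemma fun_op_mult_assoc: "fun_op a * B * C = fun_op a * (B * C)"
proof (rule spdo_eqI)
  fix m
  obtain N N' where N: "order_le N B" "order_le N' C" by (meson order_le_ex)
  then have "order_le N (fun_op a * B)" using order_le_mult[OF order_le_fun N(1)] by simp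
  then show "opcoeff (fun_op a * B * C) m = opcoeff (fun_op a * (B * C)) m"
    using N by (simp add: opcoeff_fun_mult opcoeff_mult[of N _ N'] sum_distrib_left case_prod_beta mult.assoc)
qed

lemma opcoeff_D_mult: "opcoeff (D_op 1 * B) m = D (opcoeff B m) + grading (opcoeff B (m - 1))"
proof -
  obtain N where N: "order_le N B" by (rule order_le_ex)
  then have N: "order_le (max N m) B" by (auto intro: order_le_mono)
  have z: "leibniz_coeff 1 (nat (1 + j - m)) a = 0" if "m < j" for j and a :: "'a sdp"
  proof -
    have "nat (1 + j - m) div 2 \<noteq> 0" using that by auto
    then show ?thesis by (simp add: leibniz_coeff_def superbinom_def gbinomial_0_left)
  qed
  have "opcoeff (D_op 1 * B) m = (\<Sum>j=m-1..max N m. leibniz_coeff 1 (nat (1 + j - m)) (opcoeff B j))"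
    unfolding D_op_monom by (simp add: opcoeff_monom_mult[OF N])
  also have "\<dots> = (\<Sum>j\<in>{m-1,m}. leibniz_coeff 1 (nat (1 + j - m)) (opcoeff B j))"
    by (rule sum.mono_neutral_right) (auto intro!: z)
  also have "\<dots> = D (opcoeff B m) + grading (opcoeff B (m - 1))"
    by (simp add: leibniz_coeff_def superbinom_def)
  finally show ?thesis .
qed

text \<open>This is the coefficient form of D D^i = D^(i+1). Only for i and k both odd is it the
  Pascal identity for generalised binomials; for i odd and k even the two terms cancel, and for even
  i one of them is zero.\<close>

lemma leibniz_coeff_Pascal:
  "leibniz_coeff (i + 1) (Suc k) a = D (leibniz_coeff i k a) + grading (leibniz_coeff i (Suc k) a)"
proof (cases "even i")
  case i: True
  then obtain r where "i = 2 * r" by auto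
  with i show ?thesis
    by (cases "even k") (auto simp: leibniz_coeff_def superbinom_def D_const_mult grading_D_power elim!: evenE oddE)
next
  case i: False
  then obtain r where r: "i = 2 * r + 1" by (auto elim: oddE)
  show ?thesis
  proof (cases "even k")
    case True
    then show ?thesis using r
      by (auto simp: leibniz_coeff_def superbinom_def D_const_mult grading_D_power D_power_minus elim!: evenE)
  next
    case False
    then obtain l where l: "k = 2 * l + 1" by (auto elim: oddE)
    have "(1 + of_int r gchoose Suc l :: 'a) = (of_int r gchoose l) + (of_int r gchoose Suc l)"
      using gbinomial_Suc_Suc[of "of_int r :: 'a" l] by (simp add: add.commute)
    then show ?thesis using r l
      by (simp add: leibniz_coeff_def superbinom_def D_const_mult grading_D_power const_add distrib_right)
  qed
qed

lemma D_op_1_D_op_mult: "D_op 1 * (D_op i * A) = D_op (i + 1) * A"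
proof (rule spdo_eqI)
  fix m
  obtain N where N: "order_le N A" by (rule order_le_ex)
  have c: "opcoeff (D_op n * A) m = (\<Sum>j=m-n..N. leibniz_coeff n (nat (n + j - m)) (opcoeff A j))" for n m
    by (simp add: D_op_monom opcoeff_monom_mult[OF N])
  have Dsum: "D (sum F S) = (\<Sum>x\<in>S. D (F x))" for F :: "int \<Rightarrow> 'a sdp" and S
    by (simp add: D_def superder_sum)
  have gsum: "grading (sum F S) = (\<Sum>x\<in>S. grading (F x))" for F :: "int \<Rightarrow> 'a sdp" and S
    by (induction S rule: infinite_finite_induct) auto
  let ?j = "m - i - 1"
  have s: "{?j..N} = (if ?j \<le> N then insert ?j {m-i..N} else {})" "?j > N \<Longrightarrow> {m-i..N} = {}" by auto
  have P: "leibniz_coeff (i + 1) (nat (i + 1 + j - m)) a = D (leibniz_coeff i (nat (i + j - m)) a)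
      + grading (leibniz_coeff i (nat (i + j - (m - 1))) a)" if "j \<in> {m-i..N}" for j and a :: "'a sdp"
  proof -
    have "nat (i + 1 + j - m) = Suc (nat (i + j - m))" "nat (i + j - (m - 1)) = Suc (nat (i + j - m))"
      using that by auto
    then show ?thesis by (simp add: leibniz_coeff_Pascal)
  qed
  have m1: "m - 1 - i = ?j" "m - (i + 1) = ?j" by auto
  show "opcoeff (D_op 1 * (D_op i * A)) m = opcoeff (D_op (i + 1) * A) m"
  proof (cases "?j \<le> N")
    case True
    have "opcoeff (D_op (i + 1) * A) m = leibniz_coeff (i + 1) 0 (opcoeff A ?j)
        + (\<Sum>j=m-i..N. D (leibniz_coeff i (nat (i + j - m)) (opcoeff A j))
      + grading (leibniz_coeff i (nat (i + j - (m - 1))) (opcoeff A j)))"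
      unfolding c m1 s(1) if_P[OF True] by (subst sum.insert) (auto intro!: sum.cong simp: P)
    moreover have "opcoeff (D_op i * A) (m - 1) = leibniz_coeff i 0 (opcoeff A ?j)
        + (\<Sum>j=m-i..N. leibniz_coeff i (nat (i + j - (m - 1))) (opcoeff A j))"
      unfolding c m1 s(1) if_P[OF True] by (subst sum.insert) auto
    ultimately show ?thesis
      by (simp add: opcoeff_D_mult c[of i m] Dsum gsum sum.distrib leibniz_coeff_0)
  next
    case False
    then show ?thesis by (simp add: opcoeff_D_mult c)
  qed
qed

text \<open>Since \<open>grading\<close> is injective, the coefficients of A vanish one after the
  other from the top. This cancellation carries statements over to negative powers of D.\<close>

lemma D_op_1_inject: "D_op 1 * A = 0 \<Longrightarrow> A = 0"
proof (rule spdo_eqI)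
  fix m
  assume A: "D_op 1 * A = 0"
  obtain N where N: "order_le N A" by (rule order_le_ex)
  have "opcoeff A (N + 1 - int k) = 0" for k
  proof (induction k)
    case (Suc k)
    have "opcoeff (D_op 1 * A) (N + 1 - int k) = 0" using A by (simp add: opcoeff_simps)
    then have "grading (opcoeff A (N + 1 - int (Suc k))) = 0"
      using Suc by (simp add: opcoeff_D_mult algebra_simps)
    then show ?case by (metis grading_0 grading_grading)
  qed (simp add: order_leD[OF N])
  from this[of "nat (N + 1 - m)"] show "opcoeff A m = opcoeff 0 m"
    using order_leD[OF N, of m] by (cases "m \<le> N") (auto simp: opcoeff_simps)
qed

text \<open>A continuity principle: when the order rises by at most s, the coefficient at m sees
  only the finitely many terms of A with index at least m - s. Additive maps of this kind that agree
  on monomials agree everywhere, although A is an infinite series.\<close>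

lemma filtered_ext:
  fixes F G :: "'k::field_char_0 spdo \<Rightarrow> 'l::field_char_0 spdo"
  assumes F: "\<And>A B. F (A + B) = F A + F B" "\<And>n A. order_le n A \<Longrightarrow> order_le (n + s) (F A)"
    and G: "\<And>A B. G (A + B) = G A + G B" "\<And>n A. order_le n A \<Longrightarrow> order_le (n + s) (G A)"
    and eq: "\<And>a n. F (monom_op a n) = G (monom_op a n)"
  shows "F A = G A"
proof (rule spdo_eqI)
  fix m
  obtain N where N: "order_le N A" by (rule order_le_ex)
  define T where "T = (\<Sum>i=m-s..N. monom_op (opcoeff A i) i)"
  have z: "F 0 = 0" "G 0 = 0" using F(1)[of 0 0] G(1)[of 0 0] by simp_all
  have "F (sum h S) = (\<Sum>x\<in>S. F (h x))" "G (sum h S) = (\<Sum>x\<in>S. G (h x))" for h and S :: "int set"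
    by (induction S rule: infinite_finite_induct) (simp_all add: z F(1) G(1))
  then have T: "F T = G T" by (simp add: T_def eq)
  have "opcoeff T i = (if i \<in> {m-s..N} then opcoeff A i else 0)" for i
    by (simp add: T_def opcoeff_sum monom_op.rep_eq)
  then have "order_le (m - s - 1) (A - T)"
    using order_leD[OF N] by (auto simp: order_le_def opcoeff_minus)
  then have "opcoeff (F (A - T)) m = 0" "opcoeff (G (A - T)) m = 0"
    using order_leD[OF F(2)] order_leD[OF G(2)] by fastforce+
  moreover have "F A = F T + F (A - T)" "G A = G T + G (A - T)"
    by (simp_all flip: F(1) G(1))
  ultimately show "opcoeff (F A) m = opcoeff (G A) m"
    using T by (simp add: plus_spdo.rep_eq)
qed

lemma D_op_1_mult_assoc: "D_op 1 * (B * A) = (D_op 1 * B) * (A :: 'k::field_char_0 spdo)"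
proof -
  obtain N where N: "order_le N A" by (rule order_le_ex)
  show ?thesis
  proof (rule filtered_ext[where s = "N + 1" and F = "\<lambda>B. D_op 1 * (B * A)" and G = "\<lambda>B. D_op 1 * B * A"])
    fix n and B :: "'k spdo" assume B: "order_le n B"
    show "order_le (n + (N + 1)) (D_op 1 * (B * A))" "order_le (n + (N + 1)) (D_op 1 * B * A)"
      using order_le_mult[OF order_le_D order_le_mult[OF B N], of 1]
        order_le_mult[OF order_le_mult[OF order_le_D[of 1] B] N] by (simp_all add: algebra_simps)
  next
    fix b :: "'k sdp" and n
    have "D_op 1 * monom_op b n = monom_op (D b) n + monom_op (grading b) (n + 1)"
      by (rule spdo_eqI) (simp add: opcoeff_D_mult opcoeff_simps)
    then have "D_op 1 * monom_op b n * A = fun_op (D b) * (D_op n * A) + fun_op (grading b) * (D_op 1 * (D_op n * A))"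
      by (simp add: spdo_distrib_right monom_op_mult D_op_1_D_op_mult)
    also have "\<dots> = D_op 1 * (fun_op b * (D_op n * A))"
      by (rule spdo_eqI) (simp add: opcoeff_D_mult opcoeff_fun_mult opcoeff_simps D_mult algebra_simps)
    finally show "D_op 1 * (monom_op b n * A) = D_op 1 * monom_op b n * A"
      by (simp add: monom_op_mult)
  qed (simp_all add: spdo_distrib_left spdo_distrib_right)
qed

lemma D_op_mult_assoc: "D_op i * (B * A) = (D_op i * B) * (A :: 'k::field_char_0 spdo)"
proof (induction i rule: int_induct[where k = 0])
  case base
  have "1 * X = X" for X :: "'k spdo"
  proof -
    have "1 * X = fun_op 1 * X"
      by (simp flip: D_op_0 add: D_op_monom fun_op_monom)
    then show ?thesis by (auto intro: spdo_eqI simp: opcoeff_fun_mult)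
  qed
  then show ?case by (simp add: D_op_0)
next
  case (step1 i)
  then show ?case by (simp flip: D_op_1_D_op_mult add: D_op_1_mult_assoc)
next
  \<comment> \<open>Both sides become equal after left multiplication by D, which can be
    cancelled.\<close>
  case (step2 i)
  have "D_op 1 * (D_op (i - 1) * (B * A) - D_op (i - 1) * B * A) = 0"
  proof -
    have d: "D_op 1 * (X - Y) = D_op 1 * X - D_op 1 * Y" for X Y :: "'k spdo"
      using spdo_distrib_left[of "D_op 1" "X - Y" Y] by simp
    have "D_op 1 * (D_op (i - 1) * X) = D_op i * X" for X :: "'k spdo"
      using D_op_1_D_op_mult[of "i - 1" X] by simp
    then show ?thesis using step2 D_op_1_mult_assoc[of "D_op (i - 1) * B" A] by (simp only: d diff_self)
  qed
  then show ?case using D_op_1_inject by fastforce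
qed

lemma spdo_assoc: "C * B * A = C * (B * (A :: 'k::field_char_0 spdo))"
proof -
  obtain N N' where N: "order_le N A" "order_le N' B" by (meson order_le_ex)
  show ?thesis
  proof (rule filtered_ext[where s = "N + N'" and F = "\<lambda>C. C * B * A" and G = "\<lambda>C. C * (B * A)"])
    fix n and C :: "'k spdo" assume C: "order_le n C"
    show "order_le (n + (N + N')) (C * B * A)" "order_le (n + (N + N')) (C * (B * A))"
      using order_le_mult[OF order_le_mult[OF C N(2)] N(1)] order_le_mult[OF C order_le_mult[OF N(2,1)]]
      by (simp_all add: algebra_simps)
  qed (simp_all add: spdo_distrib_left spdo_distrib_right monom_op_mult fun_op_mult_assoc D_op_mult_assoc)
qed

lemma opcoeff_mult_D: "opcoeff (A * D_op n) m = opcoeff A (m - n)"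
proof -
  obtain N where N: "order_le N A" by (rule order_le_ex)
  then have N: "order_le (max N (m - n)) A" by (auto intro: order_le_mono)
  have "leibniz_coeff i (nat (i + n - m)) (1 :: 'a sdp) = (if i = m - n then 1 else 0)" if "m - n \<le> i" for i
  proof (cases "i = m - n")
    case False
    then have "nat (i + n - m) \<noteq> 0" using that by auto
    then obtain k where "nat (i + n - m) = Suc k" by (metis not0_implies_Suc)
    moreover have "(D ^^ k) (D (1 :: 'a sdp)) = 0" by simp
    ultimately show ?thesis using False by (simp add: leibniz_coeff_def funpow_swap1 del: D_1)
  qed (simp add: leibniz_coeff_0)
  then have "opcoeff (A * D_op n) m = (\<Sum>i=m-n..max N (m-n). if i = m - n then opcoeff A i else 0)"
    unfolding D_op_monom opcoeff_mult_monom[OF N] by (intro sum.cong) auto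
  then show ?thesis by simp
qed

instance spdo :: (field_char_0) ring_1
proof
  fix A B C :: "'a spdo"
  show "A * B * C = A * (B * C)" by (rule spdo_assoc)
  show "(A + B) * C = A * C + B * C" by (rule spdo_distrib_right)
  show "A * (B + C) = A * B + A * C" by (rule spdo_distrib_left)
  show "1 * A = A"
    by (rule spdo_eqI) (simp flip: D_op_0 add: D_op_monom, simp flip: fun_op_monom add: opcoeff_fun_mult)
  show "A * 1 = A"
    by (rule spdo_eqI) (simp flip: D_op_0 add: opcoeff_mult_D)
  show "(0 :: 'a spdo) \<noteq> 1"
  proof
    assume "(0 :: 'a spdo) = 1"
    then have "opcoeff (0 :: 'a spdo) 0 = opcoeff 1 0" by simp
    then show False by (simp add: opcoeff_simps)
  qed
qed

lemma monom_op_eq: "monom_op a n = fun_op a * D_op n"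
  by (rule spdo_eqI) (simp add: opcoeff_fun_mult opcoeff_simps)

lemma D_op_mult_D_op: "D_op i * D_op j = D_op (i + j)"
  by (rule spdo_eqI) (auto simp: opcoeff_mult_D opcoeff_simps)

lemma fun_op_mult: "fun_op (a * b) = fun_op a * fun_op b"
  by (rule spdo_eqI) (simp add: opcoeff_fun_mult opcoeff_simps)

lemma fun_op_add: "fun_op (a + b) = fun_op a + fun_op b"
  by (rule spdo_eqI) (simp add: opcoeff_simps)

lemma fun_op_minus: "fun_op (- a) = - fun_op a"
  by (rule spdo_eqI) (simp add: opcoeff_simps)

lemma D_op_fun_op: "D_op 1 * fun_op a = fun_op (D a) + fun_op (grading a) * D_op 1"
  by (rule spdo_eqI) (auto simp: opcoeff_mult_D opcoeff_D_mult opcoeff_fun_mult opcoeff_simps)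

section \<open>Solving equations order by order\<close>

lemma spdo_of_coeffs:
  assumes "\<And>i. N < i \<Longrightarrow> f i = 0" obtains A where "\<And>i. opcoeff A i = f i" "order_le N A"
proof -
  have "f \<in> {A. \<exists>N. \<forall>i>N. A i = 0}" using assms by auto
  then have "opcoeff (Abs_spdo f) i = f i" for i by (simp add: Abs_spdo_inverse)
  then show thesis using assms that[of "Abs_spdo f"] by (auto simp: order_le_def)
qed

lemma order_le_all_0: "(\<And>k. order_le (N - int k) A) \<Longrightarrow> A = 0"
proof (rule spdo_eqI)
  fix m assume a: "\<And>k. order_le (N - int k) A"
  show "opcoeff A m = opcoeff 0 m"
    using order_leD[OF a[of "nat (N - m) + 1"], of m] by (simp add: opcoeff_simps)
qed

lemma order_le_pred: "order_le N A \<Longrightarrow> opcoeff A N = 0 \<Longrightarrow> order_le (N - 1) A"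
  unfolding order_le_def by (metis add.commute diff_add_cancel linorder_neqE_linordered_idom zless_imp_add1_zle not_le)

text \<open>The setting of successive approximation: changing X at order i changes
  \<open>F X\<close> at order i + s by the same coefficient times a nonzero constant c. Equations
  for inverses (c = 1) and cube roots (c = 3) have this form, also when F is not linear.\<close>

locale filtered_equation =
  fixes F :: "'k::field_char_0 spdo \<Rightarrow> 'k spdo" and i0 s :: int and c :: 'k and X0 Z :: "'k spdo"
  assumes c: "c \<noteq> 0"
    and base: "order_le (i0 + s) (F X0 - Z)"
    and step: "\<And>X Y i. i \<le> i0 \<Longrightarrow> order_le i0 (X - X0) \<Longrightarrow> order_le i0 (Y - X0) \<Longrightarrow> order_le i (X - Y) \<Longrightarrow>
      order_le (i + s) (F X - F Y) \<and> opcoeff (F X - F Y) (i + s) = const c * opcoeff (X - Y) i"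
begin

lemma unique:
  assumes X: "order_le i0 (X - X0)" and Y: "order_le i0 (Y - X0)" and eq: "F X = F Y"
  shows "X = Y"
proof -
  have "order_le (i0 - int k) (X - Y)" for k
  proof (induction k)
    case 0
    have "X - Y = (X - X0) - (Y - X0)" by simp
    then show ?case using X Y by (metis order_le_diff of_nat_0 diff_zero)
  next
    case (Suc k)
    have "opcoeff (F X - F Y) (i0 - int k + s) = const c * opcoeff (X - Y) (i0 - int k)"
      using step[OF _ X Y Suc] by simp
    then have "opcoeff (X - Y) (i0 - int k) = 0"
      using eq c const_cancel[of c "opcoeff (X - Y) (i0 - int k)" 0] by (simp add: opcoeff_simps)
    then show ?case using order_le_pred[OF Suc] by (simp add: algebra_simps)
  qed
  then have "X - Y = 0" by (rule order_le_all_0)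
  then show ?thesis by simp
qed

primrec approx :: "nat \<Rightarrow> 'k spdo" where
  "approx 0 = X0"
| "approx (Suc k) = approx k + monom_op (const (1 / c) * opcoeff (Z - F (approx k)) (i0 - int k + s)) (i0 - int k)"

lemma approx_Suc_diff: "order_le (i0 - int k) (approx (Suc k) - approx k)"
  by (simp add: order_le_monom)

lemma approx_diff: "k \<le> l \<Longrightarrow> order_le (i0 - int k) (approx l - approx k)"
proof (induction l rule: dec_induct)
  case (step l)
  have "order_le (i0 - int k) (approx (Suc l) - approx l)"
    using approx_Suc_diff[of l] step by (elim order_le_mono) simp
  then have "order_le (i0 - int k) ((approx (Suc l) - approx l) + (approx l - approx k))"
    using step by (intro order_le_add)
  then show ?case by (simp only: diff_add_eq diff_diff_eq2) (simp add: algebra_simps)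
qed simp

lemma approx_X0: "order_le i0 (approx k - X0)"
  using approx_diff[of 0 k] by simp

lemma approx_sol: "order_le (i0 - int k + s) (F (approx k) - Z)"
proof (induction k)
  case 0
  then show ?case using base by simp
next
  case (Suc k)
  let ?i = "i0 - int k"
  have st: "order_le (?i + s) (F (approx (Suc k)) - F (approx k))"
      "opcoeff (F (approx (Suc k)) - F (approx k)) (?i + s) = const c * opcoeff (approx (Suc k) - approx k) ?i"
    using step[OF _ approx_X0 approx_X0 approx_Suc_diff, of k] by simp_all
  have "const c * opcoeff (approx (Suc k) - approx k) ?i = opcoeff (Z - F (approx k)) (?i + s)"
    using c by (simp add: opcoeff_simps const_mult_const)
  then have "opcoeff ((F (approx (Suc k)) - F (approx k)) + (F (approx k) - Z)) (?i + s) = 0"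
    using st(2) by (simp only: plus_spdo.rep_eq) (simp add: opcoeff_minus)
  then have "order_le (?i + s - 1) ((F (approx (Suc k)) - F (approx k)) + (F (approx k) - Z))"
    by (rule order_le_pred[OF order_le_add[OF st(1) Suc]])
  then show ?case by (simp add: algebra_simps)
qed

lemma solution: obtains X where "order_le i0 (X - X0)" "F X = Z"
proof -
  obtain N where N: "order_le N X0" by (rule order_le_ex)
  \<comment> \<open>The coefficient at i is final from stage \<open>i0 + 1 - i\<close> on; for i
    above i0 this is stage 0, that is \<open>X0\<close>. The limit is read off along this
    diagonal.\<close>
  have "opcoeff (approx (nat (i0 + 1 - i))) i = 0" if "max N i0 < i" for i
    using that order_leD[OF N, of i] by simp
  then obtain X where X: "\<And>i. opcoeff X i = opcoeff (approx (nat (i0 + 1 - i))) i"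
    by (rule spdo_of_coeffs[where N = "max N i0"]) auto
  have d: "order_le (i0 - int k) (X - approx k)" for k
    unfolding order_le_def
  proof (intro allI impI)
    fix i assume i: "i0 - int k < i"
    then have "nat (i0 + 1 - i) \<le> k" by auto
    then have "order_le (i0 - int (nat (i0 + 1 - i))) (approx k - approx (nat (i0 + 1 - i)))"
      by (rule approx_diff)
    then have "opcoeff (approx k - approx (nat (i0 + 1 - i))) i = 0"
      by (rule order_leD) auto
    then show "opcoeff (X - approx k) i = 0"
      by (simp add: opcoeff_minus X)
  qed
  have X0: "order_le i0 (X - X0)" using d[of 0] by simp
  have "order_le (i0 + s - int k) (F X - Z)" for k
  proof -
    have "order_le (i0 - int k + s) (F X - F (approx k))"
      using step[OF _ X0 approx_X0 d] by simp
    then have "order_le (i0 - int k + s) ((F X - F (approx k)) + (F (approx k) - Z))"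
      by (rule order_le_add[OF _ approx_sol])
    then show ?thesis by (simp add: algebra_simps)
  qed
  then have "F X - Z = 0" by (rule order_le_all_0)
  then show thesis using X0 that by simp
qed

end

section \<open>The Lax operator and its cube root\<close>

definition Lam :: "'k::field_char_0 spdo" where "Lam = D_op 3 + fun_op phi"

lemma L_Lam: "L = Lam * Lam"
  by (simp add: L_def Lam_def)

lemma grading_phi [simp]: "grading phi = - phi"
  by (simp add: grading_gen)

lemma D_op_3: "D_op 3 = D_op 1 * (D_op 1 * D_op 1)"
  by (simp add: D_op_mult_D_op)

lemma D_op_3_fun_op: "D_op 3 * fun_op f = fun_op (grading f) * D_op 3 + fun_op (D f) * D_op 2
    + fun_op (dx (grading f)) * D_op 1 + fun_op (D (dx f))"
proof -
  have c: "D_op 1 * (fun_op a * X) = fun_op (D a) * X + fun_op (grading a) * (D_op 1 * X)" for a and X :: "'a spdo"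
    using arg_cong[OF D_op_fun_op[of a], of "\<lambda>Y. Y * X"] by (simp add: distrib_right mult.assoc)
  have "D_op 3 * fun_op f = D_op 1 * (D_op 1 * (D_op 1 * fun_op f))"
    by (simp add: D_op_3 mult.assoc)
  then show ?thesis
    by (simp add: D_op_fun_op c distrib_left dx_def D_op_mult_D_op fun_op_minus fun_op_add)
qed

lemma opcoeff_Lam: "opcoeff Lam i = (if i = 3 then 1 else if i = 0 then phi else 0)"
  by (simp add: Lam_def opcoeff_simps)

lemma order_le_Lam: "order_le 3 Lam"
  by (simp add: order_le_def opcoeff_Lam)

lemma L_eq: "L = D_op 6 + fun_op (gen 1) * D_op 2 - fun_op (gen 2) * D_op 1 + fun_op (gen 3)"
proof -
  have "fun_op phi * fun_op phi = (0 :: 'a spdo)"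
    using odd_square_0[of "phi :: 'a sdp"] by (simp flip: fun_op_mult) (rule spdo_eqI, simp add: opcoeff_simps)
  then show ?thesis
    by (simp add: L_def distrib_left distrib_right D_op_mult_D_op D_op_3_fun_op dx_def fun_op_minus numeral_2_eq_2 numeral_3_eq_3)
qed

lemma opcoeff_L: "opcoeff L i = (if i = 6 then 1 else if i = 2 then gen 1 else if i = 1 then - gen 2 else if i = 0 then gen 3 else 0)"
  by (simp add: L_eq opcoeff_simps opcoeff_mult_D)

text \<open>The solver yields a left inverse K of \<open>Lam\<close>. Applied once more to K it
  yields a left inverse J of K, and then J = J (K Lam) = \<open>Lam\<close>, so K is
  two-sided.\<close>

lemma inverse_Lam: obtains K where "K * Lam = 1" "Lam * K = 1" "order_le (-3) K" "opcoeff K (-3) = 1"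
proof -
  interpret filtered_equation "\<lambda>X. X * Lam" "-4" 3 1 "D_op (-3)" "1 :: 'a spdo"
  proof
    have "D_op (-3) * Lam - 1 = D_op (-3) * fun_op (phi :: 'a sdp)"
      by (simp add: Lam_def distrib_left D_op_mult_D_op D_op_0)
    then show "order_le (-4 + 3) (D_op (-3) * Lam - (1 :: 'a spdo))"
      using order_le_mult[OF order_le_D[of "-3"] order_le_fun[of "phi :: 'a sdp"]] by (auto intro: order_le_mono)
  next
    fix X Y :: "'a spdo" and i assume W: "order_le i (X - Y)"
    have "X * Lam - Y * Lam = (X - Y) * Lam" by (simp add: left_diff_distrib)
    then show "order_le (i + 3) (X * Lam - Y * Lam) \<and> opcoeff (X * Lam - Y * Lam) (i + 3) = const 1 * opcoeff (X - Y) i"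
      using order_le_mult[OF W order_le_Lam] opcoeff_mult_top[OF W order_le_Lam] by (simp add: opcoeff_Lam)
  qed simp
  obtain K where K: "order_le (-4) (K - D_op (-3))" "K * Lam = (1 :: 'a spdo)"
    by (rule solution)
  have oK: "order_le (-3) K"
    using order_le_add[OF order_le_mono[OF K(1)] order_le_D, of "-3"] by simp
  have cK: "opcoeff K (-3) = 1"
    using order_leD[OF K(1), of "-3"] by (simp add: opcoeff_simps)
  interpret K: filtered_equation "\<lambda>X. X * K" "2" "-3" 1 "D_op 3" "1 :: 'a spdo"
  proof
    have "opcoeff (D_op 3 * K) 0 = 1"
      using opcoeff_mult_top[OF order_le_D[of 3] oK] by (simp add: cK opcoeff_simps)
    then have "opcoeff (D_op 3 * K - 1) 0 = 0" by (simp add: opcoeff_simps)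
    moreover have "order_le 0 (D_op 3 * K - 1)"
      using order_le_mult[OF order_le_D[of 3] oK] order_le_D[of 0] by (intro order_le_diff) (simp_all add: D_op_0)
    ultimately show "order_le (2 + - 3) (D_op 3 * K - 1)" using order_le_pred[of 0 "D_op 3 * K - 1"] by simp
  next
    fix X Y :: "'a spdo" and i assume W: "order_le i (X - Y)"
    have "X * K - Y * K = (X - Y) * K" by (simp add: left_diff_distrib)
    then show "order_le (i + - 3) (X * K - Y * K) \<and> opcoeff (X * K - Y * K) (i + - 3) = const 1 * opcoeff (X - Y) i"
      using order_le_mult[OF W oK] opcoeff_mult_top[OF W oK] by (simp add: cK)
  qed simp
  obtain J where J: "J * K = 1" by (rule K.solution)
  then have "J = Lam" using K(2) by (metis mult.assoc mult_1_left mult_1_right)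
  then show thesis using that K(2) J oK cK by blast
qed

abbreviation root_like :: "'k::field_char_0 spdo \<Rightarrow> bool" where
  "root_like X \<equiv> order_le 1 (X - D_op 2)"

lemma root_like_iff: "root_like X \<longleftrightarrow> opcoeff X 2 = 1 \<and> (\<forall>i>2. opcoeff X i = 0)"
proof
  assume "root_like X"
  then have "opcoeff (X - D_op 2) i = 0" if "i > 1" for i using that by (rule order_leD)
  from this[of 2] this show "opcoeff X 2 = 1 \<and> (\<forall>i>2. opcoeff X i = 0)"
    by (simp add: opcoeff_simps)
next
  assume X: "opcoeff X 2 = 1 \<and> (\<forall>i>2. opcoeff X i = 0)"
  show "root_like X"
    unfolding order_le_def
  proof (intro allI impI)
    fix i :: int assume "1 < i"
    then have "i = 2 \<or> 2 < i" by auto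
    then show "opcoeff (X - D_op 2) i = 0" using X by (auto simp: opcoeff_simps)
  qed
qed

lemma root_like_order: "root_like X \<Longrightarrow> order_le 2 X"
  unfolding root_like_iff by (simp add: order_le_def)

text \<open>X^3 - Y^3 telescopes into three products, each with one factor X - Y. The other factors
  have leading term D^2, which is even and causes no signs, so the leading coefficients add up to
  three times that of X - Y.\<close>

lemma cube_filtered:
  assumes "order_le 5 (D_op 6 - Z)"
  shows "filtered_equation (\<lambda>X. X ^ 3) 1 4 3 (D_op 2) (Z :: 'k::field_char_0 spdo)"
proof
  have "D_op 2 ^ 3 = (D_op 6 :: 'k spdo)" by (simp add: power3_eq_cube D_op_mult_D_op)
  then show "order_le (1 + 4) (D_op 2 ^ 3 - Z)" using assms by simp
next
  fix X Y :: "'k spdo" and i assume X: "root_like X" and Y: "root_like Y" and W: "order_le i (X - Y)"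
  have eq: "X ^ 3 - Y ^ 3 = X * (X * (X - Y)) + X * ((X - Y) * Y) + (X - Y) * (Y * Y)"
    by (simp add: power3_eq_cube algebra_simps)
  have o: "order_le 2 X" "order_le 2 Y" and c: "opcoeff X 2 = 1" "opcoeff Y 2 = 1"
    using X Y root_like_order by (auto simp: root_like_iff)
  note o1 = order_le_mult[OF o(1) W] order_le_mult[OF W o(2)] order_le_mult[OF o(2) o(2)]
  note o2 = order_le_mult[OF o(1) o1(1)] order_le_mult[OF o(1) o1(2)] order_le_mult[OF W o1(3)]
  have o3: "order_le (i + 4) (X * (X * (X - Y)))" "order_le (i + 4) (X * ((X - Y) * Y))" "order_le (i + 4) ((X - Y) * (Y * Y))"
    using o2 by (simp_all add: algebra_simps)
  have "opcoeff (X * (X * (X - Y))) (2 + (2 + i)) = opcoeff (X - Y) i"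
    using opcoeff_mult_top[OF o(1) o1(1)] opcoeff_mult_top[OF o(1) W] c by simp
  moreover have "opcoeff (X * ((X - Y) * Y)) (2 + (i + 2)) = opcoeff (X - Y) i"
    using opcoeff_mult_top[OF o(1) o1(2)] opcoeff_mult_top[OF W o(2)] c by simp
  moreover have "opcoeff ((X - Y) * (Y * Y)) (i + (2 + 2)) = opcoeff (X - Y) i"
    using opcoeff_mult_top[OF W o1(3)] opcoeff_mult_top[OF o(2) o(2)] c by simp
  moreover have "2 + (2 + i) = i + 4" "2 + (i + 2) = i + 4" "i + (2 + 2) = i + 4" by simp_all
  ultimately have "opcoeff (X ^ 3 - Y ^ 3) (i + 4) = opcoeff (X - Y) i + opcoeff (X - Y) i + opcoeff (X - Y) i"
    by (simp only: eq plus_spdo.rep_eq)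
  also have "\<dots> = const 3 * opcoeff (X - Y) i"
  proof -
    have "(3 :: 'k sdp) = 1 + 1 + 1" by simp
    then show ?thesis by (simp only: const_numeral distrib_right mult_1)
  qed
  finally show "order_le (i + 4) (X ^ 3 - Y ^ 3) \<and> opcoeff (X ^ 3 - Y ^ 3) (i + 4) = const 3 * opcoeff (X - Y) i"
    using o3 by (auto simp: eq intro!: order_le_add)
qed simp

lemma cube_root_unique: "root_like X \<Longrightarrow> root_like Y \<Longrightarrow> X ^ 3 = Y ^ 3 \<Longrightarrow> X = Y"
  using filtered_equation.unique[OF cube_filtered[of "D_op 6"]] by simp

lemma cbrt_L: "cbrt_L ^ 3 = (L :: 'a::field_char_0 spdo)" "root_like (cbrt_L :: 'a spdo)"
proof -
  have "order_le 5 (D_op 6 - L)"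
    by (auto simp: order_le_def opcoeff_simps opcoeff_L)
  from filtered_equation.solution[OF cube_filtered[OF this]]
  obtain Q :: "'a spdo" where Q: "root_like Q" "Q ^ 3 = L" by blast
  have "cbrt_L = Q"
    unfolding cbrt_L_def
  proof (rule the_equality)
    show "Q ^ 3 = L \<and> opcoeff Q 2 = 1 \<and> (\<forall>i>2. opcoeff Q i = 0)"
      using Q root_like_iff by blast
    fix X :: "'a spdo" assume "X ^ 3 = L \<and> opcoeff X 2 = 1 \<and> (\<forall>i>2. opcoeff X i = 0)"
    then show "X = Q"
      using cube_root_unique[of X Q] Q root_like_iff[of X] by metis
  qed
  then show "cbrt_L ^ 3 = (L :: 'a spdo)" "root_like (cbrt_L :: 'a spdo)" using Q by simp_all
qed

text \<open>The conjugate of the root by \<open>Lam\<close> is again a cube root of L with leading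
  term D^2, because \<open>Lam\<close> commutes with L.\<close>

lemma Lam_cbrt_L: "Lam * cbrt_L = cbrt_L * Lam"
proof -
  obtain K where K: "K * Lam = (1 :: 'a spdo)" "Lam * K = 1" "order_le (-3) K" "opcoeff K (-3) = 1"
    by (rule inverse_Lam)
  let ?Q = "cbrt_L :: 'a spdo"
  define X where "X = Lam * ?Q * K"
  have "X * X = Lam * ?Q * (K * Lam) * ?Q * K" by (simp only: X_def mult.assoc)
  then have "X * X = Lam * (?Q * ?Q) * K" by (simp add: K mult.assoc)
  then have "X * X * X = Lam * (?Q * ?Q) * (K * Lam) * ?Q * K" by (simp only: X_def mult.assoc)
  then have "X ^ 3 = Lam * ?Q ^ 3 * K" by (simp add: power3_eq_cube K mult.assoc)
  then have "X ^ 3 = L" by (simp add: cbrt_L L_Lam mult.assoc K)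
  moreover have "root_like X"
  proof -
    have Q: "order_le 2 ?Q" "opcoeff ?Q 2 = 1" using cbrt_L(2) root_like_order root_like_iff by blast+
    note o = order_le_mult[OF order_le_Lam Q(1)]
    have "order_le 2 X" using order_le_mult[OF o K(3)] by (simp add: X_def)
    moreover have "opcoeff X 2 = 1"
      using opcoeff_mult_top[OF o K(3)] opcoeff_mult_top[OF order_le_Lam Q(1)]
      by (simp add: X_def Q K opcoeff_Lam)
    ultimately show ?thesis by (meson root_like_iff order_leD)
  qed
  ultimately have "X = ?Q" using cube_root_unique[of X ?Q] cbrt_L by metis
  then have "?Q * Lam = X * Lam" by simp
  also have "\<dots> = Lam * ?Q" by (simp add: X_def mult.assoc K)
  finally show ?thesis by simp
qed

lemma Lam_cbrt_L_power: "Lam * cbrt_L ^ n = cbrt_L ^ n * Lam"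
  by (induction n) (simp_all add: mult.assoc, metis Lam_cbrt_L mult.assoc)

section \<open>Symmetries of the cube root\<close>

lemma fun_op_1 [simp]: "fun_op 1 = 1"
  by (simp add: fun_op_monom D_op_0 flip: D_op_monom)

text \<open>Functions and D generate all monomials once D is inverted, so multiplicativity has to be
  checked only for left factors of these two kinds. Injectivity of the image of D extends it to
  negative powers, and \<open>filtered_ext\<close> to series.\<close>

lemma filtered_hom_mult:
  fixes T :: "'k::field_char_0 spdo \<Rightarrow> 'k spdo"
  assumes add: "\<And>A B. T (A + B) = T A + T B"
    and ord: "\<And>n A. order_le n A \<Longrightarrow> order_le n (T A)"
    and one: "T 1 = 1"
    and f: "\<And>a X. T (fun_op a * X) = T (fun_op a) * T X"
    and d: "\<And>X. T (D_op 1 * X) = T (D_op 1) * T X"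
    and inj: "\<And>X. T (D_op 1) * X = 0 \<Longrightarrow> X = 0"
  shows "T (A * B) = T A * T B"
proof -
  obtain N where N: "order_le N B" by (rule order_le_ex)
  have D: "T (D_op i * X) = T (D_op i) * T X" for i X
  proof (induction i rule: int_induct[where k = 0])
    case base
    then show ?case by (simp add: D_op_0 one)
  next
    case (step1 i)
    have "D_op (i + 1) = D_op 1 * (D_op i :: 'k spdo)" by (simp add: D_op_mult_D_op add.commute)
    then show ?case using step1 by (simp add: mult.assoc d)
  next
    case (step2 i)
    have "D_op i = D_op 1 * (D_op (i - 1) :: 'k spdo)" by (simp add: D_op_mult_D_op)
    then have "T (D_op 1) * (T (D_op (i - 1) * X) - T (D_op (i - 1)) * T X) = 0"
      using step2 by (simp add: mult.assoc right_diff_distrib flip: d) (simp add: d mult.assoc)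
    then show ?case using inj by fastforce
  qed
  show ?thesis
  proof (rule filtered_ext[where s = N and F = "\<lambda>A. T (A * B)" and G = "\<lambda>A. T A * T B"])
    fix n and A :: "'k spdo" assume A: "order_le n A"
    show "order_le (n + N) (T (A * B))" by (rule ord[OF order_le_mult[OF A N]])
    show "order_le (n + N) (T A * T B)" by (rule order_le_mult[OF ord[OF A] ord[OF N]])
  qed (simp_all add: add distrib_right monom_op_eq mult.assoc f D)
qed

text \<open>The grading automorphism of operators, in which D itself counts as odd: even operators
  are fixed, odd ones negated.\<close>

lift_definition parity :: "'k::field_char_0 spdo \<Rightarrow> 'k spdo" is
  "\<lambda>A i. if even i then grading (A i) else - grading (A i)"
  by (metis grading_0 minus_zero)

lemma parity_add [simp]: "parity (A + B) = parity A + parity B"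
  by (rule spdo_eqI) (simp add: parity.rep_eq opcoeff_simps)

lemma parity_minus [simp]: "parity (- A) = - parity A"
  by (rule spdo_eqI) (simp add: parity.rep_eq opcoeff_simps)

lemma parity_diff [simp]: "parity (A - B) = parity A - parity B"
  by (rule spdo_eqI) (simp add: parity.rep_eq opcoeff_simps)

lemma parity_fun_op [simp]: "parity (fun_op a) = fun_op (grading a)"
  by (rule spdo_eqI) (simp add: parity.rep_eq opcoeff_simps)

lemma parity_D_op [simp]: "parity (D_op n) = (if even n then D_op n else - D_op n)"
  by (rule spdo_eqI) (simp add: parity.rep_eq opcoeff_simps)

lemma parity_1 [simp]: "parity 1 = 1"
  using parity_D_op[of 0] by (simp add: D_op_0)

lemma order_le_parity: "order_le n A \<Longrightarrow> order_le n (parity A)"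
  by (simp add: order_le_def parity.rep_eq)

lemma parity_mult [simp]: "parity (A * B) = parity A * parity B"
proof (rule filtered_hom_mult)
  fix X :: "'a spdo" and a
  show "parity (fun_op a * X) = parity (fun_op a) * parity X"
    by (rule spdo_eqI) (simp add: parity.rep_eq opcoeff_fun_mult)
  show "parity (D_op 1 * X) = parity (D_op 1) * parity X"
    by (rule spdo_eqI) (simp add: parity.rep_eq opcoeff_D_mult opcoeff_simps)
  show "parity (D_op 1) * X = 0 \<Longrightarrow> X = 0"
    by (auto dest: D_op_1_inject)
qed (simp_all add: order_le_parity)

lemma parity_power [simp]: "parity (A ^ n) = parity A ^ n"
  by (induction n) simp_all

lemma parity_diff_part: "parity (diff_part A) = diff_part (parity A)"
  by (rule spdo_eqI) (simp add: parity.rep_eq diff_part.rep_eq)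

lemma parity_parity [simp]: "parity (parity A) = A"
  by (rule spdo_eqI) (simp add: parity.rep_eq)

lemma parity_Lam: "parity Lam = - Lam"
  by (simp add: Lam_def fun_op_minus)

lemma parity_L: "parity L = L"
  by (simp add: L_Lam parity_Lam)

lemma parity_cbrt_L [simp]: "parity cbrt_L = cbrt_L"
proof (rule cube_root_unique)
  show "root_like (parity cbrt_L)"
    using order_le_parity[OF cbrt_L(2)] by simp
  show "parity cbrt_L ^ 3 = cbrt_L ^ 3"
    by (metis parity_power cbrt_L(1) parity_L)
qed (rule cbrt_L(2))

text \<open>This sets the superfield and all its derivatives to zero. Being a ring homomorphism, it
  maps the root of L to the root D^2 of D^6, hence powers of the root to pure powers of D.\<close>

lift_definition const_part :: "'k::field_char_0 spdo \<Rightarrow> 'k spdo" is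
  "\<lambda>A i. const (mcoeff (A i) {#})"
  by (metis const_0 zero_sdp.rep_eq)

lemma const_part_mult: "const_part (A * B) = const_part A * const_part B"
proof (rule filtered_hom_mult)
  fix X Y :: "'a spdo" and a n
  show "const_part (X + Y) = const_part X + const_part Y"
    by (rule spdo_eqI) (simp add: const_part.rep_eq opcoeff_simps mcoeff_simps const_add)
  show "order_le n X \<Longrightarrow> order_le n (const_part X)"
    by (simp add: order_le_def const_part.rep_eq mcoeff_simps)
  show "const_part (fun_op a * X) = const_part (fun_op a) * const_part X"
  proof -
    have "const_part (fun_op a) = fun_op (const (mcoeff a {#}))"
      by (rule spdo_eqI) (simp add: const_part.rep_eq opcoeff_simps mcoeff_simps)
    then show ?thesis
      by (auto intro!: spdo_eqI simp: const_part.rep_eq opcoeff_fun_mult mcoeff_mult_empty const_mult)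
  qed
  have D: "const_part (D_op n) = D_op n" for n
    by (rule spdo_eqI) (simp add: const_part.rep_eq opcoeff_simps mcoeff_simps)
  show "const_part (D_op 1 * X) = const_part (D_op 1) * const_part X"
    unfolding D by (rule spdo_eqI) (simp add: const_part.rep_eq opcoeff_D_mult mcoeff_simps fdeg_def)
  show "const_part (D_op 1) * X = 0 \<Longrightarrow> X = 0"
    unfolding D by (rule D_op_1_inject)
  show "const_part 1 = (1 :: 'a spdo)"
    using D[of 0] by (simp add: D_op_0)
qed

lemma const_part_D_op [simp]: "const_part (D_op n) = D_op n"
  by (rule spdo_eqI) (simp add: const_part.rep_eq opcoeff_simps mcoeff_simps)

lemma const_part_Lam [simp]: "const_part Lam = D_op 3"
  by (rule spdo_eqI) (simp add: const_part.rep_eq opcoeff_simps opcoeff_Lam mcoeff_simps)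

lemma const_part_power: "const_part (A ^ n) = const_part A ^ n"
proof (induction n)
  case 0
  then show ?case using const_part_D_op[of 0] by (simp add: D_op_0)
qed (simp add: const_part_mult)

lemma const_part_cbrt_L: "const_part cbrt_L = D_op 2"
proof (rule cube_root_unique)
  show "root_like (const_part cbrt_L :: 'a spdo)"
    using cbrt_L(2)[where ?'a = 'a] unfolding root_like_iff by (simp add: const_part.rep_eq mcoeff_simps)
  have "const_part cbrt_L ^ 3 = D_op 3 * (D_op 3 :: 'a spdo)"
    by (metis const_part_power cbrt_L(1) L_Lam const_part_mult const_part_Lam)
  then show "const_part cbrt_L ^ 3 = (D_op 2 :: 'a spdo) ^ 3"
    by (simp add: power3_eq_cube D_op_mult_D_op)
qed simp

lemma D_op_power: "D_op i ^ n = D_op (int n * i)"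
  by (induction n) (simp_all add: D_op_0 D_op_mult_D_op algebra_simps)

lemma mcoeff_cbrt_L_power: "i \<noteq> 2 * int n \<Longrightarrow> mcoeff (opcoeff (cbrt_L ^ n) i) {#} = 0"
proof -
  assume "i \<noteq> 2 * int n"
  then have "opcoeff (const_part (cbrt_L ^ n)) i = (0 :: 'a sdp)"
    by (simp add: const_part_power const_part_cbrt_L D_op_power D_op.rep_eq)
  then have "mcoeff (const (mcoeff (opcoeff (cbrt_L ^ n) i :: 'a sdp) {#})) {#} = 0"
    by (simp add: const_part.rep_eq mcoeff_simps)
  then show ?thesis by (simp add: const.rep_eq)
qed

subsection \<open>The adjoint\<close>

text \<open>\<open>(a D\<^sup>i)\<^sup>* = (-1)\<^bsup>|a| i\<^esup> (D\<^sup>i)\<^sup>* a\<close>, where \<open>(D\<^sup>i)\<^sup>* = (-1)\<^bsup>i(i+1)/2\<^esup> D\<^sup>i\<close>.\<close>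

definition adj_sign :: "int \<Rightarrow> 'k::field_char_0 sdp" where
  "adj_sign i = (if i mod 4 \<in> {0, 3} then 1 else -1)"

lemma adj_sign_Suc: "adj_sign (i + 1) = (if even i then - adj_sign i else adj_sign i)"
proof -
  have "i mod 4 = 0 \<or> i mod 4 = 1 \<or> i mod 4 = 2 \<or> i mod 4 = 3" by presburger
  moreover have "even i \<longleftrightarrow> even (i mod 4)" by presburger
  moreover have "(i + 1) mod 4 = (i mod 4 + 1) mod 4" by presburger
  ultimately show ?thesis by (auto simp: adj_sign_def)
qed

lemma adj_sign_cases: "adj_sign i \<in> {1, -1 :: 'a::field_char_0 sdp}"
  by (simp add: adj_sign_def)

definition twist :: "int \<Rightarrow> 'k::field_char_0 sdp \<Rightarrow> 'k sdp" where
  "twist i a = (if even i then a else grading a)"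

lift_definition adj :: "'k::field_char_0 spdo \<Rightarrow> 'k spdo" is
  "\<lambda>A m. \<Sum>i | A i \<noteq> 0 \<and> m \<le> i. adj_sign i * leibniz_coeff i (nat (i - m)) (twist i (A i))"
proof -
  fix A :: "int \<Rightarrow> 'k sdp" assume "\<exists>N. \<forall>i>N. A i = 0"
  then obtain N where "\<forall>i>N. A i = 0" by blast
  then have "{i. A i \<noteq> 0 \<and> m \<le> i} = {}" if "m > N" for m
    using that by auto
  then show "\<exists>N. \<forall>m>N. (\<Sum>i | A i \<noteq> 0 \<and> m \<le> i. adj_sign i * leibniz_coeff i (nat (i - m)) (twist i (A i))) = 0"
    by (intro exI[of _ N] allI impI) (simp only: sum.empty)
qed

lemma twist_0 [simp]: "twist i 0 = 0" and twist_add: "twist i (a + b) = twist i a + twist i b"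
  and twist_mult: "twist i (a * b) = twist i a * twist i b" and twist_1 [simp]: "twist i 1 = 1"
  by (simp_all add: twist_def)

lemma opcoeff_adj:
  assumes "order_le N A"
  shows "opcoeff (adj A) m = (\<Sum>i=m..N. adj_sign i * leibniz_coeff i (nat (i - m)) (twist i (opcoeff A i)))"
  unfolding adj.rep_eq using assms
  by (intro sum.mono_neutral_left) (auto simp: order_le_def not_less[symmetric])

lemma order_le_adj: "order_le N A \<Longrightarrow> order_le N (adj A)"
  by (simp add: order_le_def[of _ "adj A"] opcoeff_adj)

lemma adj_add: "adj (A + B) = adj A + adj B"
proof (rule spdo_eqI)
  fix m
  obtain NA NB where "order_le NA A" "order_le NB B" by (meson order_le_ex)
  then have A: "order_le (max NA NB) A" and B: "order_le (max NA NB) B"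
    by (auto intro: order_le_mono)
  show "opcoeff (adj (A + B)) m = opcoeff (adj A + adj B) m"
    by (simp add: opcoeff_adj[OF order_le_add[OF A B]] plus_spdo.rep_eq opcoeff_adj[OF A] opcoeff_adj[OF B]
      twist_add leibniz_coeff_add distrib_left sum.distrib)
qed

lemma adj_0 [simp]: "adj 0 = 0"
  using adj_add[of 0 0] by simp

lemma adj_minus: "adj (- A) = - adj A"
  using adj_add[of A "- A"] by (simp add: eq_neg_iff_add_eq_0 add.commute)

lemma adj_monom: "adj (monom_op a i) = fun_op (adj_sign i) * (D_op i * fun_op (twist i a))"
proof (rule spdo_eqI)
  fix m
  have "opcoeff (adj (monom_op a i)) m = (\<Sum>j=m..i. if j = i then adj_sign i * leibniz_coeff i (nat (i - m)) (twist i a) else 0)"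
    unfolding opcoeff_adj[OF order_le_monom[OF order_refl]] by (intro sum.cong) (auto simp: monom_op.rep_eq)
  moreover have "opcoeff (D_op i * fun_op (twist i a)) m = (\<Sum>j=m..i. if j = i then leibniz_coeff i (nat (i - m)) (twist i a) else 0)"
    unfolding fun_op_monom opcoeff_mult_monom[OF order_le_D] by (intro sum.cong) (auto simp: D_op.rep_eq)
  ultimately show "opcoeff (adj (monom_op a i)) m = opcoeff (fun_op (adj_sign i) * (D_op i * fun_op (twist i a))) m"
    by (simp add: opcoeff_fun_mult)
qed

lemma adj_fun_even:
  assumes "grading a = a" shows "adj (fun_op a * B) = adj B * fun_op a"
proof -
  show ?thesis
  proof (rule filtered_ext[where s = 0 and F = "\<lambda>B. adj (fun_op a * B)" and G = "\<lambda>B. adj B * fun_op a"])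
    fix n and A :: "'a spdo" assume A: "order_le n A"
    show "order_le (n + 0) (adj (fun_op a * A))" "order_le (n + 0) (adj A * fun_op a)"
      using order_le_adj[OF order_le_mult[OF order_le_fun A]] order_le_mult[OF order_le_adj[OF A] order_le_fun] by simp_all
  next
    fix b and i
    have "fun_op a * monom_op b i = monom_op (a * b) i"
      by (rule spdo_eqI) (simp add: opcoeff_fun_mult opcoeff_simps)
    moreover have "twist i (a * b) = twist i b * a"
      using even_commute[OF assms] assms by (simp add: twist_mult) (simp add: twist_def)
    ultimately show "adj (fun_op a * monom_op b i) = adj (monom_op b i) * fun_op a"
      by (simp add: adj_monom fun_op_mult mult.assoc)
  qed (simp_all add: adj_add distrib_left distrib_right)
qed

text \<open>The sign (-1)^(|a||B|) of the super adjoint is carried by \<open>parity B\<close>, so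
  that B need not be homogeneous.\<close>

lemma adj_fun_odd:
  assumes "grading a = - a" shows "adj (fun_op a * B) = adj (parity B) * fun_op a"
proof -
  show ?thesis
  proof (rule filtered_ext[where s = 0 and F = "\<lambda>B. adj (fun_op a * B)" and G = "\<lambda>B. adj (parity B) * fun_op a"])
    fix n and A :: "'a spdo" assume A: "order_le n A"
    show "order_le (n + 0) (adj (fun_op a * A))" "order_le (n + 0) (adj (parity A) * fun_op a)"
      using order_le_adj[OF order_le_mult[OF order_le_fun A]]
        order_le_mult[OF order_le_adj[OF order_le_parity[OF A]] order_le_fun] by simp_all
  next
    fix b and i
    have "fun_op a * monom_op b i = monom_op (a * b) i"
      by (rule spdo_eqI) (simp add: opcoeff_fun_mult opcoeff_simps)
    moreover have p: "parity (monom_op b i) = monom_op (if even i then grading b else - grading b) i"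
      by (rule spdo_eqI) (simp add: opcoeff_simps parity.rep_eq)
    moreover have "twist i (a * b) = twist i (if even i then grading b else - grading b) * a"
      using odd_commute[OF assms, of "grading b"] odd_commute[OF assms, of "b"] assms
      by (simp add: twist_def)
    ultimately show "adj (fun_op a * monom_op b i) = adj (parity (monom_op b i)) * fun_op a"
      by (simp only: adj_monom fun_op_mult mult.assoc)
  qed (simp_all add: adj_add distrib_left distrib_right)
qed

lemma adj_D_op_1_mult: "adj (D_op 1 * B) = - (adj (parity B) * D_op 1)"
proof -
  show ?thesis
  proof (rule filtered_ext[where s = 1 and F = "\<lambda>B. adj (D_op 1 * B)" and G = "\<lambda>B. - (adj (parity B) * D_op 1)"])
    fix n and A :: "'a spdo" assume A: "order_le n A"
    show "order_le (n + 1) (adj (D_op 1 * A))" "order_le (n + 1) (- (adj (parity A) * D_op 1))"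
      using order_le_adj[OF order_le_mult[OF order_le_D A]]
        order_le_minus[OF order_le_mult[OF order_le_adj[OF order_le_parity[OF A]] order_le_D]]
      by (simp_all add: add.commute)
  next
    fix b :: "'a sdp" and i
    have 1: "D_op 1 * monom_op b i = monom_op (D b) i + monom_op (grading b) (i + 1)"
      by (rule spdo_eqI) (simp add: opcoeff_D_mult opcoeff_simps)
    have p: "parity (monom_op b i) = monom_op (if even i then grading b else - grading b) i"
      by (rule spdo_eqI) (simp add: opcoeff_simps parity.rep_eq)
    have "D_op (i + 1) = D_op i * (D_op 1 :: 'a spdo)" by (simp add: D_op_mult_D_op)
    then show "adj (D_op 1 * monom_op b i) = - (adj (parity (monom_op b i)) * D_op 1)"
      by (simp add: 1 p adj_add adj_monom adj_sign_Suc twist_def fun_op_minus mult.assoc D_op_fun_op)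
        (simp add: distrib_left)
  qed (simp_all add: adj_add distrib_left distrib_right)
qed

lemma adj_D_op_mult: "adj (D_op i * B) = fun_op (adj_sign i) * (adj (if even i then B else parity B) * D_op i)"
proof (induction i arbitrary: B rule: int_induct[where k = 0])
  case base
  then show ?case by (simp add: D_op_0 adj_sign_def)
next
  case (step1 i)
  have "D_op (i + 1) = D_op 1 * (D_op i :: 'a spdo)" "D_op (i + 1) = D_op i * (D_op 1 :: 'a spdo)" by (simp_all add: D_op_mult_D_op add.commute)
  then show ?case
    using step1(2)[of "parity B"]
    by (simp add: mult.assoc adj_D_op_1_mult adj_sign_Suc fun_op_minus adj_minus)
next
  case (step2 i)
  have i: "D_op i = D_op 1 * (D_op (i - 1) :: 'a spdo)" "D_op i * D_op (-1) = (D_op (i - 1) :: 'a spdo)" "D_op 1 * D_op (-1) = (1 :: 'a spdo)"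
    by (simp_all add: D_op_mult_D_op D_op_0)
  have "adj (D_op i * parity B) = - (adj (parity (D_op (i - 1) * parity B)) * D_op 1)"
    unfolding i(1) mult.assoc by (rule adj_D_op_1_mult)
  then have "adj (D_op i * parity B) * D_op (-1) = - adj (parity (D_op (i - 1) * parity B))"
    by (simp add: mult.assoc i(3))
  moreover have "adj (D_op i * parity B) * D_op (-1) = fun_op (adj_sign i) * (adj (if even i then parity B else B) * D_op (i - 1))"
    by (subst step2(2)) (simp add: mult.assoc i(2))
  ultimately have "adj (parity (D_op (i - 1) * parity B)) = - (fun_op (adj_sign i) * (adj (if even i then parity B else B) * D_op (i - 1)))"
    by simp
  then show ?case
    using adj_sign_Suc[of "i - 1", where ?'a = 'a] by (auto simp: fun_op_minus adj_minus split: if_splits)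
qed

lemma fun_op_adj_sign: "fun_op (adj_sign i) \<in> {1, - 1 :: 'a::field_char_0 spdo}"
  using adj_sign_cases[of i, where ?'a = 'a] by (auto simp: fun_op_minus)

lemma spdo_double_eq_0:
  assumes "A + A = (0 :: 'k::field_char_0 spdo)" shows "A = 0"
proof (rule spdo_eqI)
  fix m
  have "opcoeff (A + A) m = 0" by (simp add: assms zero_spdo.rep_eq)
  then show "opcoeff A m = opcoeff 0 m"
    unfolding plus_spdo.rep_eq zero_spdo.rep_eq by (rule double_eq_0)
qed

text \<open>\<open>filtered_ext\<close> ranges over all operators, whereas the rule without sign
  requires an even left factor. The statement is therefore proved for \<open>A + parity A\<close>,
  which is even for every A and equals 2 A for the given one, and then halved.\<close>

lemma adj_mult_even:
  assumes "parity A = A" shows "adj (A * B) = adj B * adj A"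
proof -
  have "adj ((A + parity A) * B) = adj B * adj (A + parity A)"
  proof -
    obtain N where N: "order_le N B" by (rule order_le_ex)
    show ?thesis
    proof (rule filtered_ext[where s = N and F = "\<lambda>A. adj ((A + parity A) * B)" and G = "\<lambda>A. adj B * adj (A + parity A)"])
      fix n and A :: "'a spdo" assume A: "order_le n A"
      then have o: "order_le n (A + parity A)" by (intro order_le_add order_le_parity)
      show "order_le (n + N) (adj ((A + parity A) * B))"
        by (rule order_le_adj[OF order_le_mult[OF o N]])
      show "order_le (n + N) (adj B * adj (A + parity A))"
        using order_le_mult[OF order_le_adj[OF N] order_le_adj[OF o]] by (simp only: add.commute)
    next
      fix a :: "'a sdp" and i :: int
      define b where "b = a + (if even i then grading a else - grading a)"
      have m: "monom_op a i + parity (monom_op a i) = monom_op b i"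
        by (rule spdo_eqI) (simp add: opcoeff_simps parity.rep_eq b_def)
      have l: "adj (monom_op b i * B) = adj (fun_op b * (D_op i * B))"
        by (simp add: monom_op_eq mult.assoc)
      have "adj (monom_op b i * B) = adj B * adj (monom_op b i)"
      proof (cases "even i")
        case True
        then have "grading b = b" by (simp add: b_def)
        then show ?thesis
          unfolding l adj_monom using True fun_op_adj_sign[of i, where ?'a = 'a]
          by (auto simp: mult.assoc adj_fun_even adj_D_op_mult twist_def)
      next
        case False
        then have "grading b = - b" by (simp add: b_def)
        then show ?thesis
          unfolding l adj_monom using False fun_op_adj_sign[of i, where ?'a = 'a]
          by (auto simp: mult.assoc adj_fun_odd adj_D_op_mult twist_def fun_op_minus adj_minus)
      qed
      then show "adj ((monom_op a i + parity (monom_op a i)) * B) = adj B * adj (monom_op a i + parity (monom_op a i))"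
        by (simp only: m)
    qed (simp_all add: adj_add distrib_left distrib_right)
  qed
  then have "adj (A * B) + adj (A * B) = adj B * adj A + adj B * adj A"
    by (simp add: assms adj_add distrib_left distrib_right)
  moreover have "(x - y) + (x - y) = (x + x) - (y + y)" for x y :: "'a spdo" by (simp add: algebra_simps)
  ultimately have "(adj (A * B) - adj B * adj A) + (adj (A * B) - adj B * adj A) = 0"
    by (simp only: diff_self)
  then have "adj (A * B) - adj B * adj A = 0"
    using spdo_double_eq_0 by blast
  then show ?thesis by simp
qed

lemma adj_1: "adj 1 = 1"
  using adj_monom[of 1 0] by (simp add: adj_sign_def D_op_0 flip: D_op_monom)

text \<open>\<open>Lam\<close> is its own adjoint, and reversing the product of two odd factors
  costs a sign.\<close>

lemma adj_L: "adj L = - L"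
proof -
  have "adj (Lam * X) = adj (parity X) * Lam" for X :: "'a spdo"
  proof -
    have s: "adj_sign 3 = (1 :: 'a sdp)" by (simp add: adj_sign_def)
    show ?thesis
      unfolding Lam_def distrib_right adj_add
      by (simp add: adj_fun_odd adj_D_op_mult s distrib_left)
  qed
  from this[of Lam] this[of 1] show ?thesis
    by (simp add: L_Lam parity_Lam adj_minus adj_1)
qed

lemma adj_power_even: "parity A = A \<Longrightarrow> adj (A ^ n) = adj A ^ n"
  by (induction n) (simp_all add: adj_1 adj_mult_even power_commutes)

lemma adj_cbrt_L: "adj cbrt_L = - cbrt_L"
proof -
  have "- adj cbrt_L = (cbrt_L :: 'a spdo)"
  proof (rule cube_root_unique)
    have o: "order_le 2 (cbrt_L :: 'a spdo)" and c: "opcoeff (cbrt_L :: 'a spdo) 2 = 1"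
      using cbrt_L(2) root_like_order root_like_iff by blast+
    have "opcoeff (adj (cbrt_L :: 'a spdo)) 2 = -1"
      by (simp add: opcoeff_adj[OF o] c adj_sign_def leibniz_coeff_0)
    then show "root_like (- adj (cbrt_L :: 'a spdo))"
      unfolding root_like_iff using order_leD[OF order_le_adj[OF o]] by (simp add: uminus_spdo.rep_eq)
    have "adj (cbrt_L :: 'a spdo) ^ 3 = - L"
      using adj_power_even[of "cbrt_L :: 'a spdo" 3] by (simp add: cbrt_L(1) adj_L)
    moreover have "(- adj (cbrt_L :: 'a spdo)) ^ 3 = - (adj cbrt_L ^ 3)" by (simp add: power3_eq_cube)
    ultimately show "(- adj (cbrt_L :: 'a spdo)) ^ 3 = cbrt_L ^ 3"
      by (simp add: cbrt_L(1))
  qed (rule cbrt_L(2))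
  then show ?thesis by (metis minus_minus)
qed

lemma adj_cbrt_L_power: "adj (cbrt_L ^ n) = (-1) ^ n * cbrt_L ^ n"
  by (simp add: adj_power_even adj_cbrt_L) (metis mult_minus1 power_minus)

lemma superbinom_eq_0: "0 \<le> i \<Longrightarrow> i < int k \<Longrightarrow> superbinom i k = (0 :: 'a::field_char_0)"
proof -
  assume a: "0 \<le> i" "i < int k"
  show ?thesis
  proof (cases "even i \<and> odd k")
    case False
    obtain j where j: "i = int j" using a(1) by (metis nonneg_int_cases)
    have "j div 2 < k div 2" using a(2) False unfolding j by presburger
    then have "(of_nat (j div 2) gchoose (k div 2)) = (0 :: 'a)"
      by (simp flip: binomial_gbinomial)
    moreover have "of_int (i div 2) = (of_nat (j div 2) :: 'a)"
      unfolding j by (metis of_int_of_nat_eq of_nat_div of_nat_numeral zdiv_int)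
    ultimately show ?thesis by (simp add: superbinom_def)
  qed (simp add: superbinom_def)
qed

text \<open>D^i a is differential for i >= 0, so the nonnegative part of A adds nothing to negative
  powers in the adjoint. The coefficient at D^-1 receives a contribution from D^-1 alone, with sign
  +1; if it vanishes, the next one comes from D^-2 alone, with sign -1.\<close>

lemma adj_residue: "opcoeff (adj A) (-1) = opcoeff A (-1)"
  and adj_coeff_minus_2: "opcoeff A (-1) = 0 \<Longrightarrow> opcoeff (adj A) (-2) = - opcoeff A (-2)"
proof -
  obtain N where N: "order_le N A" by (rule order_le_ex)
  then have N: "order_le (max N 0) A" by (auto intro: order_le_mono)
  have s: "{-2..max N 0} = insert (-2) (insert (-1) {0..max N 0})" "{-1..max N 0} = insert (-1) {0..max N 0}"
    by auto
  have z: "leibniz_coeff i (nat (i - m)) a = 0" if "i \<in> {0..max N 0}" "m < 0" for i m and a :: "'a sdp"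
    using that by (simp add: leibniz_coeff_def superbinom_eq_0)
  have z': "(\<Sum>i=0..max N 0. adj_sign i * leibniz_coeff i (nat (i - m)) (twist i (opcoeff A i))) = 0" if "m < 0" for m
    using z[OF _ that] by (intro sum.neutral) simp
  show "opcoeff (adj A) (-1) = opcoeff A (-1)"
    unfolding opcoeff_adj[OF N] s using z'[of "-1"] by (simp add: leibniz_coeff_0 adj_sign_def twist_def)
  show "opcoeff (adj A) (-2) = - opcoeff A (-2)" if "opcoeff A (-1) = 0"
    unfolding opcoeff_adj[OF N] s using z'[of "-2"] that by (simp add: leibniz_coeff_0 adj_sign_def twist_def)
qed

lemma residue_odd_power:
  assumes "odd n" shows "opcoeff (cbrt_L ^ n) (-1) = (0 :: 'k::field_char_0 sdp)"
proof -
  have "opcoeff (adj (cbrt_L ^ n)) (-1) = - opcoeff (cbrt_L ^ n :: 'k spdo) (-1)"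
    using assms by (simp add: adj_cbrt_L_power uminus_spdo.rep_eq)
  then show ?thesis
    by (metis adj_residue double_eq_0 add.right_inverse)
qed

lemma coeff_minus_2_even_power:
  assumes "even n" "opcoeff (cbrt_L ^ n) (-1) = (0 :: 'k::field_char_0 sdp)"
  shows "opcoeff (cbrt_L ^ n) (-2) = (0 :: 'k::field_char_0 sdp)"
proof -
  have "opcoeff (adj (cbrt_L ^ n)) (-2) = opcoeff (cbrt_L ^ n :: 'k spdo) (-2)"
    using assms by (simp add: adj_cbrt_L_power)
  then show ?thesis
    by (metis adj_coeff_minus_2 assms(2) double_eq_0 add.right_inverse)
qed

section \<open>The flows of the hierarchy\<close>

lemma diff_part_diff: "diff_part (A - B) = diff_part A - diff_part B"
  by (rule spdo_eqI) (simp add: opcoeff_simps)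

lemma diff_part_add: "diff_part (A + B) = diff_part A + diff_part B"
  by (rule spdo_eqI) (simp add: opcoeff_simps)

lemma diff_part_idem [simp]: "diff_part (diff_part A) = diff_part A"
  by (rule spdo_eqI) (simp add: opcoeff_simps)

lemma diff_part_eq_iff: "diff_part A = A \<longleftrightarrow> (\<forall>i<0. opcoeff A i = 0)"
  by (metis diff_part.rep_eq not_le spdo_eqI)

lemma diff_part_fun_op [simp]: "diff_part (fun_op a) = fun_op a"
  by (rule spdo_eqI) (simp add: opcoeff_simps)

lemma diff_part_Lam [simp]: "diff_part Lam = Lam"
  by (rule spdo_eqI) (simp add: opcoeff_simps opcoeff_Lam)

lemma diff_part_1 [simp]: "diff_part 1 = 1"
  by (rule spdo_eqI) (simp add: opcoeff_simps)

lemma diff_part_mult: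
  assumes "diff_part A = A" "diff_part B = B" shows "diff_part (A * B) = A * B"
  unfolding diff_part_eq_iff
proof (intro allI impI)
  fix m :: int assume m: "m < 0"
  have "opcoeff A i * leibniz_coeff i (nat (i + j - m)) (opcoeff B j) = 0"
    if "opcoeff A i \<noteq> 0" "opcoeff B j \<noteq> 0" for i j
  proof -
    have "0 \<le> i" "0 \<le> j" using that assms unfolding diff_part_eq_iff by (meson not_le)+
    then show ?thesis using m by (simp add: leibniz_coeff_def superbinom_eq_0)
  qed
  then show "opcoeff (A * B) m = 0"
    unfolding times_spdo.rep_eq by (intro sum.neutral) auto
qed

lemma opcoeff_Lam_mult: "opcoeff (Lam * X) m = grading (opcoeff X (m - 3)) + D (opcoeff X (m - 2))
    + dx (grading (opcoeff X (m - 1))) + D (dx (opcoeff X m)) + phi * opcoeff X m"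
proof -
  have 2: "opcoeff (D_op 1 * (D_op 1 * Y)) m = dx (opcoeff Y m) + opcoeff Y (m - 2)" for Y :: "'a spdo" and m
    by (simp add: opcoeff_D_mult dx_def)
  have "Lam * X = D_op 1 * (D_op 1 * (D_op 1 * X)) + fun_op phi * X"
    by (simp add: Lam_def D_op_3 distrib_right mult.assoc)
  then show ?thesis
    by (simp only: plus_spdo.rep_eq 2 opcoeff_D_mult opcoeff_fun_mult) (simp add: dx_def)
qed

lemma opcoeff_mult_fun:
  assumes "order_le N X"
  shows "opcoeff (X * fun_op b) m = (\<Sum>i=m..N. opcoeff X i * leibniz_coeff i (nat (i - m)) b)"
  unfolding fun_op_monom opcoeff_mult_monom[OF assms] by simp

lemma opcoeff_mult_Lam: "opcoeff (X * Lam) m = opcoeff X (m - 3) + opcoeff (X * fun_op phi) m"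
  by (simp add: Lam_def distrib_left plus_spdo.rep_eq opcoeff_mult_D)

lemma parity_coeff:
  assumes "parity A = A"
  shows "grading (opcoeff A i) = (if even i then opcoeff A i else - opcoeff A i)"
proof -
  have "opcoeff A i = (if even i then grading (opcoeff A i) else - grading (opcoeff A i))"
    using fun_cong[OF parity.rep_eq[of A], of i] by (simp only: assms)
  then show ?thesis by (metis minus_minus)
qed

lemma odd_parity_coeff:
  assumes "parity A = - A"
  shows "grading (opcoeff A i) = (if even i then - opcoeff A i else opcoeff A i)"
proof -
  have "- opcoeff A i = (if even i then grading (opcoeff A i) else - grading (opcoeff A i))"
    using fun_cong[OF parity.rep_eq[of A], of i] by (simp only: assms uminus_spdo.rep_eq)
  then show ?thesis by (auto split: if_splits)
qed

text \<open>Since A commutes with \<open>Lam\<close>, the commutator of its differential part is, up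
  to sign, that of its complement, whose order is at most -2 by the vanishing residue.\<close>

lemma commutator_Lam_order_0:
  assumes "Lam * A = A * Lam" "parity A = (A :: 'k::field_char_0 spdo)" "opcoeff A (-1) = 0"
  defines "C \<equiv> diff_part A * Lam - Lam * diff_part A"
  shows "C = fun_op (opcoeff C 0)" "grading (opcoeff C 0) = - opcoeff C 0"
proof -
  define M where "M = A - diff_part A"
  have CM: "C = Lam * M - M * Lam"
    unfolding C_def M_def by (simp add: algebra_simps assms(1))
  have M2: "order_le (-2) M"
    unfolding order_le_def
  proof (intro allI impI)
    fix i :: int assume "-2 < i"
    then have "i = -1 \<or> 0 \<le> i" by auto
    then show "opcoeff M i = 0" using assms(3) by (auto simp: M_def opcoeff_minus diff_part.rep_eq)
  qed
  have pM: "parity M = M" by (simp add: M_def parity_diff_part assms(2))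
  have C1: "order_le 1 C"
    using order_le_diff[OF order_le_mult[OF order_le_Lam M2] order_le_mono[OF order_le_mult[OF M2 order_le_Lam]]] CM by simp
  \<comment> \<open>The order is a priori 1. The coefficient of M at D^-2 is even, so it passes D^3
    without sign and the two leading terms cancel.\<close>
  have "opcoeff C 1 = 0"
    using opcoeff_mult_top[OF order_le_Lam M2] opcoeff_mult_top[OF M2 order_le_Lam] parity_coeff[OF pM, of "-2"]
    by (simp add: CM opcoeff_minus opcoeff_Lam)
  moreover have "diff_part C = C"
    unfolding C_def by (simp add: diff_part_diff diff_part_mult)
  ultimately have C0: "opcoeff C i = (if i = 0 then opcoeff C 0 else 0)" for i
    using order_leD[OF C1, of i] unfolding diff_part_eq_iff
    by (cases "i < 0"; cases "i = 0"; cases "i = 1") auto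
  show "C = fun_op (opcoeff C 0)"
    by (rule spdo_eqI) (subst C0, simp add: fun_op.rep_eq)
  have "parity C = - C" by (simp add: CM parity_Lam pM)
  then show "grading (opcoeff C 0) = - opcoeff C 0" by (simp add: odd_parity_coeff)
qed

lemma evol_simps: "evol f (gen k) = (D ^^ k) f" "evol f 1 = 0" "evol f (- x) = - evol f x"
  by (simp_all add: evol_def superder_1 superder_minus)

text \<open>The product rule for L = Lam^2 when \<open>Lam\<close> evolves by the odd function f;
  the terms f phi + phi f cancel by oddness.\<close>

lemma evol_op_L:
  assumes "grading f = - f"
  shows "evol_op f L = fun_op f * Lam + Lam * fun_op f"
proof -
  have z: "f * phi + phi * f = 0"
    using odd_commute[OF assms, of phi] by simp
  have "fun_op f * Lam + Lam * fun_op f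
      = fun_op (D f) * D_op 2 - fun_op (dx f) * D_op 1 + fun_op (D (dx f)) + fun_op (f * phi + phi * f)"
    by (simp add: Lam_def distrib_left distrib_right D_op_3_fun_op assms fun_op_minus fun_op_add dx_def flip: fun_op_mult)
  moreover have "evol_op f L = fun_op (D f) * D_op 2 - fun_op (dx f) * D_op 1 + fun_op (D (dx f)) + fun_op 0"
    by (rule spdo_eqI) (auto simp: opcoeff_simps opcoeff_L opcoeff_mult_D evol_simps dx_def numeral_2_eq_2 numeral_3_eq_3)
  ultimately show ?thesis by (simp only: z)
qed

text \<open>L has the coefficient D phi at D^2, so its evolution determines D f, and an odd f is
  determined by D f.\<close>

lemma evol_op_L_inject:
  assumes "grading f = - f" "grading g = - g" "evol_op f L = evol_op g L" shows "f = g"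
proof -
  have "opcoeff (evol_op f L) 2 = opcoeff (evol_op g L) 2" using assms(3) by simp
  then have "D f = D g" by (simp add: evol_op.rep_eq opcoeff_L evol_simps)
  then show ?thesis using assms D_odd_eq_0[of "f - g"] by simp
qed

text \<open>L is not odd, as its leading coefficient 1 stands at an even power. The supercommutator
  with L is thus the plain commutator for every A.\<close>

lemma supercomm_L: "supercomm A L = A * L - L * A"
proof -
  have "\<not> odd_op (L :: 'a spdo)"
  proof
    assume "odd_op (L :: 'a spdo)"
    then have "odd_elem (opcoeff (L :: 'a spdo) 6)" unfolding odd_op_def by (metis even_numeral)
    then have "grading (1 :: 'a sdp) = - 1" by (simp add: opcoeff_L odd_elem_iff)
    then show False using double_eq_0[of "1 :: 'a sdp"] by (metis grading_1 add.right_inverse one_neq_zero)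
  qed
  then show ?thesis by (simp add: supercomm_def)
qed

lemma commutator_L:
  assumes "B * Lam - Lam * B = fun_op f" shows "B * L - L * B = fun_op f * Lam + Lam * fun_op f"
  unfolding L_Lam assms[symmetric] by (simp add: algebra_simps)

lemma flow_of_commutator:
  assumes "diff_part (cbrt_L ^ n) * Lam - Lam * diff_part (cbrt_L ^ n) = fun_op f" "grading f = - f"
  shows "flow n f"
  unfolding flow_def odd_elem_iff supercomm_L using assms commutator_L[OF assms(1)] evol_op_L by metis

lemma flow_unique: "flow n f \<Longrightarrow> flow n g \<Longrightarrow> f = g"
  unfolding flow_def odd_elem_iff by (metis evol_op_L_inject)

text \<open>The assumption is the vanishing residue instead of odd n, because for even n the residue
  is shown to vanish under the assumption that a flow exists.\<close>

lemma flow_exists: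
  assumes "opcoeff (cbrt_L ^ n) (-1) = (0 :: 'k sdp)"
  obtains f :: "'k::field_char_0 sdp" where "flow n f"
    "diff_part (cbrt_L ^ n) * Lam - Lam * diff_part (cbrt_L ^ n) = fun_op f" "grading f = - f"
  using commutator_Lam_order_0[OF Lam_cbrt_L_power, of n] assms flow_of_commutator[of n]
  by (metis parity_power parity_cbrt_L)

lemma flow_commutator:
  assumes "odd n" "flow n (f :: 'k::field_char_0 sdp)"
  shows "diff_part (cbrt_L ^ n) * Lam - Lam * diff_part (cbrt_L ^ n) = fun_op f"
  by (metis flow_exists flow_unique residue_odd_power assms)

text \<open>At this order only the commutator of the third power of the x-derivative with the D^-1
  term of M survives, giving three times the x-derivative; the other terms of L have order at most
  2.\<close>

lemma opcoeff_mult_L_minus: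
  fixes M :: "'k::field_char_0 spdo"
  assumes "order_le (-1) M" "parity M = M"
  shows "opcoeff (L * M - M * L) 3 = 3 * dx (opcoeff M (-1))"
proof -
  have z: "opcoeff M i = 0" if "0 \<le> i" for i using that by (intro order_leD[OF assms(1)]) simp
  note p = parity_coeff[OF assms(2)]
  define K where "K = L - (D_op 6 :: 'k spdo)"
  have "order_le 2 K" by (auto simp: K_def order_le_def opcoeff_simps opcoeff_L)
  then have "opcoeff (M * K) 3 = 0"
    by (intro order_leD[OF order_le_mult[OF assms(1)]]) auto
  moreover have "M * L = M * D_op 6 + M * K" by (simp add: K_def flip: distrib_left)
  ultimately have 1: "opcoeff (M * L) 3 = opcoeff M (-3)"
    by (simp add: plus_spdo.rep_eq opcoeff_mult_D)
  have "opcoeff (L * M) 3 = opcoeff M (-3) + 3 * dx (opcoeff M (-1))"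
  proof -
    have "3 * x = x + x + x" for x :: "'k sdp"
    proof -
      have "(3 :: 'k sdp) = 1 + 1 + 1" by simp
      then show ?thesis by (simp only: distrib_right mult_1)
    qed
    then show ?thesis
      by (simp add: L_Lam mult.assoc opcoeff_Lam_mult z p dx_def)
  qed
  then show ?thesis by (simp add: opcoeff_minus 1)
qed

text \<open>L has no D^3 term, so the coefficient at D^-1 has vanishing x-derivative and, being odd,
  is zero. The adjoint then removes the one at D^-2, after which the commutator with
  \<open>Lam\<close> describes the flow.\<close>

lemma flow_even:
  assumes "even n" "flow n f" shows "(f :: 'k::field_char_0 sdp) = 0"
proof -
  define A where "A = (cbrt_L ^ n :: 'k spdo)"
  define M where "M = A - diff_part A"
  have AL: "A * Lam = Lam * A" by (simp add: A_def Lam_cbrt_L_power)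
  then have "A * L = L * A" by (metis L_Lam mult.assoc)
  then have c: "supercomm (diff_part A) L = L * M - M * L"
    by (simp add: supercomm_L M_def algebra_simps)
  have pM: "parity M = M" by (simp add: M_def parity_diff_part A_def)
  have M1: "order_le (-1) M" by (simp add: order_le_def M_def opcoeff_minus diff_part.rep_eq)
  have "opcoeff (evol_op f L) 3 = 3 * dx (opcoeff M (-1))"
    using assms(2) opcoeff_mult_L_minus[OF M1 pM] unfolding flow_def A_def[symmetric] c by simp
  then have "3 * dx (opcoeff M (-1)) = 3 * 0" by (simp add: evol_op.rep_eq opcoeff_L)
  then have "D (D (opcoeff M (-1))) = 0" by (simp only: numeral_mult_cancel dx_def)
  then have "D (opcoeff M (-1)) = 0" by (rule D_eq_0) simp
  then have "opcoeff M (-1) = 0"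
    by (rule D_odd_eq_0) (simp add: parity_coeff[OF pM])
  then have a1: "opcoeff A (-1) = 0" by (simp add: M_def opcoeff_minus diff_part.rep_eq)
  then have a2: "opcoeff A (-2) = 0" using coeff_minus_2_even_power[OF assms(1)] by (simp add: A_def)
  obtain f' :: "'k sdp" where f': "flow n f'" "diff_part A * Lam - Lam * diff_part A = fun_op f'" "grading f' = - f'"
    using flow_exists[of n] a1 unfolding A_def by blast
  have "f = f'" using assms(2) f'(1) by (rule flow_unique)
  have M3: "order_le (-3) M"
    unfolding order_le_def
  proof (intro allI impI)
    fix i :: int assume "-3 < i"
    then have "i = -2 \<or> i = -1 \<or> 0 \<le> i" by auto
    then show "opcoeff M i = 0" using a1 a2 by (auto simp: M_def opcoeff_minus diff_part.rep_eq)
  qed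
  have C: "fun_op f = Lam * M - M * Lam"
    unfolding \<open>f = f'\<close> f'(2)[symmetric] by (simp add: M_def algebra_simps AL)
  have z: "opcoeff M i = 0" if "-2 \<le> i" for i using that by (intro order_leD[OF M3]) simp
  have p3: "grading (opcoeff M (-3)) = - opcoeff M (-3)" by (simp add: parity_coeff[OF pM])
  have fm: "opcoeff (M * fun_op phi) m = 0" if "-3 < m" for m
    using order_leD[OF order_le_mult[OF M3 order_le_fun]] that by simp
  have m1: "opcoeff (Lam * M - M * Lam) (-1) = 0" "opcoeff (Lam * M - M * Lam) 0 = f"
    unfolding C[symmetric] by (simp_all add: fun_op.rep_eq)
  \<comment> \<open>The coefficient at D^0 expresses f by the odd coefficient of M at D^-3; the one
    at D^-1 says that D annihilates it, so it is zero.\<close>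
  have "f = - opcoeff M (-3) - opcoeff M (-3)"
    using m1(2) by (simp add: opcoeff_minus opcoeff_Lam_mult opcoeff_mult_Lam fm z p3 dx_def)
  moreover have "D (opcoeff M (-3)) = 0"
    using m1(1) parity_coeff[OF pM, of "-4"] by (simp add: opcoeff_minus opcoeff_Lam_mult opcoeff_mult_Lam fm z p3 dx_def)
  ultimately show "f = 0" using D_odd_eq_0[of "opcoeff M (-3)"] p3 by simp
qed

lemma flow_dvd_3:
  assumes "3 dvd n" "flow n f" shows "(f :: 'k::field_char_0 sdp) = 0"
proof -
  obtain k where "n = 3 * k" using assms(1) by auto
  then have Q: "cbrt_L ^ n = (L :: 'k spdo) ^ k" by (simp add: power_mult cbrt_L)
  have dL: "diff_part L = (L :: 'k spdo)" by (simp add: L_Lam diff_part_mult)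
  have "diff_part (L ^ k) = (L :: 'k spdo) ^ k"
    by (induction k) (simp_all add: diff_part_mult dL)
  then have "evol_op f L = 0"
    using assms(2) unfolding flow_def Q supercomm_L by (simp add: power_commutes)
  moreover have "fun_op 0 = (0 :: 'k spdo)" by (rule spdo_eqI) (simp add: opcoeff_simps)
  then have "evol_op 0 L = (0 :: 'k spdo)" using evol_op_L[of "0 :: 'k sdp"] by simp
  ultimately have "evol_op f L = evol_op 0 L" by simp
  then show ?thesis
    using evol_op_L_inject[of f 0] assms(2) by (simp add: flow_def odd_elem_iff)
qed

lemma flow_nontrivial: "flow n f \<Longrightarrow> f \<noteq> 0 \<Longrightarrow> odd n \<and> \<not> 3 dvd n"
  using flow_even flow_dvd_3 by blast

lemma flow_ex1: "odd n \<Longrightarrow> \<exists>!f :: 'k::field_char_0 sdp. flow n f"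
  by (metis flow_exists flow_unique residue_odd_power)

text \<open>\<open>L\<^sup>2 B\<^sub>n\<close> is differential, so \<open>B\<^sub>n\<^sub>+\<^sub>6 = L\<^sup>2 B\<^sub>n + R\<^sub>n\<close> with \<open>R\<^sub>n = (L\<^sup>2 (L\<^bsup>n/3\<^esup>)\<^sub>-)\<^sub>+\<close>.\<close>

lemma
  fixes f g :: "'k::field_char_0 sdp"
  assumes "odd n" "flow n f" "flow (n + 6) g"
  defines "M \<equiv> cbrt_L ^ n - diff_part (cbrt_L ^ n)"
  defines "R \<equiv> diff_part (L * (L * M))"
  shows flow_plus_6_minus: "M * Lam - Lam * M = - fun_op f"
    and flow_plus_6: "fun_op g = L * (L * fun_op f) + (R * Lam - Lam * R)"
proof -
  define B where "B = (diff_part (cbrt_L ^ n) :: 'k spdo)"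
  have B: "B * Lam - Lam * B = fun_op f" unfolding B_def by (rule flow_commutator[OF assms(1,2)])
  then show "M * Lam - Lam * M = - fun_op f"
    unfolding M_def B_def[symmetric] by (simp add: algebra_simps Lam_cbrt_L_power)
  have dL: "diff_part L = (L :: 'k spdo)" by (simp add: L_Lam diff_part_mult)
  have "cbrt_L ^ 6 = (L * L :: 'k spdo)"
    using power_mult[of "cbrt_L :: 'k spdo" 3 2] by (simp add: cbrt_L power2_eq_square)
  then have "cbrt_L ^ (n + 6) = (L * (L * cbrt_L ^ n) :: 'k spdo)"
    by (simp only: add.commute[of n] power_add mult.assoc)
  also have "\<dots> = L * (L * B) + L * (L * M)" by (simp add: M_def B_def flip: distrib_left)
  finally have "diff_part (cbrt_L ^ (n + 6)) = L * (L * B) + R"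
    by (simp add: diff_part_add R_def diff_part_mult dL B_def)
  then have "fun_op g = (L * (L * B) + R) * Lam - Lam * (L * (L * B) + R)"
    using flow_commutator[OF _ assms(3)] assms(1) by simp
  \<comment> \<open>L commutes with \<open>Lam\<close>, so it can be pulled out of the
    commutator.\<close>
  also have "\<dots> = L * (L * (B * Lam - Lam * B)) + (R * Lam - Lam * R)"
    by (simp add: L_Lam algebra_simps)
  finally show "fun_op g = L * (L * fun_op f) + (R * Lam - Lam * R)" unfolding B .
qed

text \<open>M is the inverse root of L, written as Lam^-2 Q^2 with Q the cube root. Then Q^5 = L^2
  M, which is the step from n = -1 to n = 5: M commutes with \<open>Lam\<close>, and its leading
  coefficient is the constant 1.\<close>

lemma flow_5_from_inverse_root:
  fixes f :: "'k::field_char_0 sdp"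
  assumes "flow 5 f"
  obtains M :: "'k spdo" where "order_le (-2) M" "opcoeff M (-2) = 1" "parity M = M"
    "\<And>i. i < -2 \<Longrightarrow> mcoeff (opcoeff M i) {#} = 0" "M * Lam = Lam * M"
    "fun_op f = diff_part (L * (L * M)) * Lam - Lam * diff_part (L * (L * M))"
proof -
  let ?Q = "cbrt_L :: 'k spdo"
  obtain K where K: "K * Lam = (1 :: 'k spdo)" "Lam * K = 1" "order_le (-3) K" "opcoeff K (-3) = 1"
    by (rule inverse_Lam)
  define M where "M = K * (K * ?Q ^ 2)"
  have Q: "order_le 2 ?Q" "opcoeff ?Q 2 = 1" using cbrt_L(2) root_like_order root_like_iff by blast+
  have K': "K * (Lam * X) = X" "Lam * (K * X) = X" for X by (simp_all flip: mult.assoc add: K)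
  have comm: "X * Lam = Lam * X \<Longrightarrow> K * X * Lam = Lam * (K * X)" for X
    by (simp add: mult.assoc K')
  have comM: "M * Lam = Lam * M"
    unfolding M_def using comm[OF comm[of "?Q ^ 2"]] Lam_cbrt_L_power[of 2] by metis
  have Q2: "order_le 4 (?Q ^ 2)" "opcoeff (?Q ^ 2) 4 = 1"
    using order_le_mult[OF Q(1) Q(1)] opcoeff_mult_top[OF Q(1) Q(1)] by (simp_all add: power2_eq_square Q(2))
  note o = order_le_mult[OF K(3) Q2(1)]
  have M2: "order_le (-2) M" "opcoeff M (-2) = 1"
    using order_le_mult[OF K(3) o] opcoeff_mult_top[OF K(3) o] opcoeff_mult_top[OF K(3) Q2(1)]
    by (simp_all add: M_def K Q2)
  have "parity (K * Lam) = 1" by (simp add: K(1) del: parity_mult)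
  then have "- (parity K * Lam) = 1" by (simp add: parity_Lam)
  then have "parity K * Lam * K = - K" by (metis minus_minus mult_minus1)
  then have pK: "parity K = - K" by (simp add: K(2) mult.assoc)
  have pM: "parity M = M" by (simp add: M_def pK)
  have "const_part (K * Lam) = 1" using const_part_D_op[of 0] by (simp add: K(1) D_op_0)
  then have "const_part K * D_op 3 = 1" by (simp add: const_part_mult)
  then have "const_part K * D_op 3 * D_op (-3) = D_op (-3)" by simp
  then have cK: "const_part K = D_op (-3)" by (simp add: mult.assoc D_op_mult_D_op D_op_0)
  have cM: "const_part M = D_op (-2)"
    by (simp add: M_def const_part_mult cK const_part_power const_part_cbrt_L D_op_power D_op_mult_D_op)
  have e: "mcoeff (opcoeff M i) {#} = 0" if "i < -2" for i
  proof -
    have "const (mcoeff (opcoeff M i) {#}) = (0 :: 'k sdp)"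
      using arg_cong[OF cM, of "\<lambda>X. opcoeff X i"] that by (simp add: const_part.rep_eq D_op.rep_eq)
    then have "mcoeff (const (mcoeff (opcoeff M i) {#}) :: 'k sdp) {#} = 0" by (simp add: mcoeff_simps)
    then show ?thesis by (simp add: const.rep_eq)
  qed
  have "?Q ^ 5 = ?Q ^ 3 * ?Q ^ 2" by (simp flip: power_add)
  also have "\<dots> = L * (L * M)" by (simp add: cbrt_L M_def L_Lam mult.assoc K')
  finally have "fun_op f = diff_part (L * (L * M)) * Lam - Lam * diff_part (L * (L * M))"
    using flow_commutator[OF _ assms] by simp
  then show thesis using that M2 pM e comM by blast
qed

section \<open>Normal forms of superdifferential polynomials\<close>

text \<open>Letters stand for \<open>D\<^sup>k \<phi>\<close>, for \<open>D\<^sup>k h\<close> with an even \<open>h\<close>, and for two even potentials \<open>p\<close>, \<open>q\<close>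
  and their first \<open>D\<close>-derivatives; \<open>\<partial>\<^sub>x p\<close> and \<open>\<partial>\<^sub>x q\<close> are polynomials in the other letters.\<close>

datatype letter = Phi nat | H nat | P | DP | Q | DQ

primrec fermionic :: "letter \<Rightarrow> bool" where
  "fermionic (Phi k) = even k"
| "fermionic (H k) = odd k"
| "fermionic P = False"
| "fermionic DP = True"
| "fermionic Q = False"
| "fermionic DQ = True"

primrec kind :: "letter \<Rightarrow> nat" where
  "kind (Phi k) = 0" | "kind (H k) = 1" | "kind P = 2" | "kind DP = 3" | "kind Q = 4" | "kind DQ = 5"

primrec idx :: "letter \<Rightarrow> nat" where
  "idx (Phi k) = k" | "idx (H k) = k" | "idx P = 0" | "idx DP = 0" | "idx Q = 0" | "idx DQ = 0"

definition letter_less :: "letter \<Rightarrow> letter \<Rightarrow> bool" where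
  "letter_less x y \<longleftrightarrow> kind x < kind y \<or> kind x = kind y \<and> idx x < idx y"

text \<open>Sums of integer multiples of words. Sorting the letters and merging equal words lets
  both sides of an identity compute to the same list; the meaning of a list is given by
  \<open>p_eval\<close>.\<close>

type_synonym poly = "(int \<times> letter list) list"

fun word_less :: "letter list \<Rightarrow> letter list \<Rightarrow> bool" where
  "word_less _ [] = False"
| "word_less [] (y # ys) = True"
| "word_less (x # xs) (y # ys) = (if x = y then word_less xs ys else letter_less x y)"

fun p_addm :: "int \<Rightarrow> letter list \<Rightarrow> poly \<Rightarrow> poly" where
  "p_addm c w [] = (if c = 0 then [] else [(c, w)])"
| "p_addm c w ((d, u) # p) = (if w = u then (if c + d = 0 then p else (c + d, u) # p)
     else if word_less w u then (if c = 0 then (d, u) # p else (c, w) # (d, u) # p)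
     else (d, u) # p_addm c w p)"

fun p_add :: "poly \<Rightarrow> poly \<Rightarrow> poly" where
  "p_add [] q = q"
| "p_add ((c, w) # p) q = p_add p (p_addm c w q)"

fun p_smul :: "int \<Rightarrow> poly \<Rightarrow> poly" where
  "p_smul k [] = []"
| "p_smul k ((c, w) # p) = (k * c, w) # p_smul k p"

text \<open>A vanishing product is returned with coefficient 0; \<open>p_addm\<close> drops it later.\<close>

fun m_ins :: "letter \<Rightarrow> int \<Rightarrow> letter list \<Rightarrow> int \<times> letter list" where
  "m_ins x c [] = (c, [x])"
| "m_ins x c (y # ys) = (if x = y then (if fermionic x then (0, []) else (c, x # y # ys))
     else if letter_less x y then (c, x # y # ys)
     else apsnd ((#) y) (m_ins x (if fermionic x \<and> fermionic y then - c else c) ys))"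

fun m_mul :: "letter list \<Rightarrow> int \<Rightarrow> letter list \<Rightarrow> int \<times> letter list" where
  "m_mul [] c w = (c, w)"
| "m_mul (x # xs) c w = (case m_mul xs c w of (d, u) \<Rightarrow> m_ins x d u)"

fun p_mulm :: "int \<Rightarrow> letter list \<Rightarrow> poly \<Rightarrow> poly \<Rightarrow> poly" where
  "p_mulm c w [] acc = acc"
| "p_mulm c w ((d, u) # q) acc = (case m_mul w (c * d) u of (e, t) \<Rightarrow> p_mulm c w q (p_addm e t acc))"

fun p_mul :: "poly \<Rightarrow> poly \<Rightarrow> poly" where
  "p_mul [] q = []"
| "p_mul ((c, w) # p) q = p_mulm c w q (p_mul p q)"

fun m_odd :: "letter list \<Rightarrow> bool" where
  "m_odd [] = False"
| "m_odd (x # xs) = (fermionic x \<noteq> m_odd xs)"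

fun p_sig :: "poly \<Rightarrow> poly" where
  "p_sig [] = []"
| "p_sig ((c, w) # p) = (if m_odd w then - c else c, w) # p_sig p"

primrec l_der :: "poly \<Rightarrow> poly \<Rightarrow> letter \<Rightarrow> poly" where
  "l_der dp dq (Phi k) = [(1, [Phi (Suc k)])]"
| "l_der dp dq (H k) = [(1, [H (Suc k)])]"
| "l_der dp dq P = [(1, [DP])]"
| "l_der dp dq DP = dp"
| "l_der dp dq Q = [(1, [DQ])]"
| "l_der dp dq DQ = dq"

fun m_der :: "poly \<Rightarrow> poly \<Rightarrow> letter list \<Rightarrow> poly" where
  "m_der dp dq [] = []"
| "m_der dp dq (x # w) = p_add (p_mul (l_der dp dq x) [(1, w)])
     (p_mul [(if fermionic x then -1 else 1, [x])] (m_der dp dq w))"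

fun p_der :: "poly \<Rightarrow> poly \<Rightarrow> poly \<Rightarrow> poly" where
  "p_der dp dq [] = []"
| "p_der dp dq ((c, w) # p) = p_add (p_smul c (m_der dp dq w)) (p_der dp dq p)"

fun p_eval :: "(letter \<Rightarrow> 'k::field_char_0 sdp) \<Rightarrow> poly \<Rightarrow> 'k sdp" where
  "p_eval v [] = 0"
| "p_eval v ((c, w) # p) = of_int c * prod_list (map v w) + p_eval v p"

lemma of_int_left_commute: "x * (of_int c * y) = of_int c * (x * (y :: 'a::ring_1))"
  by (metis mult.assoc mult_of_int_commute)

text \<open>\<open>dp\<close> and \<open>dq\<close> are the lists for D applied to the letters
  \<open>DP\<close> and \<open>DQ\<close>, that is, for the x-derivatives of p and q. Keeping them
  as parameters allows the calculus to be used before these potentials are known.\<close>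

locale letter_values =
  fixes v :: "letter \<Rightarrow> 'k::field_char_0 sdp" and dp dq :: poly
  assumes grading_v: "grading (v x) = (if fermionic x then - v x else v x)"
    and D_v: "D (v x) = p_eval v (l_der dp dq x)"
begin

abbreviation "I \<equiv> p_eval v"
abbreviation "mv w \<equiv> prod_list (map v w)"

lemma I_addm: "I (p_addm c w p) = of_int c * mv w + I p"
proof (induction p)
  case (Cons m p)
  have "c + d = 0 \<Longrightarrow> of_int c * x + (of_int d * x + y) = y" for d and x y :: "'k sdp"
    by (metis add.assoc add_0 distrib_right mult_zero_left of_int_0 of_int_add)
  then show ?case using Cons by (cases m) (simp add: algebra_simps)
qed simp

lemma I_add: "I (p_add p q) = I p + I q"
  by (induction p q rule: p_add.induct) (simp_all add: I_addm algebra_simps)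

lemma I_smul: "I (p_smul k p) = of_int k * I p"
  by (induction k p rule: p_smul.induct) (simp_all add: algebra_simps)

lemma v_commute: "v x * v y = (if fermionic x \<and> fermionic y then - (v y * v x) else v y * v x)"
  using even_commute[of "v x" "v y"] even_commute[of "v y" "v x"] odd_commute[of "v y" "v x"]
  by (auto simp: grading_v split: if_splits)

lemma m_ins: "m_ins x c w = (d, u) \<Longrightarrow> of_int d * mv u = of_int c * (v x * mv w)"
proof (induction x c w arbitrary: d u rule: m_ins.induct)
  case (2 x c y ys)
  show ?case
  proof (cases "x = y \<or> letter_less x y")
    case True
    have "v x * (v x * z) = 0" if "fermionic x" for z
      using that odd_square_0[of "v x"] by (simp add: grading_v flip: mult.assoc)
    then show ?thesis
      using 2(2) True by (auto split: if_splits)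
  next
    case False
    obtain u' where u: "u = y # u'" "m_ins x (if fermionic x \<and> fermionic y then - c else c) ys = (d, u')"
      using 2(2) False by (cases "m_ins x (if fermionic x \<and> fermionic y then - c else c) ys") auto
    have "of_int d * mv u' = of_int (if fermionic x \<and> fermionic y then - c else c) * (v x * mv ys)"
      using 2(1)[OF _ _ u(2)] False by blast
    moreover have "v x * (v y * z) = (if fermionic x \<and> fermionic y then - (v y * (v x * z)) else v y * (v x * z))" for z
      by (simp flip: mult.assoc add: v_commute[of x y])
    moreover have "of_int d * mv u = v y * (of_int d * mv u')"
      by (simp add: u of_int_left_commute)
    ultimately show ?thesis by (simp add: of_int_left_commute)
  qed
qed simp

lemma m_mul: "m_mul w c u = (d, t) \<Longrightarrow> of_int d * mv t = of_int c * (mv w * mv u)"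
proof (induction w arbitrary: d t)
  case (Cons x xs)
  obtain e s where s: "m_mul xs c u = (e, s)" by (cases "m_mul xs c u")
  then have "m_ins x e s = (d, t)" using Cons(2) by simp
  from m_ins[OF this] Cons(1)[OF s] have "of_int d * mv t = v x * (of_int c * (mv xs * mv u))"
    by (metis of_int_left_commute)
  then show ?case by (simp add: of_int_left_commute mult.assoc)
qed simp

lemma I_mulm: "I (p_mulm c w q acc) = of_int c * (mv w * I q) + I acc"
proof (induction q arbitrary: acc)
  case (Cons m q)
  obtain d u where m: "m = (d, u)" by (cases m)
  obtain e t where t: "m_mul w (c * d) u = (e, t)" by (cases "m_mul w (c * d) u")
  have "mv w * (of_int d * x) = of_int d * (mv w * x)" for x by (rule of_int_left_commute)
  then show ?case using Cons m_mul[OF t] by (simp add: m t I_addm algebra_simps)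
qed simp

lemma I_mul: "I (p_mul p q) = I p * I q"
  by (induction p q rule: p_mul.induct) (simp_all add: I_mulm algebra_simps)

lemma grading_mv: "grading (mv w) = (if m_odd w then - mv w else mv w)"
  by (induction w) (auto simp: grading_v)

lemma I_sig: "I (p_sig p) = grading (I p)"
  by (induction p rule: p_sig.induct) (simp_all add: grading_mv)

lemma I_mder: "I (m_der dp dq w) = D (mv w)"
  by (induction w) (simp_all add: I_add I_mul I_mulm D_mult D_v grading_v)

lemma I_der: "I (p_der dp dq p) = D (I p)"
  by (induction p) (auto simp: I_add I_smul I_mder D_mult)

text \<open>Oriented so that rewriting collapses an algebraic expression into one evaluated list
  expression; an identity then becomes an equation between lists that \<open>code_simp\<close>
  computes.\<close>

lemma I_eqs:
  "I p + I q = I (p_add p q)" "I p - I q = I (p_add p (p_smul (-1) q))" "- I p = I (p_smul (-1) p)"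
  "I p * I q = I (p_mul p q)" "numeral n * I p = I (p_smul (numeral n) p)"
  "of_int k * I p = I (p_smul k p)"
  "grading (I p) = I (p_sig p)" "D (I p) = I (p_der dp dq p)"
  "dx (I p) = I (p_der dp dq (p_der dp dq p))"
  by (simp_all add: I_add I_smul I_mul I_sig I_der dx_def)

end

section \<open>Operators commuting with the Lax operator up to a function\<close>

lemma numeral_mult_ex: "\<exists>x. numeral n * x = (y :: 'k::field_char_0 sdp)"
  by (rule exI[of _ "const (1 / numeral n) * y"]) (simp add: const_mult_const flip: const_numeral)

text \<open>The integer form of the Leibniz coefficients for a negative exponent -k applied to phi:
  (-j choose t) = (-1)^t (j+t-1 choose t) with j = (k+1) div 2 and t = l div 2, and a sign from the
  oddness of phi.\<close>

definition phi_coeff :: "nat \<Rightarrow> nat \<Rightarrow> int" where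
  "phi_coeff k l = (if even k \<and> odd l then 0 else (if even (k + l) then 1 else -1) *
     (-1) ^ (l div 2) * int (((k + 1) div 2 + l div 2 - 1) choose (l div 2)))"

lemma leibniz_coeff_phi:
  assumes "0 < k"
  shows "leibniz_coeff (- int k) l phi = of_int (phi_coeff k l) * (gen l :: 'k::field_char_0 sdp)"
proof -
  define j t where "j = (k + 1) div 2" and "t = l div 2"
  have j: "0 < j" using assms by (simp add: j_def)
  have "(- int k) div 2 = - int j" unfolding j_def by presburger
  moreover have "((- of_nat j :: 'k) gchoose t) = (-1) ^ t * of_nat ((j + t - 1) choose t)"
    using j by (simp add: gbinomial_minus binomial_gbinomial of_nat_diff)
  ultimately have "(superbinom (- int k) l :: 'k) =
      (if even k \<and> odd l then 0 else (-1) ^ t * of_nat ((j + t - 1) choose t))"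
    by (simp add: superbinom_def t_def)
  moreover have "(D ^^ l) (gen 0) = (gen l :: 'k sdp)" by (induction l) auto
  ultimately show ?thesis
    by (auto simp: leibniz_coeff_def phi_coeff_def j_def t_def D_power_minus grading_gen const_minus
        simp flip: const_of_int)
qed

text \<open>Abstracts the negative part of a power of the root, so that the same computation also
  serves the inverse root with f = 0. There the coefficient at D^-2 is a nonzero constant, which is
  why constant terms are excluded only below -2.\<close>

locale resolvent =
  fixes M :: "'k::field_char_0 spdo" and f :: "'k sdp"
  assumes order_M: "order_le (-2) M" and parity_M: "parity M = M"
    and eps_M: "\<And>i. i < -2 \<Longrightarrow> mcoeff (opcoeff M i) {#} = 0"
    and comm_M: "M * Lam - Lam * M = - fun_op f" and odd_f: "grading f = - f"
begin

text \<open>The factor 27 makes the coefficients of \<open>D\<^sup>-\<^sup>2, ..., D\<^bsup>-13\<^esup>\<close> integral in \<open>h\<close> and the two further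
  potentials.\<close>

definition a :: "nat \<Rightarrow> 'k sdp" where "a k = 27 * opcoeff M (- int k)"
definition h :: "'k sdp" where "h = 3 * opcoeff M (-2)"
definition S :: "nat \<Rightarrow> 'k sdp" where
  "S m = (\<Sum>k\<leftarrow>[2..<Suc m]. a k * (of_int (phi_coeff k (m - k)) * gen (m - k)))"

lemma grading_a: "grading (a k) = (if even k then a k else - a k)"
  using parity_coeff[OF parity_M, of "- int k"] by (simp add: a_def)

lemma a_0_1: "a 0 = 0" "a 1 = 0"
  using order_leD[OF order_M] by (simp_all add: a_def)

lemma a_2: "a 2 = 9 * h"
proof -
  have "(27 :: 'k sdp) = 9 * 3" by simp
  then show ?thesis by (simp only: a_def h_def mult.assoc) simp
qed

lemma eps_a: "3 \<le> k \<Longrightarrow> mcoeff (a k) {#} = 0"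
  by (simp add: a_def mcoeff_mult_empty eps_M)

lemma grading_h: "grading h = h"
  using parity_coeff[OF parity_M, of "-2"] by (simp add: h_def)

lemma S_eq: "27 * opcoeff (M * fun_op phi) (- int m) = S m"
proof -
  have "opcoeff (M * fun_op phi) (- int m) =
      (\<Sum>i=-int m..-2. opcoeff M i * leibniz_coeff i (nat (i + int m)) phi)"
    using opcoeff_mult_fun[OF order_M, of phi "- int m"] by simp
  also have "\<dots> = (\<Sum>k=2..m. opcoeff M (- int k) * leibniz_coeff (- int k) (m - k) phi)"
  proof (rule sum.reindex_bij_witness[of _ "\<lambda>k. - int k" "\<lambda>i. nat (- i)"])
    fix i assume "i \<in> {- int m..- 2}"
    then have "m - nat (- i) = nat (i + int m)" "- int (nat (- i)) = i" by auto
    then show "opcoeff M (- int (nat (- i))) * leibniz_coeff (- int (nat (- i))) (m - nat (- i)) phi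
        = opcoeff M i * leibniz_coeff i (nat (i + int m)) phi" by simp
  qed auto
  also have "\<dots> = (\<Sum>k=2..m. opcoeff M (- int k) * (of_int (phi_coeff k (m - k)) * gen (m - k)))"
    by (intro sum.cong refl) (simp add: leibniz_coeff_phi)
  finally show ?thesis
    unfolding S_def a_def
    by (simp add: sum_list_distinct_conv_sum_set atLeastLessThanSuc_atLeastAtMost sum_distrib_left mult.assoc del: upt_Suc)
qed

lemma coeff_eq: "a (m + 3) + S m - (grading (a (m + 3)) + D (a (m + 2)) + dx (grading (a (m + 1)))
    + D (dx (a m)) + phi * a m) = (if m = 0 then - (27 * f) else 0)"
proof -
  have idx: "- int m - 3 = - int (m + 3)" "- int m - 2 = - int (m + 2)" "- int m - 1 = - int (m + 1)" by simp_all
  have swap: "phi * (27 * x) = 27 * (phi * x)" for x :: "'k sdp"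
    using const_mult_left_commute[of phi 27 x] by (simp add: const_numeral)
  have D27: "D (27 * x) = 27 * D x" for x :: "'k sdp" by (simp add: D_mult)
  have 1: "27 * opcoeff (M * Lam) (- int m) = a (m + 3) + S m"
    by (simp only: opcoeff_mult_Lam distrib_left S_eq a_def idx)
  have 2: "27 * opcoeff (Lam * M) (- int m) = grading (a (m + 3)) + D (a (m + 2)) + dx (grading (a (m + 1)))
    + D (dx (a m)) + phi * a m"
    by (simp only: opcoeff_Lam_mult idx a_def dx_def distrib_left grading_mult grading_numeral D27 swap)
  have "opcoeff (M * Lam - Lam * M) (- int m) = (if m = 0 then - f else 0)"
    unfolding comm_M by (simp add: opcoeff_simps)
  then have "27 * opcoeff (M * Lam) (- int m) - 27 * opcoeff (Lam * M) (- int m) = 27 * (if m = 0 then - f else 0)"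
    by (simp only: opcoeff_minus flip: right_diff_distrib)
  then show ?thesis unfolding 1 2 by simp
qed

text \<open>For even m the coefficient \<open>a (m + 3)\<close> is odd and occurs twice; for odd m
  it is even and drops out, which leaves a relation between its two predecessors.\<close>

lemma coeff_eq_even:
  "even m \<Longrightarrow> 0 < m \<Longrightarrow> 2 * a (m + 3) - D (a (m + 2)) = D (dx (a m)) + phi * a m - dx (a (m + 1)) - S m"
  using coeff_eq[of m] by (simp add: grading_a dx_def algebra_simps mult_2)

lemma coeff_eq_odd:
  "odd m \<Longrightarrow> D (a (m + 2)) + dx (a (m + 1)) = S m - D (dx (a m)) - phi * a m"
  using coeff_eq[of m] by (cases "m = 0") (simp_all add: grading_a dx_def algebra_simps)

lemma a_3_f: "a 3 + a 3 - D (a 2) = - (27 * f)"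
proof -
  have "grading (a 3) = - a 3" by (simp add: grading_a)
  then show ?thesis
    using coeff_eq[of 0, unfolded add_0 a_0_1] by (simp add: S_def dx_def algebra_simps)
qed

text \<open>The equations at D^0 and D^-1 both contain \<open>a 3\<close>. Eliminating it shows that
  f and D h have the same derivative, and both are odd.\<close>

lemma f_eq: "f = D h"
proof -
  have s: "S 1 = 0" by (simp add: S_def)
  have 1: "D (a 3) + dx (a 2) = 0"
    using coeff_eq_odd[of 1] s a_0_1 by (simp add: dx_def numeral_2_eq_2 numeral_3_eq_3)
  have "D (- (27 * f)) = - (dx (a 2) + dx (a 2) + dx (a 2))"
  proof -
    have "D (a 3) = - dx (a 2)" using 1 by (simp add: eq_neg_iff_add_eq_0)
    then show ?thesis by (simp only: a_3_f[symmetric]) (simp add: dx_def)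
  qed
  then have "27 * D f = 27 * D (D h)"
  proof -
    have "(27 :: 'k sdp) * x = 9 * x + 9 * x + 9 * x" for x
      by (simp flip: distrib_right)
    moreover have "- (27 * D f) = - (dx (a 2) + dx (a 2) + dx (a 2))"
      using \<open>D (- (27 * f)) = - (dx (a 2) + dx (a 2) + dx (a 2))\<close> by (simp add: D_mult)
    then have "27 * D f = dx (a 2) + dx (a 2) + dx (a 2)" by (simp only: neg_equal_iff_equal)
    moreover have "dx (a 2) = 9 * D (D h)" by (simp add: a_2 dx_def D_mult)
    ultimately show ?thesis by simp
  qed
  then have "D (f - D h) = 0" by (simp add: numeral_mult_cancel)
  then have "f - D h = 0" by (rule D_odd_eq_0) (simp add: odd_f grading_h)
  then show ?thesis by simp
qed

lemma a_3: "a 3 = - 9 * D h"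
proof -
  note a_3_f
  moreover have "(27 :: 'k sdp) * x = 9 * x + 9 * x + 9 * x" for x
    by (simp flip: distrib_right)
  moreover have "(18 :: 'k sdp) * x = 9 * x + 9 * x" for x
    by (simp flip: distrib_right)
  ultimately have "2 * a 3 = 2 * (- 9 * D h)"
    by (simp add: f_eq a_2 D_mult mult_2 algebra_simps)
  then show ?thesis by (simp only: numeral_mult_cancel)
qed

end

definition letter_val :: "'k::field_char_0 sdp \<Rightarrow> 'k sdp \<Rightarrow> 'k sdp \<Rightarrow> letter \<Rightarrow> 'k sdp" where
  "letter_val h p q x = (case x of Phi k \<Rightarrow> gen k | H k \<Rightarrow> (D ^^ k) h | P \<Rightarrow> p | DP \<Rightarrow> D p | Q \<Rightarrow> q | DQ \<Rightarrow> D q)"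

lemma letter_val_simps [simp]:
  "letter_val h p q (Phi k) = gen k" "letter_val h p q (H k) = (D ^^ k) h" "letter_val h p q P = p"
  "letter_val h p q DP = D p" "letter_val h p q Q = q" "letter_val h p q DQ = D q"
  by (simp_all add: letter_val_def)

lemma letter_values_letter_val:
  assumes "grading h = h" "grading p = p" "grading q = q"
    "dx p = p_eval (letter_val h p q) dp" "dx q = p_eval (letter_val h p q) dq"
  shows "letter_values (letter_val h p q) dp dq"
proof
  fix x
  show "grading (letter_val h p q x) = (if fermionic x then - letter_val h p q x else letter_val h p q x)"
    by (cases x) (simp_all add: assms grading_gen grading_D_power minus_one_power_iff)
  show "D (letter_val h p q x) = p_eval (letter_val h p q) (l_der dp dq x)"
    by (cases x) (simp_all add: assms(4,5)[symmetric] dx_def)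
qed

text \<open>Only \<open>h\<close> may have a constant term.\<close>

lemma mcoeff_p_eval_empty:
  assumes "mcoeff p {#} = 0" "mcoeff q {#} = 0" "\<forall>(c, w)\<in>set xs. \<exists>x\<in>set w. x \<noteq> H 0"
  shows "mcoeff (p_eval (letter_val h p q) xs) {#} = 0"
  using assms(3)
proof (induction xs)
  case (Cons m xs)
  have "mcoeff (letter_val h p q x) {#} = 0" if "x \<noteq> H 0" for x
  proof (cases x)
    case (H k)
    then obtain j where "k = Suc j" using \<open>x \<noteq> H 0\<close> by (cases k) auto
    then show ?thesis by (simp add: H)
  qed (simp_all add: assms)
  then have "\<exists>x\<in>set w. x \<noteq> H 0 \<Longrightarrow> mcoeff (prod_list (map (letter_val h p q) w)) {#} = 0" for w
    by (induction w) (auto simp: mcoeff_mult_empty)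
  then show ?case using Cons by (cases m) (auto simp: mcoeff_simps mcoeff_mult_empty)
qed (simp add: mcoeff_simps)

section \<open>The coefficients of the resolvent\<close>

text \<open>For \<open>x\<close> the coefficient of an even power \<open>D\<^bsup>-k\<^esup>\<close> and \<open>y\<close> that of \<open>D\<^bsup>-k-1\<^esup>\<close>, the two equations come from
  consecutive coefficients of the commutator with \<open>Lam\<close>: \<open>y\<close> is algebraic in \<open>x\<close>, and \<open>x\<close> is found by
  integration.\<close>

lemma dx_even_coeff:
  assumes "2 * y - D x = (X :: 'k::field_char_0 sdp)" "D y + dx x = Y"
  shows "3 * dx x = 2 * Y - D X"
proof -
  have "(3 :: 'k sdp) * z = z + z + z" for z
  proof -
    have "(3 :: 'k sdp) = 1 + 1 + 1" by simp
    then show ?thesis by (simp only: distrib_right mult_1)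
  qed
  then show ?thesis unfolding assms[symmetric] by (simp add: D_mult dx_def mult_2 algebra_simps)
qed

lemma dx_numeral_mult: "dx (numeral n * x) = numeral n * dx x"
  by (simp add: dx_def D_mult)

lemma phi_x_gen: "phi_x k = gen (2 * k)"
  by (induction k) (simp_all add: dx_def)

section \<open>Symbolic composition with \<open>Lam\<close>\<close>

definition lam_comb :: "poly \<Rightarrow> poly \<Rightarrow> poly \<Rightarrow> poly \<Rightarrow> poly \<Rightarrow> poly \<Rightarrow> poly" where
  "lam_comb dp dq w x y z = p_add (p_sig w) (p_add (p_der dp dq x) (p_add (p_der dp dq (p_der dp dq (p_sig y)))
     (p_add (p_der dp dq (p_der dp dq (p_der dp dq z))) (p_mul [(1, [Phi 0])] z))))"

text \<open>The lists hold the coefficients of \<open>X\<close> and \<open>Lam * X\<close> in descending order;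
  \<open>x\<close>, \<open>y\<close>, \<open>z\<close> are the three coefficients of \<open>X\<close> preceding the list.\<close>

fun lam_list :: "poly \<Rightarrow> poly \<Rightarrow> poly \<Rightarrow> poly \<Rightarrow> poly \<Rightarrow> poly list \<Rightarrow> poly list" where
  "lam_list dp dq x y z [] = []"
| "lam_list dp dq x y z (w # ws) = lam_comb dp dq w x y z # lam_list dp dq w x y ws"

text \<open>The constant coefficient of \<open>Lam * X\<close> for a differential operator X with
  constant coefficient x.\<close>

definition lam_act :: "poly \<Rightarrow> poly \<Rightarrow> poly \<Rightarrow> poly" where
  "lam_act dp dq x = p_add (p_der dp dq (p_der dp dq (p_der dp dq x))) (p_mul [(1, [Phi 0])] x)"

text \<open>The constant coefficient of X times phi: the list is descending and ends at D^0, so its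
  head belongs to the power \<open>length ws\<close> and meets the derivative of phi of that
  order.\<close>

fun apply_phi :: "poly list \<Rightarrow> poly" where
  "apply_phi [] = []"
| "apply_phi (w # ws) = p_add (p_mul w [(1, [Phi (length ws)])]) (apply_phi ws)"

context letter_values
begin

text \<open>For an order at which the right-hand side is not an x-derivative in the letters at hand:
  z is the part integrated explicitly, and the remainder r becomes the derivative of a new
  potential.\<close>

lemma even_step_dx:
  assumes X: "2 * y - D x = I X" and Y: "D y + dx x = I Y"
    and e: "p_add (p_smul 2 Y) (p_smul (-1) (p_der dp dq X)) =
      p_add (p_smul 3 (p_der dp dq (p_der dp dq z))) (p_smul 3 r)"
  shows "dx (x - I z) = I r"
proof -
  have "3 * dx x = 2 * I Y - D (I X)" by (rule dx_even_coeff[OF X Y])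
  also have "\<dots> = I (p_add (p_smul 2 Y) (p_smul (-1) (p_der dp dq X)))" by (simp only: I_eqs)
  also have "\<dots> = 3 * dx (I z) + 3 * I r" unfolding e by (simp add: I_add I_smul I_der dx_def)
  finally have "3 * dx (x - I z) = 3 * I r" by (simp add: dx_def right_diff_distrib)
  then show ?thesis by (simp only: numeral_mult_cancel)
qed

lemma odd_step:
  assumes X: "2 * y - D x = I X" and x: "x = I z" and e: "p_add X (p_der dp dq z) = p_smul 2 z'"
  shows "y = I z'"
proof -
  have "2 * y = I X + D (I z)" using X x by (simp add: diff_eq_eq)
  also have "\<dots> = 2 * I z'" using e by (simp only: I_eqs)
  finally show ?thesis by (simp only: numeral_mult_cancel)
qed

lemma even_step:
  assumes X: "2 * y - D x = I X" and Y: "D y + dx x = I Y"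
    and e: "p_add (p_smul 2 Y) (p_smul (-1) (p_der dp dq X)) = p_smul 3 (p_der dp dq (p_der dp dq z))"
    and eps: "mcoeff x {#} = 0" "mcoeff (I z) {#} = 0"
  shows "x = I z"
proof -
  have "3 * dx x = 2 * I Y - D (I X)" by (rule dx_even_coeff[OF X Y])
  also have "\<dots> = 3 * dx (I z)" using e by (simp only: I_eqs)
  finally have "dx x = dx (I z)" by (simp only: numeral_mult_cancel)
  then show ?thesis by (rule dx_cancel) (simp only: eps)
qed

end

section \<open>The next flow in terms of the coefficients of M\<close>

context resolvent
begin

text \<open>Lam^4 = L^2, so j = 4 gives 27 times the coefficients of L^2 M.\<close>

definition b :: "nat \<Rightarrow> int \<Rightarrow> 'k sdp" where "b j m = 27 * opcoeff (Lam ^ j * M) m"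

lemma b_0: "b 0 (- int k) = a k"
  by (simp add: b_def a_def)

lemma phi_27: "phi * (27 * x) = 27 * (phi * x :: 'k sdp)"
  using const_mult_left_commute[of phi 27 x] by (simp add: const_numeral)

lemma D_27: "D (27 * x) = 27 * D (x :: 'k sdp)"
  by (simp add: D_mult)

lemma b_Suc: "b (Suc j) m = grading (b j (m - 3)) + D (b j (m - 2)) + dx (grading (b j (m - 1)))
    + D (dx (b j m)) + phi * b j m"
  unfolding b_def power_Suc mult.assoc opcoeff_Lam_mult
  by (simp add: distrib_left D_27 dx_def phi_27)

lemma b_eq_0: "3 * int j - 2 < m \<Longrightarrow> b j m = 0"
proof -
  have "order_le (3 * int j + - 2) (Lam ^ j * M)"
  proof (induction j)
    case 0
    then show ?case using order_M by simp
  next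
    case (Suc j)
    then show ?case using order_le_mult[OF order_le_Lam Suc] by (simp add: mult.assoc algebra_simps)
  qed
  then show "3 * int j - 2 < m \<Longrightarrow> b j m = 0" by (simp add: b_def order_le_def)
qed

primrec coeffs_are :: "(letter \<Rightarrow> 'k sdp) \<Rightarrow> nat \<Rightarrow> int \<Rightarrow> poly list \<Rightarrow> bool" where
  "coeffs_are v j t [] = True"
| "coeffs_are v j t (w # ws) = (b j t = p_eval v w \<and> coeffs_are v j (t - 1) ws)"

lemma coeffs_are_lam_list:
  assumes "letter_values v dp dq" and phi: "v (Phi 0) = phi"
  shows "coeffs_are v j t ws \<Longrightarrow> b j (t + 1) = p_eval v x \<Longrightarrow> b j (t + 2) = p_eval v y \<Longrightarrow>
    b j (t + 3) = p_eval v z \<Longrightarrow> coeffs_are v (Suc j) (t + 3) (lam_list dp dq x y z ws)"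
proof (induction ws arbitrary: t x y z)
  case (Cons w ws)
  interpret letter_values v dp dq by fact
  have "b (Suc j) (t + 3) = grading (b j t) + D (b j (t + 1)) + dx (grading (b j (t + 2)))
    + D (dx (b j (t + 3))) + phi * b j (t + 3)"
  proof -
    have e: "t + 3 - 3 = t" "t + 3 - 2 = t + 1" "t + 3 - 1 = t + 2" by simp_all
    show ?thesis using b_Suc[of j "t + 3"] by (simp only: e)
  qed
  also have "\<dots> = I (lam_comb dp dq w x y z)"
    using Cons.prems phi by (simp add: lam_comb_def I_add I_sig I_der I_mul I_mulm dx_def add.assoc)
  finally have "b (Suc j) (t + 3) = I (lam_comb dp dq w x y z)" .
  moreover have "coeffs_are v (Suc j) (t - 1 + 3) (lam_list dp dq w x y ws)"
    using Cons.prems by (intro Cons.IH) (simp_all add: algebra_simps)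
  ultimately show ?case by (simp add: algebra_simps)
qed simp

text \<open>The lists start at the top order 3 j - 2; the three preceding coefficients vanish and
  enter as empty polynomials.\<close>

lemma coeffs_are_lam:
  assumes "letter_values v dp dq" "v (Phi 0) = phi" "coeffs_are v j (3 * int j - 2) ws"
  shows "coeffs_are v (Suc j) (3 * int (Suc j) - 2) (lam_list dp dq [] [] [] ws)"
  using coeffs_are_lam_list[OF assms, of "[]" "[]" "[]"] by (simp add: b_eq_0 algebra_simps)

lemma coeffs_are_apply_phi:
  assumes "letter_values v dp dq" and phi: "\<And>k. v (Phi k) = gen k"
  shows "coeffs_are v j (int (length ws) - 1) ws \<Longrightarrow>
    p_eval v (apply_phi ws) = (\<Sum>i<length ws. b j (int i) * gen i)"
proof (induction ws)
  case (Cons w ws)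
  interpret letter_values v dp dq by fact
  show ?case using Cons by (simp add: I_add I_mul I_mulm phi algebra_simps)
qed simp

lemma coeffs_are_last:
  "ws \<noteq> [] \<Longrightarrow> coeffs_are v j (int (length ws) - 1) ws \<Longrightarrow> b j 0 = p_eval v (last ws)"
  by (induction ws) (auto split: if_splits)

lemma opcoeff_Lam_mult_diff_part:
  assumes "diff_part X = X"
  shows "opcoeff (Lam * X) 0 = D (dx (opcoeff X 0)) + phi * opcoeff X 0"
  using assms unfolding diff_part_eq_iff by (simp add: opcoeff_Lam_mult dx_def)

lemma opcoeff_diff_part_mult_phi:
  fixes X :: "'k spdo"
  assumes "diff_part X = X" "order_le N X" "0 \<le> N"
  shows "opcoeff (X * fun_op phi) 0 = (\<Sum>i<Suc (nat N). opcoeff X (int i) * gen i)"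
proof -
  have l: "leibniz_coeff (int i) i phi = (gen i :: 'k sdp)" for i
  proof -
    have "int i div 2 = int (i div 2)" by (simp add: zdiv_int)
    then have "superbinom (int i) i = (of_nat (i div 2) gchoose (i div 2) :: 'k)"
      by (simp add: superbinom_def)
    then have "superbinom (int i) i = (1 :: 'k)" by (simp flip: binomial_gbinomial)
    moreover have "(D ^^ i) (gen 0) = (gen i :: 'k sdp)" by (induction i) auto
    ultimately show ?thesis by (simp add: leibniz_coeff_def)
  qed
  have "opcoeff (X * fun_op phi) 0 = (\<Sum>i=0..N. opcoeff X i * leibniz_coeff i (nat i) phi)"
    by (simp add: opcoeff_mult_fun[OF assms(2)])
  also have "\<dots> = (\<Sum>i<Suc (nat N). opcoeff X (int i) * leibniz_coeff (int i) i phi)"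
    by (rule sum.reindex_bij_witness[of _ int nat]) (use assms(3) in auto)
  finally show ?thesis by (simp only: l)
qed

text \<open>L^2 raises orders by 12, so the eleven coefficients of M from D^-2 to D^-12 fix those of
  L^2 M from D^10 to D^0. The three summands are the constant coefficients of L^2 f, R Lam and Lam
  R.\<close>

lemma next_flow:
  assumes v: "letter_values v dp dq" "\<And>k. v (Phi k) = gen k" "v (H 1) = D h"
    and ws: "coeffs_are v 0 (-2) ws" "length ws = 11"
    and g: "fun_op g = L * (L * fun_op f) + (diff_part (L * (L * M)) * Lam - Lam * diff_part (L * (L * M)))"
    and us: "us = lam_list dp dq [] [] [] (lam_list dp dq [] [] [] (lam_list dp dq [] [] [] (lam_list dp dq [] [] [] ws)))"
  shows "27 * g = p_eval v (p_add (p_smul 27 (lam_act dp dq (lam_act dp dq (lam_act dp dq (lam_act dp dq [(1, [H 1])])))))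
     (p_add (apply_phi us) (p_smul (-1) (lam_act dp dq (last us)))))"
proof -
  interpret letter_values v dp dq by fact
  have len: "length (lam_list dp dq x y z ws) = length ws" for x y z ws
    by (induction ws arbitrary: x y z) auto
  have lus: "length us = 11" by (simp add: us len ws(2))
  have "coeffs_are v (Suc (Suc (Suc (Suc 0)))) 10 us"
    using coeffs_are_lam[OF v(1,2) coeffs_are_lam[OF v(1,2) coeffs_are_lam[OF v(1,2) coeffs_are_lam[OF v(1,2), of 0]]]] ws(1)
    by (simp add: us)
  then have us4: "coeffs_are v 4 (int (length us) - 1) us" by (simp add: lus numeral_eq_Suc)
  define R where "R = diff_part (L * (L * M))"
  have R: "27 * opcoeff R i = (if 0 \<le> i then b 4 i else 0)" for i
    by (simp add: R_def diff_part.rep_eq b_def L_Lam numeral_eq_Suc mult.assoc)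
  have dR: "diff_part R = R" by (simp add: R_def)
  have "order_le 10 R"
    unfolding order_le_def
  proof (intro allI impI)
    fix i :: int assume "10 < i"
    then have "27 * opcoeff R i = 27 * 0" using R[of i] b_eq_0[of 4 i] by simp
    then show "opcoeff R i = 0" by (simp only: numeral_mult_cancel)
  qed
  then have "27 * opcoeff (R * fun_op phi) 0 = (\<Sum>i<11. 27 * opcoeff R (int i) * gen i)"
    using opcoeff_diff_part_mult_phi[OF dR, of 10] by (simp add: sum_distrib_left mult.assoc)
  then have 1: "27 * opcoeff (R * Lam) 0 = I (apply_phi us)"
    using coeffs_are_apply_phi[OF v(1,2) us4] dR unfolding R lus opcoeff_mult_Lam diff_part_eq_iff by simp
  have act: "D (dx (I x)) + phi * I x = I (lam_act dp dq x)" for x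
    using v(2)[of 0] by (simp add: lam_act_def I_add I_der I_mul I_mulm dx_def)
  have "27 * opcoeff (Lam * R) 0 = D (dx (b 4 0)) + phi * b 4 0"
    using R[of 0] by (simp add: opcoeff_Lam_mult_diff_part[OF dR] distrib_left dx_def flip: D_27 phi_27)
  moreover have "us \<noteq> []" using lus by auto
  then have "b 4 0 = I (last us)" using us4 by (rule coeffs_are_last)
  ultimately have 2: "27 * opcoeff (Lam * R) 0 = I (lam_act dp dq (last us))" by (simp add: act)
  have "opcoeff (Lam * (Lam * (Lam * (Lam * fun_op f)))) 0
     = I (lam_act dp dq (lam_act dp dq (lam_act dp dq (lam_act dp dq [(1, [H 1])]))))"
  proof -
    have "f = I [(1, [H 1])]" using f_eq v(3) by simp
    then show ?thesis
      by (simp only: opcoeff_Lam_mult_diff_part diff_part_mult diff_part_Lam diff_part_fun_op fun_op.rep_eq simp_thms if_True act)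
  qed
  moreover have "g = opcoeff (Lam * (Lam * (Lam * (Lam * fun_op f)))) 0 + (opcoeff (R * Lam) 0 - opcoeff (Lam * R) 0)"
    using arg_cong[OF g, of "\<lambda>X. opcoeff X 0"] unfolding R_def[symmetric]
    by (simp add: fun_op.rep_eq plus_spdo.rep_eq opcoeff_minus L_Lam mult.assoc)
  ultimately show ?thesis
    by (simp add: distrib_left right_diff_distrib 1 2 I_add I_smul)
qed

end

section \<open>Explicit coefficients of M down to D^-12\<close>

context resolvent
begin

lemma S_2: "S 2 = a 2 * (of_int (phi_coeff 2 0) * gen 0)"
  by (simp add: S_def add.assoc)

lemma S_3: "S 3 = a 2 * (of_int (phi_coeff 2 1) * gen 1)
    + a 3 * (of_int (phi_coeff 3 0) * gen 0)"
  by (simp add: S_def add.assoc)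

lemma S_4: "S 4 = a 2 * (of_int (phi_coeff 2 2) * gen 2)
    + a 3 * (of_int (phi_coeff 3 1) * gen 1) + a 4 * (of_int (phi_coeff 4 0) * gen 0)"
  by (simp add: S_def add.assoc)

lemma S_5: "S 5 = a 2 * (of_int (phi_coeff 2 3) * gen 3)
    + a 3 * (of_int (phi_coeff 3 2) * gen 2) + a 4 * (of_int (phi_coeff 4 1) * gen 1)
    + a 5 * (of_int (phi_coeff 5 0) * gen 0)"
  by (simp add: S_def add.assoc)

lemma S_6: "S 6 = a 2 * (of_int (phi_coeff 2 4) * gen 4)
    + a 3 * (of_int (phi_coeff 3 3) * gen 3) + a 4 * (of_int (phi_coeff 4 2) * gen 2)
    + a 5 * (of_int (phi_coeff 5 1) * gen 1) + a 6 * (of_int (phi_coeff 6 0) * gen 0)"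
  by (simp add: S_def add.assoc)

lemma S_7: "S 7 = a 2 * (of_int (phi_coeff 2 5) * gen 5)
    + a 3 * (of_int (phi_coeff 3 4) * gen 4) + a 4 * (of_int (phi_coeff 4 3) * gen 3)
    + a 5 * (of_int (phi_coeff 5 2) * gen 2) + a 6 * (of_int (phi_coeff 6 1) * gen 1)
    + a 7 * (of_int (phi_coeff 7 0) * gen 0)"
  by (simp add: S_def add.assoc)

lemma S_8: "S 8 = a 2 * (of_int (phi_coeff 2 6) * gen 6)
    + a 3 * (of_int (phi_coeff 3 5) * gen 5) + a 4 * (of_int (phi_coeff 4 4) * gen 4)
    + a 5 * (of_int (phi_coeff 5 3) * gen 3) + a 6 * (of_int (phi_coeff 6 2) * gen 2)
    + a 7 * (of_int (phi_coeff 7 1) * gen 1) + a 8 * (of_int (phi_coeff 8 0) * gen 0)"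
  by (simp add: S_def add.assoc)

lemma S_9: "S 9 = a 2 * (of_int (phi_coeff 2 7) * gen 7)
    + a 3 * (of_int (phi_coeff 3 6) * gen 6) + a 4 * (of_int (phi_coeff 4 5) * gen 5)
    + a 5 * (of_int (phi_coeff 5 4) * gen 4) + a 6 * (of_int (phi_coeff 6 3) * gen 3)
    + a 7 * (of_int (phi_coeff 7 2) * gen 2) + a 8 * (of_int (phi_coeff 8 1) * gen 1)
    + a 9 * (of_int (phi_coeff 9 0) * gen 0)"
  by (simp add: S_def add.assoc)

lemma S_10: "S 10 = a 2 * (of_int (phi_coeff 2 8) * gen 8)
    + a 3 * (of_int (phi_coeff 3 7) * gen 7) + a 4 * (of_int (phi_coeff 4 6) * gen 6)
    + a 5 * (of_int (phi_coeff 5 5) * gen 5) + a 6 * (of_int (phi_coeff 6 4) * gen 4)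
    + a 7 * (of_int (phi_coeff 7 3) * gen 3) + a 8 * (of_int (phi_coeff 8 2) * gen 2)
    + a 9 * (of_int (phi_coeff 9 1) * gen 1) + a 10 * (of_int (phi_coeff 10 0) * gen 0)"
  by (simp add: S_def add.assoc)

lemma S_11: "S 11 = a 2 * (of_int (phi_coeff 2 9) * gen 9)
    + a 3 * (of_int (phi_coeff 3 8) * gen 8) + a 4 * (of_int (phi_coeff 4 7) * gen 7)
    + a 5 * (of_int (phi_coeff 5 6) * gen 6) + a 6 * (of_int (phi_coeff 6 5) * gen 5)
    + a 7 * (of_int (phi_coeff 7 4) * gen 4) + a 8 * (of_int (phi_coeff 8 3) * gen 3)
    + a 9 * (of_int (phi_coeff 9 2) * gen 2) + a 10 * (of_int (phi_coeff 10 1) * gen 1)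
    + a 11 * (of_int (phi_coeff 11 0) * gen 0)"
  by (simp add: S_def add.assoc)

text \<open>The potentials p and q are not yet constructed, so 0 stands in their place. The lists
  found at this stage contain none of their letters and keep their values under \<open>I2\<close>
  and \<open>I3\<close>.\<close>

abbreviation "I1 \<equiv> p_eval (letter_val h 0 0)"

interpretation s1: letter_values "letter_val h 0 0" "[]" "[]"
  by (rule letter_values_letter_val) (simp_all add: grading_h dx_def)

lemma gen_I1: "gen k = I1 [(1, [Phi k])]" by simp

lemma a_2_1: "a 2 = I1 [(9, [H 0])]"
  by (simp add: a_2)

lemma a_3_1: "a 3 = I1 [(-9, [H 1])]"
  by (simp add: a_3)

text \<open>The equations \<open>X_k\<close> and \<open>Y_k\<close> determine the pair
  \<open>a k\<close>, \<open>a (k + 1)\<close>. They come from the coefficients of D^(2-k) and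
  D^(1-k) in the commutator, with all earlier coefficients inserted.\<close>

lemma X_4: "2 * a 5 - D (a 4) = I1
  [(18, [H 3])]"
proof -
  have "2 * a 5 - D (a 4) = D (dx (a 2)) + phi * a 2 - dx (a 3) - S 2"
    using coeff_eq_even[of 2] by simp
  also have "\<dots> = I1 [(18, [H 3])]"
    unfolding S_2 a_2_1 a_3_1 gen_I1 s1.I_eqs by (rule arg_cong[where f = I1]) code_simp
  finally show ?thesis .
qed

lemma Y_4: "D (a 5) + dx (a 4) = I1
  [(9, [H 4])]"
proof -
  have "D (a 5) + dx (a 4) = S 3 - D (dx (a 3)) - phi * a 3"
    using coeff_eq_odd[of 3] by simp
  also have "\<dots> = I1 [(9, [H 4])]"
    unfolding S_3 a_2_1 a_3_1 gen_I1 s1.I_eqs by (rule arg_cong[where f = I1]) code_simp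
  finally show ?thesis .
qed

lemma a_4_1: "a 4 = I1 []"
  by (rule s1.even_step[OF X_4 Y_4 _ eps_a mcoeff_p_eval_empty], code_simp) (simp_all add: mcoeff_simps)

lemma a_5_1: "a 5 = I1 [(9, [H 3])]"
  by (rule s1.odd_step[OF X_4 a_4_1]) code_simp

lemma X_6: "2 * a 7 - D (a 6) = I1
  [(9, [Phi 1, H 1]), (9, [Phi 2, H 0]), (-9, [H 5])]"
proof -
  have "2 * a 7 - D (a 6) = D (dx (a 4)) + phi * a 4 - dx (a 5) - S 4"
    using coeff_eq_even[of 4] by simp
  also have "\<dots> = I1 [(9, [Phi 1, H 1]), (9, [Phi 2, H 0]), (-9, [H 5])]"
    unfolding S_4 a_2_1 a_3_1 a_4_1 a_5_1 gen_I1 s1.I_eqs by (rule arg_cong[where f = I1]) code_simp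
  finally show ?thesis .
qed

lemma Y_6: "D (a 7) + dx (a 6) = I1
  [(18, [Phi 2, H 1]), (-9, [H 6])]"
proof -
  have "D (a 7) + dx (a 6) = S 5 - D (dx (a 5)) - phi * a 5"
    using coeff_eq_odd[of 5] by simp
  also have "\<dots> = I1 [(18, [Phi 2, H 1]), (-9, [H 6])]"
    unfolding S_5 a_2_1 a_3_1 a_4_1 a_5_1 gen_I1 s1.I_eqs by (rule arg_cong[where f = I1]) code_simp
  finally show ?thesis .
qed

text \<open>What is left of \<open>a 6\<close> after its explicitly integrable part has the
  x-derivative 12 phi_x f. Division by 12 is expressed by choice and is possible in characteristic
  0.\<close>

definition p :: "'k sdp" where "p = (SOME x. 12 * x = a 6 - I1 [(-3, [Phi 1, H 0]), (-3, [H 4])])"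

lemma p_eq: "12 * p = a 6 - I1 [(-3, [Phi 1, H 0]), (-3, [H 4])]"
  unfolding p_def by (rule someI_ex[OF numeral_mult_ex])

lemma grading_p: "grading p = p"
proof -
  have "grading (12 * p) = 12 * p"
    unfolding p_eq by (simp add: grading_a grading_h grading_gen del: p_eval.simps flip: s1.I_sig)
  then show ?thesis by (simp add: numeral_mult_cancel)
qed

lemma eps_p: "mcoeff p {#} = 0"
proof -
  have "mcoeff (12 * p) {#} = 0"
    unfolding p_eq sdp_minus_rep by (subst eps_a, simp, subst mcoeff_p_eval_empty) (simp_all add: mcoeff_simps)
  then show ?thesis by (simp add: mcoeff_mult_empty)
qed

lemma dx_p_aux: "dx p = I1 [(1, [Phi 2, H 1])]"
proof -
  have "dx (12 * p) = I1 (p_smul 12 [(1, [Phi 2, H 1])])"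
    unfolding p_eq by (rule s1.even_step_dx[OF X_6 Y_6]) code_simp
  then have "12 * dx p = 12 * I1 [(1, [Phi 2, H 1])]"
    by (simp only: s1.I_smul dx_numeral_mult of_int_numeral)
  then show ?thesis by (simp only: numeral_mult_cancel)
qed

lemma dx_p: "dx p = phi_x 1 * f"
  unfolding dx_p_aux f_eq phi_x_gen by simp

abbreviation "I2 \<equiv> p_eval (letter_val h p 0)"

interpretation s2: letter_values "letter_val h p 0" "[(1, [Phi 2, H 1])]" "[]"
  by (rule letter_values_letter_val) (simp_all add: grading_h grading_p dx_p_aux, simp_all add: dx_def)

lemma gen_I2: "gen k = I2 [(1, [Phi k])]" by simp

lemma a_2_2: "a 2 = I2 [(9, [H 0])]"
  by (simp add: a_2_1)
lemma a_3_2: "a 3 = I2 [(-9, [H 1])]"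
  by (simp add: a_3_1)
lemma a_4_2: "a 4 = I2 []"
  by (simp add: a_4_1)
lemma a_5_2: "a 5 = I2 [(9, [H 3])]"
  by (simp add: a_5_1)

lemma a_6_2: "a 6 = I2 [(-3, [Phi 1, H 0]), (-3, [H 4]), (12, [P])]"
  using p_eq by (simp add: algebra_simps)

lemma X_6_2: "2 * a 7 - D (a 6) = I2 [(9, [Phi 1, H 1]), (9, [Phi 2, H 0]), (-9, [H 5])]"
  by (simp add: X_6)

lemma a_7_2: "a 7 = I2 [(3, [Phi 1, H 1]), (3, [Phi 2, H 0]), (-6, [H 5]), (6, [DP])]"
  by (rule s2.odd_step[OF X_6_2 a_6_2]) code_simp

lemma X_8: "2 * a 9 - D (a 8) = I2
  [(-15, [Phi 1, H 3]), (-12, [Phi 2, H 2]), (-18, [Phi 3, H 1]), (-15, [Phi 4, H 0]), (3, [H 7])]"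
proof -
  have "2 * a 9 - D (a 8) = D (dx (a 6)) + phi * a 6 - dx (a 7) - S 6"
    using coeff_eq_even[of 6] by simp
  also have "\<dots> = I2 [(-15, [Phi 1, H 3]), (-12, [Phi 2, H 2]), (-18, [Phi 3, H 1]), (-15, [Phi 4, H 0]), (3, [H 7])]"
    unfolding S_6 a_2_2 a_3_2 a_4_2 a_5_2 a_6_2 a_7_2 gen_I2 s2.I_eqs by (rule arg_cong[where f = I2]) code_simp
  finally show ?thesis .
qed

lemma Y_8: "D (a 9) + dx (a 8) = I2
  [(-3, [Phi 1, H 4]), (-33, [Phi 2, H 3]), (-6, [Phi 3, H 2]), (-33, [Phi 4, H 1]),
   (-3, [Phi 5, H 0]), (6, [H 8])]"
proof -
  have "D (a 9) + dx (a 8) = S 7 - D (dx (a 7)) - phi * a 7"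
    using coeff_eq_odd[of 7] by simp
  also have "\<dots> = I2 [(-3, [Phi 1, H 4]), (-33, [Phi 2, H 3]), (-6, [Phi 3, H 2]), (-33, [Phi 4, H 1]),
   (-3, [Phi 5, H 0]), (6, [H 8])]"
    unfolding S_7 a_2_2 a_3_2 a_4_2 a_5_2 a_6_2 a_7_2 gen_I2 s2.I_eqs by (rule arg_cong[where f = I2]) code_simp
  finally show ?thesis .
qed

lemma a_8_2: "a 8 = I2 [(3, [Phi 1, H 2]), (-21, [Phi 2, H 1]), (3, [Phi 3, H 0]), (3, [H 6])]"
  by (rule s2.even_step[OF X_8 Y_8 _ eps_a mcoeff_p_eval_empty], code_simp) (simp_all add: eps_p mcoeff_simps)

lemma a_9_2: "a 9 = I2 [(-6, [Phi 1, H 3]), (6, [Phi 2, H 2]), (-18, [Phi 3, H 1]), (-6, [Phi 4, H 0]), (3, [H 7])]"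
  by (rule s2.odd_step[OF X_8 a_8_2]) code_simp

lemma X_10: "2 * a 11 - D (a 10) = I2
  [(-3, [Phi 1, Phi 1, H 1]), (-12, [Phi 1, Phi 2, H 0]), (15, [Phi 1, H 5]), (-6, [Phi 1, DP]),
   (9, [Phi 2, H 4]), (36, [Phi 2, P]), (36, [Phi 3, H 3]), (27, [Phi 4, H 2]),
   (27, [Phi 5, H 1]), (18, [Phi 6, H 0])]"
proof -
  have "2 * a 11 - D (a 10) = D (dx (a 8)) + phi * a 8 - dx (a 9) - S 8"
    using coeff_eq_even[of 8] by simp
  also have "\<dots> = I2 [(-3, [Phi 1, Phi 1, H 1]), (-12, [Phi 1, Phi 2, H 0]), (15, [Phi 1, H 5]), (-6, [Phi 1, DP]),
   (9, [Phi 2, H 4]), (36, [Phi 2, P]), (36, [Phi 3, H 3]), (27, [Phi 4, H 2]),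
   (27, [Phi 5, H 1]), (18, [Phi 6, H 0])]"
    unfolding S_8 a_2_2 a_3_2 a_4_2 a_5_2 a_6_2 a_7_2 a_8_2 a_9_2 gen_I2 s2.I_eqs by (rule arg_cong[where f = I2]) code_simp
  finally show ?thesis .
qed

lemma Y_10: "D (a 11) + dx (a 10) = I2
  [(-12, [Phi 1, Phi 2, H 1]), (6, [Phi 1, H 6]), (36, [Phi 2, H 5]), (-24, [Phi 2, DP]),
   (18, [Phi 3, H 4]), (78, [Phi 4, H 3]), (18, [Phi 5, H 2]), (48, [Phi 6, H 1]),
   (6, [Phi 7, H 0]), (-3, [H 10])]"
proof -
  have "D (a 11) + dx (a 10) = S 9 - D (dx (a 9)) - phi * a 9"
    using coeff_eq_odd[of 9] by simp
  also have "\<dots> = I2 [(-12, [Phi 1, Phi 2, H 1]), (6, [Phi 1, H 6]), (36, [Phi 2, H 5]), (-24, [Phi 2, DP]),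
   (18, [Phi 3, H 4]), (78, [Phi 4, H 3]), (18, [Phi 5, H 2]), (48, [Phi 6, H 1]),
   (6, [Phi 7, H 0]), (-3, [H 10])]"
    unfolding S_9 a_2_2 a_3_2 a_4_2 a_5_2 a_6_2 a_7_2 a_8_2 a_9_2 gen_I2 s2.I_eqs by (rule arg_cong[where f = I2]) code_simp
  finally show ?thesis .
qed

text \<open>The subtracted list is chosen so that the rest of \<open>a 10\<close> is twice the
  potential whose D-derivative is the braces of the recursion operator applied to f.\<close>

definition q :: "'k sdp" where "q = (SOME x. 2 * x = a 10 - I2 [(1, [Phi 1, Phi 1, H 0]), (-1, [Phi 1, H 4]), (-8, [Phi 1, P]), (22, [Phi 2, H 3]),
   (-2, [Phi 3, H 2]), (27, [Phi 4, H 1]), (-4, [Phi 5, H 0]), (-2, [H 8])])"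

lemma q_eq: "2 * q = a 10 - I2 [(1, [Phi 1, Phi 1, H 0]), (-1, [Phi 1, H 4]), (-8, [Phi 1, P]), (22, [Phi 2, H 3]),
   (-2, [Phi 3, H 2]), (27, [Phi 4, H 1]), (-4, [Phi 5, H 0]), (-2, [H 8])]"
  unfolding q_def by (rule someI_ex[OF numeral_mult_ex])

lemma grading_q: "grading q = q"
proof -
  have "grading (2 * q) = 2 * q"
    unfolding q_eq by (simp add: grading_a grading_h grading_gen grading_p del: p_eval.simps flip: s2.I_sig)
  then show ?thesis by (simp add: numeral_mult_cancel)
qed

lemma eps_q: "mcoeff q {#} = 0"
proof -
  have "mcoeff (2 * q) {#} = 0"
    unfolding q_eq sdp_minus_rep by (subst eps_a, simp, subst mcoeff_p_eval_empty) (simp_all add: mcoeff_simps eps_p)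
  then show ?thesis by (simp add: mcoeff_mult_empty)
qed

lemma dx_q_aux: "dx q = I2 [(1, [Phi 1, Phi 3, H 0]), (-1, [Phi 2, DP]), (-2, [Phi 3, P]), (1, [Phi 6, H 1]),
   (1, [Phi 7, H 0])]"
proof -
  have "dx (2 * q) = I2 (p_smul 2 [(1, [Phi 1, Phi 3, H 0]), (-1, [Phi 2, DP]), (-2, [Phi 3, P]), (1, [Phi 6, H 1]),
   (1, [Phi 7, H 0])])"
    unfolding q_eq by (rule s2.even_step_dx[OF X_10 Y_10]) code_simp
  then have "2 * dx q = 2 * I2 [(1, [Phi 1, Phi 3, H 0]), (-1, [Phi 2, DP]), (-2, [Phi 3, P]), (1, [Phi 6, H 1]),
   (1, [Phi 7, H 0])]"
    by (simp only: s2.I_smul dx_numeral_mult of_int_numeral)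
  then show ?thesis by (simp only: numeral_mult_cancel)
qed

abbreviation "I3 \<equiv> p_eval (letter_val h p q)"

interpretation s3: letter_values "letter_val h p q" "[(1, [Phi 2, H 1])]" "[(1, [Phi 1, Phi 3, H 0]), (-1, [Phi 2, DP]), (-2, [Phi 3, P]), (1, [Phi 6, H 1]),
   (1, [Phi 7, H 0])]"
  by (rule letter_values_letter_val) (simp_all add: grading_h grading_p grading_q dx_p_aux dx_q_aux)

lemma gen_I3: "gen k = I3 [(1, [Phi k])]" by simp

lemma a_2_3: "a 2 = I3 [(9, [H 0])]"
  by (simp add: a_2_2)
lemma a_3_3: "a 3 = I3 [(-9, [H 1])]"
  by (simp add: a_3_2)
lemma a_4_3: "a 4 = I3 []"
  by (simp add: a_4_2)
lemma a_5_3: "a 5 = I3 [(9, [H 3])]"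
  by (simp add: a_5_2)
lemma a_6_3: "a 6 = I3 [(-3, [Phi 1, H 0]), (-3, [H 4]), (12, [P])]"
  by (simp add: a_6_2)
lemma a_7_3: "a 7 = I3 [(3, [Phi 1, H 1]), (3, [Phi 2, H 0]), (-6, [H 5]), (6, [DP])]"
  by (simp add: a_7_2)
lemma a_8_3: "a 8 = I3 [(3, [Phi 1, H 2]), (-21, [Phi 2, H 1]), (3, [Phi 3, H 0]), (3, [H 6])]"
  by (simp add: a_8_2)
lemma a_9_3: "a 9 = I3 [(-6, [Phi 1, H 3]), (6, [Phi 2, H 2]), (-18, [Phi 3, H 1]), (-6, [Phi 4, H 0]), (3, [H 7])]"
  by (simp add: a_9_2)

lemma a_10_3: "a 10 = I3 [(1, [Phi 1, Phi 1, H 0]), (-1, [Phi 1, H 4]), (-8, [Phi 1, P]), (22, [Phi 2, H 3]),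
   (-2, [Phi 3, H 2]), (27, [Phi 4, H 1]), (-4, [Phi 5, H 0]), (-2, [H 8]), (2, [Q])]"
  using q_eq by (simp add: algebra_simps)

lemma X_10_3: "2 * a 11 - D (a 10) = I3 [(-3, [Phi 1, Phi 1, H 1]), (-12, [Phi 1, Phi 2, H 0]), (15, [Phi 1, H 5]), (-6, [Phi 1, DP]),
   (9, [Phi 2, H 4]), (36, [Phi 2, P]), (36, [Phi 3, H 3]), (27, [Phi 4, H 2]),
   (27, [Phi 5, H 1]), (18, [Phi 6, H 0])]"
  by (simp add: X_10)

lemma a_11_3: "a 11 = I3 [(-1, [Phi 1, Phi 1, H 1]), (-5, [Phi 1, Phi 2, H 0]), (7, [Phi 1, H 5]), (-7, [Phi 1, DP]),
   (-7, [Phi 2, H 4]), (14, [Phi 2, P]), (28, [Phi 3, H 3]), (-1, [Phi 4, H 2]),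
   (25, [Phi 5, H 1]), (7, [Phi 6, H 0]), (-1, [H 9]), (1, [DQ])]"
  by (rule s3.odd_step[OF X_10_3 a_10_3]) code_simp

lemma X_12: "2 * a 13 - D (a 12) = I3
  [(8, [Phi 1, Phi 1, H 3]), (14, [Phi 1, Phi 2, H 2]), (34, [Phi 1, Phi 3, H 1]),
   (32, [Phi 1, Phi 4, H 0]), (-11, [Phi 1, H 7]), (32, [Phi 2, Phi 3, H 0]),
   (-4, [Phi 2, H 6]), (-40, [Phi 3, H 5]), (20, [Phi 3, DP]), (-26, [Phi 4, H 4]),
   (-96, [Phi 4, P]), (-64, [Phi 5, H 3]), (-40, [Phi 6, H 2]), (-36, [Phi 7, H 1]),
   (-19, [Phi 8, H 0]), (-1, [H 11])]"
proof -
  have "2 * a 13 - D (a 12) = D (dx (a 10)) + phi * a 10 - dx (a 11) - S 10"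
    using coeff_eq_even[of 10] by simp
  also have "\<dots> = I3 [(8, [Phi 1, Phi 1, H 3]), (14, [Phi 1, Phi 2, H 2]), (34, [Phi 1, Phi 3, H 1]),
   (32, [Phi 1, Phi 4, H 0]), (-11, [Phi 1, H 7]), (32, [Phi 2, Phi 3, H 0]),
   (-4, [Phi 2, H 6]), (-40, [Phi 3, H 5]), (20, [Phi 3, DP]), (-26, [Phi 4, H 4]),
   (-96, [Phi 4, P]), (-64, [Phi 5, H 3]), (-40, [Phi 6, H 2]), (-36, [Phi 7, H 1]),
   (-19, [Phi 8, H 0]), (-1, [H 11])]"
    unfolding S_10 a_2_3 a_3_3 a_4_3 a_5_3 a_6_3 a_7_3 a_8_3 a_9_3 a_10_3 a_11_3 gen_I3 s3.I_eqs by (rule arg_cong[where f = I3]) code_simp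
  finally show ?thesis .
qed

lemma Y_12: "D (a 13) + dx (a 12) = I3
  [(1, [Phi 1, Phi 1, H 4]), (34, [Phi 1, Phi 2, H 3]), (6, [Phi 1, Phi 3, H 2]),
   (34, [Phi 1, Phi 4, H 1]), (4, [Phi 1, Phi 5, H 0]), (-7, [Phi 1, H 8]),
   (104, [Phi 2, Phi 3, H 1]), (-29, [Phi 2, H 7]), (4, [Phi 3, Phi 3, H 0]),
   (-28, [Phi 3, H 6]), (-103, [Phi 4, H 5]), (82, [Phi 4, DP]), (-45, [Phi 5, H 4]),
   (-12, [Phi 5, P]), (-138, [Phi 6, H 3]), (-32, [Phi 7, H 2]), (-64, [Phi 8, H 1]),
   (-8, [Phi 9, H 0]), (1, [H 12])]"
proof -
  have "D (a 13) + dx (a 12) = S 11 - D (dx (a 11)) - phi * a 11"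
    using coeff_eq_odd[of 11] by simp
  also have "\<dots> = I3 [(1, [Phi 1, Phi 1, H 4]), (34, [Phi 1, Phi 2, H 3]), (6, [Phi 1, Phi 3, H 2]),
   (34, [Phi 1, Phi 4, H 1]), (4, [Phi 1, Phi 5, H 0]), (-7, [Phi 1, H 8]),
   (104, [Phi 2, Phi 3, H 1]), (-29, [Phi 2, H 7]), (4, [Phi 3, Phi 3, H 0]),
   (-28, [Phi 3, H 6]), (-103, [Phi 4, H 5]), (82, [Phi 4, DP]), (-45, [Phi 5, H 4]),
   (-12, [Phi 5, P]), (-138, [Phi 6, H 3]), (-32, [Phi 7, H 2]), (-64, [Phi 8, H 1]),
   (-8, [Phi 9, H 0]), (1, [H 12])]"
    unfolding S_11 a_2_3 a_3_3 a_4_3 a_5_3 a_6_3 a_7_3 a_8_3 a_9_3 a_10_3 a_11_3 gen_I3 s3.I_eqs by (rule arg_cong[where f = I3]) code_simp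
  finally show ?thesis .
qed

lemma a_12_3: "a 12 = I3 [(-2, [Phi 1, Phi 1, H 2]), (22, [Phi 1, Phi 2, H 1]), (-8, [Phi 1, Phi 3, H 0]),
   (-1, [Phi 1, H 6]), (-17, [Phi 2, H 5]), (16, [Phi 2, DP]), (-3, [Phi 3, H 4]),
   (24, [Phi 3, P]), (-47, [Phi 4, H 3]), (3, [Phi 5, H 2]), (-37, [Phi 6, H 1]),
   (1, [Phi 7, H 0]), (1, [H 10])]"
  by (rule s3.even_step[OF X_12 Y_12 _ eps_a mcoeff_p_eval_empty], code_simp) (simp_all add: eps_p eps_q)

text \<open>The factor -27 gives D^13 h, the sixth x-derivative of f, the coefficient 1, as in the
  recursion operator.\<close>

lemma next_flow_eq:
  assumes "fun_op g = L * (L * fun_op f) + (diff_part (L * (L * M)) * Lam - Lam * diff_part (L * (L * M)))"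
  shows "- 27 * g = I3
  [(4, [Phi 1, Phi 1, Phi 1, H 1]), (7, [Phi 1, Phi 1, Phi 2, H 0]), (9, [Phi 1, Phi 1, H 5]),
   (-5, [Phi 1, Phi 1, DP]), (12, [Phi 1, Phi 2, H 4]), (-6, [Phi 1, Phi 2, P]),
   (9, [Phi 1, Phi 3, H 3]), (12, [Phi 1, Phi 4, H 2]), (4, [Phi 1, Phi 5, H 1]),
   (6, [Phi 1, Phi 6, H 0]), (6, [Phi 1, H 9]), (-1, [Phi 1, DQ]), (6, [Phi 2, Phi 3, H 2]),
   (3, [Phi 2, Phi 4, H 1]), (2, [Phi 2, Phi 5, H 0]), (-2, [Phi 2, Q]),
   (5, [Phi 3, Phi 4, H 0]), (9, [Phi 3, H 7]), (6, [Phi 4, H 6]), (5, [Phi 5, H 5]),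
   (-2, [Phi 5, DP]), (9, [Phi 6, H 4]), (1, [Phi 7, H 3]), (5, [Phi 8, H 2]),
   (1, [Phi 10, H 0]), (1, [H 13])]"
proof -
  let ?ws = "[[(9, [H 0])], [(-9, [H 1])], [], [(9, [H 3])], [(-3, [Phi 1, H 0]), (-3, [H 4]), (12, [P])], [(3, [Phi 1, H 1]), (3, [Phi 2, H 0]), (-6, [H 5]), (6, [DP])], [(3, [Phi 1, H 2]), (-21, [Phi 2, H 1]), (3, [Phi 3, H 0]), (3, [H 6])], [(-6, [Phi 1, H 3]), (6, [Phi 2, H 2]), (-18, [Phi 3, H 1]), (-6, [Phi 4, H 0]), (3, [H 7])], [(1, [Phi 1, Phi 1, H 0]), (-1, [Phi 1, H 4]), (-8, [Phi 1, P]), (22, [Phi 2, H 3]),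
   (-2, [Phi 3, H 2]), (27, [Phi 4, H 1]), (-4, [Phi 5, H 0]), (-2, [H 8]), (2, [Q])], [(-1, [Phi 1, Phi 1, H 1]), (-5, [Phi 1, Phi 2, H 0]), (7, [Phi 1, H 5]), (-7, [Phi 1, DP]),
   (-7, [Phi 2, H 4]), (14, [Phi 2, P]), (28, [Phi 3, H 3]), (-1, [Phi 4, H 2]),
   (25, [Phi 5, H 1]), (7, [Phi 6, H 0]), (-1, [H 9]), (1, [DQ])], [(-2, [Phi 1, Phi 1, H 2]), (22, [Phi 1, Phi 2, H 1]), (-8, [Phi 1, Phi 3, H 0]),
   (-1, [Phi 1, H 6]), (-17, [Phi 2, H 5]), (16, [Phi 2, DP]), (-3, [Phi 3, H 4]),
   (24, [Phi 3, P]), (-47, [Phi 4, H 3]), (3, [Phi 5, H 2]), (-37, [Phi 6, H 1]),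
   (1, [Phi 7, H 0]), (1, [H 10])]]"
  have c: "coeffs_are (letter_val h p q) 0 (-2) ?ws"
    using b_0[of 2] b_0[of 3] b_0[of 4] b_0[of 5] b_0[of 6] b_0[of 7] b_0[of 8] b_0[of 9] b_0[of 10] b_0[of 11] b_0[of 12]
    by (simp add: a_2_3 a_3_3 a_4_3 a_5_3 a_6_3 a_7_3 a_8_3 a_9_3 a_10_3 a_11_3 a_12_3 del: p_eval.simps)
  have "27 * g = I3 [(-4, [Phi 1, Phi 1, Phi 1, H 1]), (-7, [Phi 1, Phi 1, Phi 2, H 0]), (-9, [Phi 1, Phi 1, H 5]),
   (5, [Phi 1, Phi 1, DP]), (-12, [Phi 1, Phi 2, H 4]), (6, [Phi 1, Phi 2, P]),
   (-9, [Phi 1, Phi 3, H 3]), (-12, [Phi 1, Phi 4, H 2]), (-4, [Phi 1, Phi 5, H 1]),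
   (-6, [Phi 1, Phi 6, H 0]), (-6, [Phi 1, H 9]), (1, [Phi 1, DQ]), (-6, [Phi 2, Phi 3, H 2]),
   (-3, [Phi 2, Phi 4, H 1]), (-2, [Phi 2, Phi 5, H 0]), (2, [Phi 2, Q]),
   (-5, [Phi 3, Phi 4, H 0]), (-9, [Phi 3, H 7]), (-6, [Phi 4, H 6]), (-5, [Phi 5, H 5]),
   (2, [Phi 5, DP]), (-9, [Phi 6, H 4]), (-1, [Phi 7, H 3]), (-5, [Phi 8, H 2]),
   (-1, [Phi 10, H 0]), (-1, [H 13])]"
    \<comment> \<open>\<open>next_flow\<close> leaves an unevaluated list expression;
      \<open>code_simp\<close> carries out the four compositions with \<open>Lam\<close>.\<close>
    by (rule trans[OF next_flow[OF s3.letter_values_axioms _ _ c _ assms refl] arg_cong[where f = I3]],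
        simp, simp, simp, code_simp)
  then have "- 27 * g = - I3 [(-4, [Phi 1, Phi 1, Phi 1, H 1]), (-7, [Phi 1, Phi 1, Phi 2, H 0]), (-9, [Phi 1, Phi 1, H 5]),
   (5, [Phi 1, Phi 1, DP]), (-12, [Phi 1, Phi 2, H 4]), (6, [Phi 1, Phi 2, P]),
   (-9, [Phi 1, Phi 3, H 3]), (-12, [Phi 1, Phi 4, H 2]), (-4, [Phi 1, Phi 5, H 1]),
   (-6, [Phi 1, Phi 6, H 0]), (-6, [Phi 1, H 9]), (1, [Phi 1, DQ]), (-6, [Phi 2, Phi 3, H 2]),
   (-3, [Phi 2, Phi 4, H 1]), (-2, [Phi 2, Phi 5, H 0]), (2, [Phi 2, Q]),
   (-5, [Phi 3, Phi 4, H 0]), (-9, [Phi 3, H 7]), (-6, [Phi 4, H 6]), (-5, [Phi 5, H 5]),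
   (2, [Phi 5, DP]), (-9, [Phi 6, H 4]), (-1, [Phi 7, H 3]), (-5, [Phi 8, H 2]),
   (-1, [Phi 10, H 0]), (-1, [H 13])]" by simp
  also have "\<dots> = I3 [(4, [Phi 1, Phi 1, Phi 1, H 1]), (7, [Phi 1, Phi 1, Phi 2, H 0]), (9, [Phi 1, Phi 1, H 5]),
   (-5, [Phi 1, Phi 1, DP]), (12, [Phi 1, Phi 2, H 4]), (-6, [Phi 1, Phi 2, P]),
   (9, [Phi 1, Phi 3, H 3]), (12, [Phi 1, Phi 4, H 2]), (4, [Phi 1, Phi 5, H 1]),
   (6, [Phi 1, Phi 6, H 0]), (6, [Phi 1, H 9]), (-1, [Phi 1, DQ]), (6, [Phi 2, Phi 3, H 2]),
   (3, [Phi 2, Phi 4, H 1]), (2, [Phi 2, Phi 5, H 0]), (-2, [Phi 2, Q]),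
   (5, [Phi 3, Phi 4, H 0]), (9, [Phi 3, H 7]), (6, [Phi 4, H 6]), (5, [Phi 5, H 5]),
   (-2, [Phi 5, DP]), (9, [Phi 6, H 4]), (1, [Phi 7, H 3]), (5, [Phi 8, H 2]),
   (1, [Phi 10, H 0]), (1, [H 13])]"
    unfolding s3.I_eqs by (rule arg_cong[where f = I3]) code_simp
  finally show ?thesis .
qed

end

section \<open>The recursion operator\<close>

context resolvent
begin

definition val :: "letter \<Rightarrow> 'k sdp" where "val = letter_val h p q"

abbreviation "J \<equiv> p_eval val"

interpretation val: letter_values val "[(1, [Phi 2, H 1])]" "[(1, [Phi 1, Phi 3, H 0]), (-1, [Phi 2, DP]), (-2, [Phi 3, P]), (1, [Phi 6, H 1]),
   (1, [Phi 7, H 0])]"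
  unfolding val_def
  by (rule letter_values_letter_val) (simp_all add: grading_h grading_p grading_q dx_p_aux dx_q_aux)

text \<open>The remaining integral, of (phi_xxx + 2 phi_x D phi) f, requires no further potential: r
  is solved from the required formula for D q, and its own derivative is checked in
  \<open>D_r\<close>.\<close>

definition r :: "'k sdp" where "r = (SOME x. 2 * x = J [(-1, [Phi 1, Phi 2, H 0]), (3, [Phi 1, DP]), (2, [Phi 2, P]), (-1, [Phi 6, H 0]), (1, [DQ])])"

lemma r_eq: "2 * r = J [(-1, [Phi 1, Phi 2, H 0]), (3, [Phi 1, DP]), (2, [Phi 2, P]), (-1, [Phi 6, H 0]), (1, [DQ])]"
  unfolding r_def by (rule someI_ex[OF numeral_mult_ex])

lemma dx_powers: "(dx ^^ 2) x = dx (dx x)" "(dx ^^ 3) x = dx (dx (dx x))"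
  "(dx ^^ 4) x = dx (dx (dx (dx x)))" "(dx ^^ 6) x = dx (dx (dx (dx (dx (dx x)))))"
  by (simp_all add: eval_nat_numeral)

lemma letters_J:
  "phi_x 0 = J [(1, [Phi 0])]" "phi_x 1 = J [(1, [Phi 2])]" "phi_x 2 = J [(1, [Phi 4])]"
  "phi_x 3 = J [(1, [Phi 6])]" "phi_x 4 = J [(1, [Phi 8])]" "phi_x 5 = J [(1, [Phi 10])]"
  "f = J [(1, [H 1])]" "h = J [(1, [H 0])]" "p = J [(1, [P])]" "q = J [(1, [Q])]"
  unfolding phi_x_gen f_eq val_def by simp_all

text \<open>Only 2 r has an integral list, so a factor 2 must be moved next to r before the term is
  evaluated.\<close>

lemma r_swap: "x * r = y" if "x = 2 * z" "y = z * J [(-1, [Phi 1, Phi 2, H 0]), (3, [Phi 1, DP]), (2, [Phi 2, P]), (-1, [Phi 6, H 0]), (1, [DQ])]" for x y z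
proof -
  have "2 * z * r = z * (2 * r)"
    using const_mult_left_commute[of z 2 r] by (simp add: const_numeral mult.assoc)
  then show ?thesis using that r_eq by simp
qed

lemma D_r: "D r = (phi_x 3 + 2 * phi_x 1 * Dphi_x 0) * f"
proof -
  have "2 * D r = D (2 * r)" by (simp add: D_mult)
  also have "\<dots> = 2 * ((phi_x 3 + 2 * phi_x 1 * Dphi_x 0) * f)"
    unfolding r_eq unfolding letters_J val.I_eqs by (rule arg_cong[where f = J]) code_simp
  finally show ?thesis by (simp only: numeral_mult_cancel)
qed

lemma eps_r: "mcoeff r {#} = 0"
proof -
  have "mcoeff (2 * r) {#} = 0"
    unfolding r_eq val_def by (rule mcoeff_p_eval_empty) (simp_all add: eps_p eps_q)
  then show ?thesis by (simp add: mcoeff_mult_empty)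
qed

lemma D_q: "D q = (phi_x 3 + phi_x 1 * Dphi_x 0) * h - 3 * Dphi_x 0 * D p - 2 * phi_x 1 * p + 2 * r"
  unfolding r_eq unfolding letters_J val.I_eqs by (rule arg_cong[where f = J]) code_simp

text \<open>Stated with h, p, q, r in place of the formal inverses. It thus also covers a constant
  nonzero h with f = 0, where \<open>antideriv D\<close> would return 0.\<close>

lemma next_flow_expand:
  assumes "fun_op g = L * (L * fun_op f) + (diff_part (L * (L * M)) * Lam - Lam * diff_part (L * (L * M)))"
  shows "- 27 * g =
     (dx ^^ 6) f + 6 * Dphi_x 0 * (dx ^^ 4) f + 9 * Dphi_x 1 * (dx ^^ 3) f + 6 * phi_x 2 * (dx ^^ 2) (D f)
     + (5 * Dphi_x 2 + 9 * (Dphi_x 0)^2) * (dx ^^ 2) f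
     + (9 * phi_x 3 + 12 * phi_x 1 * Dphi_x 0) * dx (D f) + (Dphi_x 3 + 9 * Dphi_x 1 * Dphi_x 0) * dx f
     + (5 * phi_x 4 + 12 * phi_x 2 * Dphi_x 0 + 6 * phi_x 1 * Dphi_x 1) * D f
     + (4 * Dphi_x 2 * Dphi_x 0 + 4 * (Dphi_x 0)^3 - 3 * phi_x 2 * phi_x 1) * f
     + (phi_x 5 + 5 * phi_x 3 * Dphi_x 0 + 5 * phi_x 2 * Dphi_x 1 + 2 * phi_x 1 * Dphi_x 2
         + 6 * phi_x 1 * (Dphi_x 0)^2) * h
     - (2 * Dphi_x 2 + 2 * (Dphi_x 0)^2) * D p
     - 4 * phi_x 1 * Dphi_x 0 * p
     - 2 * Dphi_x 0 * r
     - 2 * phi_x 1 * q"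
proof -
  have rr: "2 * Dphi_x 0 * r = Dphi_x 0 * J [(-1, [Phi 1, Phi 2, H 0]), (3, [Phi 1, DP]), (2, [Phi 2, P]), (-1, [Phi 6, H 0]), (1, [DQ])]"
    by (rule r_swap) (rule refl)+
  show ?thesis
    unfolding next_flow_eq[OF assms, folded val_def] rr power2_eq_square power3_eq_cube
    unfolding letters_J
    unfolding dx_powers
    unfolding val.I_eqs by (rule arg_cong[where f = J]) code_simp
qed

end

section \<open>Values of the recursion operator and the fifth flow\<close>

lemma app_plus: "app (A + B) x = (case (app A x, app B x) of (Some y, Some z) \<Rightarrow> Some (y + z) | _ \<Rightarrow> None)"
  and app_minus: "app (A - B) x = (case (app A x, app B x) of (Some y, Some z) \<Rightarrow> Some (y - z) | _ \<Rightarrow> None)"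
  by (simp_all add: plus_nonlocal_op_def minus_nonlocal_op_def)

lemma app_times: "app (A * B) x = (case app B x of None \<Rightarrow> None | Some y \<Rightarrow> app A y)"
  by (simp add: times_nonlocal_op_def map_comp_def)

lemma app_basic: "app \<langle>c\<rangle> x = Some (c * x)" "app \<D> x = Some (D x)" "app \<D>\<inverse> x = antideriv D x"
  "app \<partial> x = Some (dx x)" "app \<partial>\<inverse> x = antideriv dx x"
  by (simp_all add: mult_by_def DD_def DX_def Dinv_def DXinv_def)

lemma app_DX_power: "app (\<partial> ^ n) x = Some ((dx ^^ n) x)"
  by (induction n) (simp_all add: one_nonlocal_op_def app_times app_basic)

text \<open>\<open>antideriv\<close> returns the preimage without constant term. Since h, p, q, r
  have none, they are the values of the nested inverses, and all terms are defined.\<close>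

lemma (in resolvent) app_recursion_op:
  assumes eps_h: "mcoeff h {#} = 0"
    and g: "fun_op g = L * (L * fun_op f) + (diff_part (L * (L * M)) * Lam - Lam * diff_part (L * (L * M)))"
  shows "app recursion_op f = Some (- 27 * g)"
proof -
  have h: "antideriv D f = Some h" by (rule antideriv_D[OF f_eq[symmetric] eps_h])
  have p: "antideriv dx (phi_x 1 * f) = Some p" by (rule antideriv_dx[OF dx_p eps_p])
  \<comment> \<open>The same source phi_x f occurs under both inverses: p inverts the x-derivative,
    and D p, which has no constant term, inverts D.\<close>
  have Dp: "antideriv D (phi_x 1 * f) = Some (D p)"
    using dx_p by (intro antideriv_D) (simp_all add: dx_def)
  have r: "antideriv D ((phi_x 3 + 2 * phi_x 1 * Dphi_x 0) * f) = Some r"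
    by (rule antideriv_D[OF D_r eps_r])
  have q: "antideriv D ((phi_x 3 + phi_x 1 * Dphi_x 0) * h - 3 * Dphi_x 0 * D p - 2 * phi_x 1 * p + 2 * r) = Some q"
    by (rule antideriv_D[OF D_q eps_q])
  show ?thesis
    unfolding next_flow_expand[OF g] recursion_op_def app_plus app_minus app_times app_basic app_DX_power
      option.case prod.case h p Dp r q by (rule refl)
qed

lemma recursion:
  fixes f g :: "'k::field_char_0 sdp"
  assumes "odd n" "flow n f" "flow (n + 6) g"
  shows "app recursion_op f = Some (- 27 * g)"
proof -
  define M where "M = cbrt_L ^ n - (diff_part (cbrt_L ^ n) :: 'k spdo)"
  interpret resolvent M f
  proof
    show "order_le (-2) M"
      unfolding order_le_def
    proof (intro allI impI)
      fix i :: int assume "-2 < i"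
      then have "i = -1 \<or> 0 \<le> i" by auto
      then show "opcoeff M i = 0"
        using residue_odd_power[OF assms(1)] by (auto simp: M_def opcoeff_minus diff_part.rep_eq)
    qed
    show "parity M = M" by (simp add: M_def parity_diff_part)
    show "mcoeff (opcoeff M i) {#} = 0" if "i < -2" for i
      using that mcoeff_cbrt_L_power[of i n, where ?'a = 'k] by (simp add: M_def opcoeff_minus diff_part.rep_eq)
    show "M * Lam - Lam * M = - fun_op f"
      unfolding M_def by (rule flow_plus_6_minus[OF assms])
    show "grading f = - f" using assms(2) by (simp add: flow_def odd_elem_iff)
  qed
  have "mcoeff (opcoeff M (-2)) {#} = 0"
    using mcoeff_cbrt_L_power[of "-2" n, where ?'a = 'k] by (simp add: M_def opcoeff_minus diff_part.rep_eq)
  then have "mcoeff h {#} = 0" by (simp add: h_def mcoeff_mult_empty)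
  then show ?thesis
    using flow_plus_6[OF assms] unfolding M_def[symmetric] by (rule app_recursion_op)
qed

text \<open>The fifth flow is the recursion applied to the trivial flow of \<open>L\<^bsup>-1/3\<^esup>\<close>, where \<open>D\<^sup>-\<^sup>1 0\<close> is a nonzero
  constant. The factor 2 keeps \<open>q\<close> integral.\<close>

lemma flow_5_eq:
  fixes g :: "'k::field_char_0 sdp"
  assumes "flow 5 g"
  shows "9 * g + phi_x 5 + 5 * phi_x 3 * Dphi_x 0 + 5 * phi_x 2 * Dphi_x 1 + 5 * phi_x 1 * (Dphi_x 0)^2 = 0"
proof -
  obtain N :: "'k spdo" where N: "order_le (-2) N" "opcoeff N (-2) = 1" "parity N = N"
    "\<And>i. i < -2 \<Longrightarrow> mcoeff (opcoeff N i) {#} = 0" "N * Lam = Lam * N"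
    "fun_op g = diff_part (L * (L * N)) * Lam - Lam * diff_part (L * (L * N))"
    using flow_5_from_inverse_root[OF assms] by blast
  define M where "M = N + N"
  have f0: "fun_op 0 = (0 :: 'k spdo)" by (rule spdo_eqI) (simp add: opcoeff_simps)
  interpret resolvent M 0
    by standard (simp_all add: M_def order_le_add N opcoeff_simps mcoeff_simps distrib_left distrib_right f0)
  have "opcoeff M (-2) = 2" by (simp add: M_def opcoeff_simps N(2))
  then have h6: "h = 6" by (simp add: h_def)
  have "dx p = dx 0" using dx_p by (simp add: dx_def)
  then have p0: "p = 0" by (rule dx_cancel) (simp only: eps_p zero_sdp.rep_eq)
  have "D r = 0" using D_r by simp
  then have r0: "r = 0" using eps_r by (rule D_eq_0)
  interpret s: letter_values "letter_val (0 :: 'k sdp) 0 0" "[]" "[]"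
    by (rule letter_values_letter_val) (simp_all add: dx_def)
  let ?I = "p_eval (letter_val (0 :: 'k sdp) 0 0)"
  have I: "phi_x 0 = ?I [(1, [Phi 0])]" "phi_x 1 = ?I [(1, [Phi 2])]" "phi_x 2 = ?I [(1, [Phi 4])]"
    "phi_x 3 = ?I [(1, [Phi 6])]" "phi_x 5 = ?I [(1, [Phi 10])]"
    unfolding phi_x_gen by simp_all
  \<comment> \<open>With h = 6 and p = r = 0, D q = 6 (phi_xxx + phi_x D phi), which integrates to 6
    D phi_xx + 3 (D phi)^2. Its contribution cancels the term phi_x D phi_xx and lowers the
    coefficient of phi_x (D phi)^2 from 6 to 5.\<close>
  have q: "q = ?I [(6, [Phi 5]), (3, [Phi 1, Phi 1])]"
  proof (rule D_cancel)
    have six: "6 = ?I [(6, [])]" by simp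
    have "D q = (phi_x 3 + phi_x 1 * Dphi_x 0) * 6"
      unfolding D_q p0 r0 h6 by simp
    also have "\<dots> = D (?I [(6, [Phi 5]), (3, [Phi 1, Phi 1])])"
      unfolding six unfolding I s.I_eqs by (rule arg_cong[where f = ?I]) code_simp
    finally show "D q = D (?I [(6, [Phi 5]), (3, [Phi 1, Phi 1])])" .
    show "mcoeff q {#} = mcoeff (?I [(6, [Phi 5]), (3, [Phi 1, Phi 1])]) {#}"
      by (simp add: eps_q mcoeff_simps mcoeff_mult_empty)
  qed
  have "fun_op (g + g) = L * (L * fun_op 0) + (diff_part (L * (L * M)) * Lam - Lam * diff_part (L * (L * M)))"
    by (simp add: f0 fun_op_add N(6) M_def distrib_left distrib_right diff_part_add algebra_simps)
  from next_flow_expand[OF this]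
  have "- 27 * (g + g) = (phi_x 5 + 5 * phi_x 3 * Dphi_x 0 + 5 * phi_x 2 * Dphi_x 1 + 2 * phi_x 1 * Dphi_x 2
         + 6 * phi_x 1 * (Dphi_x 0)^2) * 6 - 2 * phi_x 1 * q"
    unfolding p0 r0 h6 by (simp add: dx_def eval_nat_numeral)
  also have "\<dots> = 6 * (phi_x 5 + 5 * phi_x 3 * Dphi_x 0 + 5 * phi_x 2 * Dphi_x 1 + 5 * phi_x 1 * (Dphi_x 0)^2)"
  proof -
    have six: "x * 6 = 6 * x" for x :: "'k sdp"
      by (metis const_commute const_numeral)
    show ?thesis
      unfolding q six power2_eq_square unfolding I s.I_eqs by (rule arg_cong[where f = ?I]) code_simp
  qed
  also have "- 27 * (g + g) = 6 * - (9 * g)"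
  proof -
    have "g + g = 2 * g" by (simp add: mult_2)
    then show ?thesis by simp
  qed
  finally have "- (9 * g) = phi_x 5 + 5 * phi_x 3 * Dphi_x 0 + 5 * phi_x 2 * Dphi_x 1 + 5 * phi_x 1 * (Dphi_x 0)^2"
    by (simp only: numeral_mult_cancel)
  then have "9 * g + (phi_x 5 + 5 * phi_x 3 * Dphi_x 0 + 5 * phi_x 2 * Dphi_x 1 + 5 * phi_x 1 * (Dphi_x 0)^2) = 0"
    by (metis add.right_inverse)
  then show ?thesis by (simp only: add.assoc)
qed

text \<open>The converse needs no computation: a fifth flow exists, it satisfies the equation, and
  the equation has only one solution because 9 can be cancelled.\<close>

lemma flow_5_iff:
  fixes g :: "'k::field_char_0 sdp"
  shows "flow 5 g \<longleftrightarrow>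
    9 * g + phi_x 5 + 5 * phi_x 3 * Dphi_x 0 + 5 * phi_x 2 * Dphi_x 1 + 5 * phi_x 1 * (Dphi_x 0)^2 = 0"
    (is "_ \<longleftrightarrow> ?S g = 0")
proof
  assume "?S g = 0"
  obtain g' :: "'k sdp" where g': "flow 5 g'" using flow_ex1[of 5] by auto
  have "?S g' = 0" using g' by (rule flow_5_eq)
  with \<open>?S g = 0\<close> have "?S g = ?S g'" by simp
  then have "9 * g = 9 * g'" by (simp only: add_right_cancel)
  then have "g = g'" by (simp only: numeral_mult_cancel)
  then show "flow 5 g" using g' by simp
qed (rule flow_5_eq)

theorem mainTheorem4:
  shows
    "(\<forall>n (f :: 'k::field_char_0 sdp). flow n f \<and> f \<noteq> 0 \<longrightarrow> odd n \<and> \<not> 3 dvd n)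
     \<and> (\<forall>n. odd n \<and> \<not> 3 dvd n \<longrightarrow> (\<exists>!f :: 'k sdp. flow n f))
     \<comment> \<open>with respect to the rescaled time \<open>t\<close> with \<open>\<partial>L/\<partial>t = 9 \<partial>L/\<partial>t\<^sub>5\<close>, the \<open>t\<^sub>5\<close>-flow is the
        supersymmetric Sawada-Kotera equation\<close>
     \<and> (\<forall>f :: 'k sdp. flow 5 f \<longleftrightarrow>
          9 * f + phi_x 5 + 5 * phi_x 3 * Dphi_x 0 + 5 * phi_x 2 * Dphi_x 1 + 5 * phi_x 1 * (Dphi_x 0)^2 = 0)
     \<comment> \<open>\<open>R\<close> has leading coefficient 1, while \<open>L\<^sup>2\<close> shifts \<open>t\<^sub>n\<close> to \<open>t\<^bsub>n+6\<^esub>\<close> exactly; this fixes the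
        constant, e.g. \<open>-27\<close> times the \<open>t\<^sub>7\<close>-flow is \<open>\<phi>\<^sub>x\<^sub>x\<^sub>x\<^sub>x\<^sub>x\<^sub>x\<^sub>x + ...\<close>\<close>
     \<and> (\<forall>n (f :: 'k sdp) g. odd n \<and> \<not> 3 dvd n \<and> flow n f \<and> flow (n + 6) g
          \<longrightarrow> app recursion_op f = Some (- 27 * g))"
proof (intro conjI allI impI)
  show "odd n" "\<not> 3 dvd n" if "flow n f \<and> f \<noteq> 0" for n and f :: "'k sdp"
    using that flow_nontrivial by blast+
  show "\<exists>!f :: 'k sdp. flow n f" if "odd n \<and> \<not> 3 dvd n" for n
    using that flow_ex1 by blast
  show "flow 5 f \<longleftrightarrow>
      9 * f + phi_x 5 + 5 * phi_x 3 * Dphi_x 0 + 5 * phi_x 2 * Dphi_x 1 + 5 * phi_x 1 * (Dphi_x 0)^2 = 0"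
    for f :: "'k sdp" by (rule flow_5_iff)
  show "app recursion_op f = Some (- 27 * g)"
    if "odd n \<and> \<not> 3 dvd n \<and> flow n f \<and> flow (n + 6) g" for n and f g :: "'k sdp"
    using that recursion by blast
qed

end
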